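(* Let $k\ge 1$. Let $G$ be a connected graph on $n$ vertices which does not contain a path on $\min\{n,2k+3\}$ vertices. If every vertex of $G$, except for at most one vertex, has degree at least $k$, then $G$ is a subgraph of one of the following graphs: (i) $H(2k+2,2k+1,k)$, or $H(n,2k+2,k)$ with $n\ge 2k+3$; (ii) $K_1+(tK_k\cup K_{k+1}\cup K_1)$ with $t\ge 1$; (iii) the graph obtained from vertex-disjoint copies of $K_1+sK_k$ and $K_1+(tK_k\cup K_1)$, with $s\ge 1$, $t\ge 1$, by adding an edge joining their centers (the center of $K_1+sK_k$ is the $K_1$-vertex, of degree $sk$; the center of $K_1+(tK_k\cup K_1)$ is the first $K_1$-vertex, of degree $tk+1$); (iv) when $k=2$: $K_1+M_t$ with $t\ge 6$, or $K_1+(S_s\cup M_t)$ with $s+t\ge 6$; when $k=3$: $K_2+M_t$ with $t\ge 7$.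
   Context: Graphs are finite and simple. For graphs $G,H$, $G\cup H$ is their vertex-disjoint union, $G+H$ is obtained from $G\cup H$ by joining every vertex of $G$ to every vertex of $H$, and $kH$ is the disjoint union of $k$ copies of $H$. $K_m$ is the complete graph on $m$ vertices. $H(n,\ell,a)$: the $n$-vertex graph with vertex partition $A\cup B\cup C$, $|A|=a$, $|B|=n-\ell+a$, $|C|=\ell-2a$, whose edges are all pairs between $A$ and $B$ and all pairs inside $A\cup C$. $S_s=K_{1,s-1}$ is the star on $s$ vertices; $M_t$ is the graph on $t$ vertices consisting of a matching with $\lfloor t/2\rfloor$ edges plus one isolated vertex if $t$ is odd. *)

theory Defs
  imports "Graph_Theory.Graph_Theory"
begin

text \<open>
  A finite simple graph is a \<^typ>\<open>'a pair_pre_digraph\<close> satisfying \<^const>\<open>pair_graph\<close>: every edge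
  \<open>uv\<close> is represented by the two arcs \<open>(u, v)\<close> and \<open>(v, u)\<close>, so the degree of a vertex is its
  \<^const>\<open>out_degree\<close>.
\<close>

definition complete_graph :: "nat \<Rightarrow> nat pair_pre_digraph" where
  "complete_graph m = \<lparr> pverts = {..<m}, parcs = {(u, v). u < m \<and> v < m \<and> u \<noteq> v} \<rparr>"

definition graph_union ::
  "'a pair_pre_digraph \<Rightarrow> 'b pair_pre_digraph \<Rightarrow> ('a + 'b) pair_pre_digraph" where
  "graph_union G H = \<lparr>
     pverts = Inl ` pverts G \<union> Inr ` pverts H,
     parcs = map_prod Inl Inl ` parcs G \<union> map_prod Inr Inr ` parcs H \<rparr>"

definition graph_join ::
  "'a pair_pre_digraph \<Rightarrow> 'b pair_pre_digraph \<Rightarrow> ('a + 'b) pair_pre_digraph" where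
  "graph_join G H = \<lparr>
     pverts = pverts (graph_union G H),
     parcs = parcs (graph_union G H)
       \<union> Inl ` pverts G \<times> Inr ` pverts H \<union> Inr ` pverts H \<times> Inl ` pverts G \<rparr>"

definition copies :: "nat \<Rightarrow> 'a pair_pre_digraph \<Rightarrow> (nat \<times> 'a) pair_pre_digraph" where
  "copies k H = \<lparr>
     pverts = {..<k} \<times> pverts H,
     parcs = {((i, u), (i, v)) | i u v. i < k \<and> (u, v) \<in> parcs H} \<rparr>"

definition add_edge :: "'a \<Rightarrow> 'a \<Rightarrow> 'a pair_pre_digraph \<Rightarrow> 'a pair_pre_digraph" where
  "add_edge u v G = \<lparr> pverts = pverts G \<union> {u, v}, parcs = parcs G \<union> {(u, v), (v, u)} \<rparr>"

text \<open>
  The graph \<open>H(n, l, a)\<close>. When \<open>2 * a \<le> l\<close> and \<open>l \<le> n + a\<close> the vertex set \<open>{..<n}\<close> is split into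
  consecutive intervals \<open>A\<close>, \<open>C\<close>, \<open>B\<close> of sizes \<open>a\<close>, \<open>l - 2 * a\<close> and \<open>n - l + a\<close>.
\<close>

definition H_graph :: "nat \<Rightarrow> nat \<Rightarrow> nat \<Rightarrow> nat pair_pre_digraph" where
  "H_graph n l a = (let A = {..<a}; C = {a..<l - a}; B = {l - a..<n} in \<lparr>
     pverts = A \<union> B \<union> C,
     parcs = A \<times> B \<union> B \<times> A \<union> {(u, v). u \<in> A \<union> C \<and> v \<in> A \<union> C \<and> u \<noteq> v} \<rparr>)"

text \<open>The star \<open>S\<^sub>s = K\<^bsub>1,s-1\<^esub>\<close> on \<open>s \<ge> 1\<close> vertices, with center \<open>0\<close>.\<close>

definition star_graph :: "nat \<Rightarrow> nat pair_pre_digraph" where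
  "star_graph s = \<lparr> pverts = {..<s}, parcs = {0} \<times> {1..<s} \<union> {1..<s} \<times> {0} \<rparr>"

text \<open>The edges of \<open>M\<^sub>t\<close> are the pairs \<open>{2 * i, 2 * i + 1}\<close> with \<open>2 * i + 1 < t\<close>.\<close>

definition matching_graph :: "nat \<Rightarrow> nat pair_pre_digraph" where
  "matching_graph t = \<lparr> pverts = {..<t},
     parcs = {(u, v). u < t \<and> v < t \<and> u \<noteq> v \<and> u div 2 = v div 2} \<rparr>"

text \<open>
  \<open>K\<^sub>1 + s K\<^sub>k\<close> and \<open>K\<^sub>1 + (t K\<^sub>k \<union> K\<^sub>1)\<close> with their centers joined by an edge; both centers are the
  vertex \<open>0\<close> of the left operand of the respective join.
\<close>

definition linked_graph ::
  "nat \<Rightarrow> nat \<Rightarrow> nat \<Rightarrow> ((nat + nat \<times> nat) + (nat + (nat \<times> nat + nat))) pair_pre_digraph" where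
  "linked_graph k s t = add_edge (Inl (Inl 0)) (Inr (Inl 0))
     (graph_union
       (graph_join (complete_graph 1) (copies s (complete_graph k)))
       (graph_join (complete_graph 1)
         (graph_union (copies t (complete_graph k)) (complete_graph 1))))"

text \<open>``\<open>G\<close> is a subgraph of \<open>H\<close>'' for graphs given up to isomorphism.\<close>

definition is_subgraph_of :: "'a pair_pre_digraph \<Rightarrow> 'b pair_pre_digraph \<Rightarrow> bool" where
  "is_subgraph_of G H \<longleftrightarrow>
     (\<exists>H'. subgraph H' (with_proj H) \<and> digraph_iso (with_proj G) H')"

definition contains_path_on :: "'a pair_pre_digraph \<Rightarrow> nat \<Rightarrow> bool" where
  "contains_path_on G m \<longleftrightarrow> (\<exists>p. vpath p (with_proj G) \<and> length p = m)"


lemma pair_graphI':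
  assumes "finite (pverts G)"
    and "\<And>u v. (u, v) \<in> parcs G \<Longrightarrow> u \<in> pverts G \<and> u \<noteq> v \<and> (v, u) \<in> parcs G"
  shows "pair_graph G"
proof -
  have "parcs G \<subseteq> pverts G \<times> pverts G"
    by (intro subrelI SigmaI) (auto dest!: assms(2) intro: assms(2)[THEN conjunct1])
  then have "finite (parcs G)" using assms(1) by (meson finite_SigmaI finite_subset)
  moreover have "symmetric (with_proj G)"
    using assms(2) by (simp add: symmetric_def sym_def)
  moreover have "fst e \<in> pverts G" "snd e \<in> pverts G" "fst e \<noteq> snd e" if "e \<in> parcs G" for e
    using assms(2)[of "fst e" "snd e"] assms(2)[of "snd e" "fst e"] that by simp_all
  ultimately show ?thesis
    using assms(1) by unfold_locales
qed

lemma pair_graphD':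
  assumes "pair_graph G"
  shows "finite (pverts G)"
    and "(u, v) \<in> parcs G \<Longrightarrow> u \<in> pverts G \<and> v \<in> pverts G \<and> u \<noteq> v \<and> (v, u) \<in> parcs G"
proof -
  interpret pair_graph G by fact
  show "finite (pverts G)" by simp
  show "(u, v) \<in> parcs G \<Longrightarrow> u \<in> pverts G \<and> v \<in> pverts G \<and> u \<noteq> v \<and> (v, u) \<in> parcs G"
    by (auto intro: arcs_symmetric dest: in_arcsD1 in_arcsD2 no_loops')
qed

lemma pair_graph_complete_graph: "pair_graph (complete_graph m)"
  by (rule pair_graphI') (auto simp: complete_graph_def)

lemma complete_digraph_complete_graph: "complete_digraph m (with_proj (complete_graph m))"
  unfolding complete_digraph_def
  using pair_graph.pair_graphD_graph[OF pair_graph_complete_graph]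
  by (auto simp: complete_graph_def)

lemma pair_graph_graph_union:
  assumes "pair_graph G" "pair_graph H"
  shows "pair_graph (graph_union G H)"
proof (rule pair_graphI')
  note G = pair_graphD'[OF assms(1)] and H = pair_graphD'[OF assms(2)]
  show "finite (pverts (graph_union G H))" using G(1) H(1) by (simp add: graph_union_def)
  fix u v assume "(u, v) \<in> parcs (graph_union G H)"
  then consider (l) x y where "u = Inl x" "v = Inl y" "(x, y) \<in> parcs G"
    | (r) x y where "u = Inr x" "v = Inr y" "(x, y) \<in> parcs H"
    by (auto simp: graph_union_def)
  then show "u \<in> pverts (graph_union G H) \<and> u \<noteq> v \<and> (v, u) \<in> parcs (graph_union G H)"
  proof cases
    case l
    with G(2)[of x y] show ?thesis by (force simp: graph_union_def)
  next
    case r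
    with H(2)[of x y] show ?thesis by (force simp: graph_union_def)
  qed
qed

lemma pair_graph_graph_join:
  assumes "pair_graph G" "pair_graph H"
  shows "pair_graph (graph_join G H)"
proof (rule pair_graphI')
  note U = pair_graphD'[OF pair_graph_graph_union[OF assms]]
  show "finite (pverts (graph_join G H))" using U(1) by (simp add: graph_join_def)
  fix u v assume "(u, v) \<in> parcs (graph_join G H)"
  then show "u \<in> pverts (graph_join G H) \<and> u \<noteq> v \<and> (v, u) \<in> parcs (graph_join G H)"
    using U(2)[of u v] by (auto simp: graph_join_def graph_union_def)
qed

lemma pair_graph_copies:
  assumes "pair_graph H"
  shows "pair_graph (copies k H)"
proof (rule pair_graphI')
  show "finite (pverts (copies k H))" using pair_graphD'(1)[OF assms] by (simp add: copies_def)
  fix u v assume "(u, v) \<in> parcs (copies k H)"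
  then obtain i x y where "u = (i, x)" "v = (i, y)" "i < k" "(x, y) \<in> parcs H"
    by (auto simp: copies_def)
  with pair_graphD'(2)[OF assms, of x y]
  show "u \<in> pverts (copies k H) \<and> u \<noteq> v \<and> (v, u) \<in> parcs (copies k H)"
    by (simp add: copies_def)
qed

lemma pair_graph_add_edge:
  assumes "pair_graph G" "u \<noteq> v"
  shows "pair_graph (add_edge u v G)"
proof (rule pair_graphI')
  show "finite (pverts (add_edge u v G))"
    using pair_graphD'(1)[OF assms(1)] by (simp add: add_edge_def)
  fix x y assume "(x, y) \<in> parcs (add_edge u v G)"
  then show "x \<in> pverts (add_edge u v G) \<and> x \<noteq> y \<and> (y, x) \<in> parcs (add_edge u v G)"
    using pair_graphD'(2)[OF assms(1), of x y] assms(2) by (auto simp: add_edge_def)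
qed

lemma pair_graph_H_graph: "pair_graph (H_graph n l a)"
  if "2 * a \<le> l" "l \<le> n + a"
  using that by (intro pair_graphI') (auto simp: H_graph_def Let_def)

lemma pverts_H_graph: "pverts (H_graph n l a) = {..<n}" if "2 * a \<le> l" "l \<le> n + a"
  using that by (auto simp: H_graph_def Let_def)

lemma pair_graph_star_graph: "pair_graph (star_graph s)"
  by (rule pair_graphI') (auto simp: star_graph_def)

lemma complete_bipartite_star_graph:
  assumes "s \<ge> 1"
  shows "complete_bipartite_digraph 1 (s - 1) (with_proj (star_graph s))"
  unfolding complete_bipartite_digraph_def
proof (intro conjI exI)
  show "graph (with_proj (star_graph s))"
    by (rule pair_graph.pair_graphD_graph[OF pair_graph_star_graph])
  show "verts (with_proj (star_graph s)) = {0} \<union> {1..<s}"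
    using assms by (auto simp: star_graph_def)
qed (simp_all add: star_graph_def)

lemma pair_graph_matching_graph: "pair_graph (matching_graph t)"
  by (rule pair_graphI') (auto simp: matching_graph_def)

lemma pair_graph_linked_graph: "pair_graph (linked_graph k s t)"
  unfolding linked_graph_def
  by (intro pair_graph_add_edge pair_graph_graph_union pair_graph_graph_join pair_graph_copies
      pair_graph_complete_graph) simp

lemma is_subgraph_of_iff:
  assumes "pair_wf_digraph G" "pair_wf_digraph H"
  shows "is_subgraph_of G H \<longleftrightarrow>
    (\<exists>f. inj_on f (pverts G) \<and> f ` pverts G \<subseteq> pverts H \<and>
      (\<forall>u v. (u, v) \<in> parcs G \<longrightarrow> (f u, f v) \<in> parcs H))" (is "_ \<longleftrightarrow> ?R")
proof -
  have wf: "wf_digraph (with_proj G)" "wf_digraph (with_proj H)"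
    using assms by (simp_all add: wf_digraph_wp_iff)
  have G: "u \<in> pverts G" "v \<in> pverts G" if "(u, v) \<in> parcs G" for u v
    using assms(1) that by (simp_all add: pair_wf_digraph.in_arcsD1 pair_wf_digraph.in_arcsD2)
  show ?thesis
  proof
    assume "is_subgraph_of G H"
    then obtain h where h: "pre_digraph.digraph_isomorphism (with_proj G) h"
        and sub: "subgraph (app_iso h (with_proj G)) (with_proj H)"
      unfolding is_subgraph_of_def digraph_iso_def by blast
    have ht: "iso_tail h = fst" "iso_head h = snd"
      using sub by (simp_all add: subgraph_def compatible_def)
    let ?f = "iso_verts h"
    have arcs: "(?f u, ?f v) \<in> parcs H" if "(u, v) \<in> parcs G" for u v
    proof -
      have "iso_arcs h (u, v) = (?f u, ?f v)"
        using h that by (auto simp: pre_digraph.digraph_isomorphism_def ht prod_eq_iff)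
      moreover have "iso_arcs h (u, v) \<in> parcs H"
        using sub that by (auto simp: subgraph_def)
      ultimately show ?thesis by simp
    qed
    have "inj_on ?f (pverts G)"
      using pre_digraph.digraph_isomorphism_inj_on_verts[OF h] by simp
    moreover have "?f ` pverts G \<subseteq> pverts H"
      using sub by (simp add: subgraph_def)
    ultimately show ?R using arcs by blast
  next
    assume ?R
    then obtain f where f: "inj_on f (pverts G)" "f ` pverts G \<subseteq> pverts H"
        "\<And>u v. (u, v) \<in> parcs G \<Longrightarrow> (f u, f v) \<in> parcs H"
      by blast
    define h where "h = \<lparr> iso_verts = f, iso_arcs = map_prod f f, iso_head = snd, iso_tail = fst \<rparr>"
    have "inj_on (map_prod f f) (parcs G)"
    proof (rule inj_on_subset)
      show "inj_on (map_prod f f) (pverts G \<times> pverts G)"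
        by (rule map_prod_inj_on) (rule f(1))+
      show "parcs G \<subseteq> pverts G \<times> pverts G" by (intro subrelI SigmaI G)
    qed
    then have iso: "pre_digraph.digraph_isomorphism (with_proj G) h"
      using f(1) wf(1) by (simp add: pre_digraph.digraph_isomorphism_def h_def)
    have "map_prod f f ` parcs G \<subseteq> parcs H" using f(3) by auto
    then have "subgraph (app_iso h (with_proj G)) (with_proj H)"
      using wf_digraph.wf_digraphI_app_iso[OF wf(1) iso] wf(2) f(2)
      by (simp add: subgraph_def h_def compatible_def)
    with iso show "is_subgraph_of G H"
      unfolding is_subgraph_of_def digraph_iso_def by blast
  qed
qed

end

theory Submission
  imports Defs "HOL-Combinatorics.Cycles"
begin

text \<open>
  Let \<open>m\<close> be the order of a longest path; then \<open>m \<le> 2k + 2\<close> and \<open>m < n\<close>.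

  If there is a cycle \<open>C\<close> of length \<open>m - 1\<close>, the vertices off \<open>C\<close> are independent. One of them has a
  set \<open>A\<close> of at least \<open>k\<close> pairwise non-consecutive neighbours on \<open>C\<close>, and both the successors and
  the predecessors of \<open>A\<close> on \<open>C\<close> are independent, so \<open>|A| = k\<close> and \<open>A\<close> covers all edges but at most
  one: this is (i).

  Otherwise suppose that both ends of some longest path have degree at least \<open>k\<close>. Counting
  neighbours of the two ends along the path, without the crossings that would close a cycle of
  length \<open>m\<close> or \<open>m - 1\<close>, leaves two possibilities. Either a crossing yields a cycle of length \<open>2k\<close>
  with an edge off it, which gives (i) again unless \<open>k\<close> is 2 or 3, where the small cases (iv)
  appear; or the neighbours of one end precede those of the other, and rotating the path at its ends
  exposes a cut vertex, or two adjacent ones, whose removal leaves components of at most \<open>k\<close>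
  vertices (one of them possibly of \<open>k + 1\<close>): this is (ii), (iii), or a star in (iv) for \<open>k = 2\<close>.

  Finally, if no longest path has both ends of degree at least \<open>k\<close>, rotations show that the
  exceptional vertex is a leaf, and the previous analysis applies to the graph without it.
\<close>

section \<open>Paths and cycles\<close>

locale simple_graph =
  fixes V :: "'a set" and adj :: "'a \<Rightarrow> 'a \<Rightarrow> bool"
  assumes finite_V: "finite V"
    and adj_V: "adj x y \<Longrightarrow> x \<in> V \<and> y \<in> V"
    and adj_irrefl: "\<not> adj x x"
    and adj_sym: "adj x y \<Longrightarrow> adj y x"
begin

definition nbrs :: "'a \<Rightarrow> 'a set" where
  "nbrs x = {y. adj x y}"

abbreviation deg :: "'a \<Rightarrow> nat" where
  "deg x \<equiv> card (nbrs x)"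

definition is_path :: "'a list \<Rightarrow> bool" where
  "is_path xs \<longleftrightarrow> xs \<noteq> [] \<and> distinct xs \<and> set xs \<subseteq> V \<and> successively adj xs"

definition is_cycle :: "'a list \<Rightarrow> bool" where
  "is_cycle xs \<longleftrightarrow> 3 \<le> length xs \<and> is_path xs \<and> adj (last xs) (hd xs)"

definition has_cycle :: "nat \<Rightarrow> bool" where
  "has_cycle l \<longleftrightarrow> (\<exists>C. is_cycle C \<and> length C = l)"

definition paths_bounded :: "nat \<Rightarrow> bool" where
  "paths_bounded m \<longleftrightarrow> (\<forall>p. is_path p \<longrightarrow> length p \<le> m)"

definition is_connected :: bool where
  "is_connected \<longleftrightarrow> (\<forall>S. S \<subseteq> V \<longrightarrow> S \<noteq> {} \<longrightarrow> S \<noteq> V \<longrightarrow> (\<exists>x\<in>S. \<exists>y\<in>V - S. adj x y))"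

lemma adj_commute: "adj x y \<longleftrightarrow> adj y x"
  using adj_sym by blast

lemma adj_neq: "adj x y \<Longrightarrow> x \<noteq> y"
  using adj_irrefl by blast

lemma mem_nbrs [simp]: "y \<in> nbrs x \<longleftrightarrow> adj x y"
  by (simp add: nbrs_def)

lemma nbrs_subsetD: "nbrs x \<subseteq> S \<Longrightarrow> adj x y \<Longrightarrow> y \<in> S"
  by auto

lemma nbrs_subset: "nbrs x \<subseteq> V"
  using adj_V by auto

lemma finite_nbrs [simp]: "finite (nbrs x)"
  using nbrs_subset finite_V by (rule finite_subset)

lemma successively_adj_rev: "successively adj (rev xs) \<longleftrightarrow> successively adj xs"
proof -
  have "(\<lambda>x y. adj y x) = adj" using adj_commute by (intro ext) blast
  then show ?thesis using successively_rev[of adj xs] by (simp only:)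
qed

lemma is_path_rev [simp]: "is_path (rev xs) \<longleftrightarrow> is_path xs"
  unfolding is_path_def using successively_adj_rev by (auto simp del: successively_rev)

lemma is_path_append_iff:
  "xs \<noteq> [] \<Longrightarrow> ys \<noteq> [] \<Longrightarrow> is_path (xs @ ys) \<longleftrightarrow>
     is_path xs \<and> is_path ys \<and> set xs \<inter> set ys = {} \<and> adj (last xs) (hd ys)"
  unfolding is_path_def by (auto simp: successively_append_iff)

lemma is_path_Cons_iff:
  "xs \<noteq> [] \<Longrightarrow> is_path (x # xs) \<longleftrightarrow> is_path xs \<and> x \<notin> set xs \<and> adj x (hd xs)"
  using adj_V[of x "hd xs"] unfolding is_path_def by (auto simp: successively_Cons)

lemma is_path_singleton [simp]: "is_path [x] \<longleftrightarrow> x \<in> V"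
  by (simp add: is_path_def)

lemma is_path_pair [simp]: "is_path [x, y] \<longleftrightarrow> adj x y"
  using adj_V[of x y] adj_neq[of x y] by (auto simp: is_path_Cons_iff)

lemma not_is_path_Nil [simp]: "\<not> is_path []"
  by (simp add: is_path_def)

lemma is_pathD:
  assumes "is_path xs"
  shows "xs \<noteq> []" "distinct xs" "set xs \<subseteq> V"
  using assms by (auto simp: is_path_def)

lemma is_path_snoc_iff:
  "xs \<noteq> [] \<Longrightarrow> is_path (xs @ [x]) \<longleftrightarrow> is_path xs \<and> x \<notin> set xs \<and> adj (last xs) x"
  using is_path_append_iff[of xs "[x]"] adj_V[of "last xs" x] by auto

lemma is_path_appendI:
  "is_path xs \<Longrightarrow> is_path ys \<Longrightarrow> set xs \<inter> set ys = {} \<Longrightarrow> adj (last xs) (hd ys) \<Longrightarrow> is_path (xs @ ys)"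
  using is_path_append_iff[of xs ys] is_pathD(1) by blast

lemma is_path_take:
  assumes "is_path xs" "0 < i"
  shows "is_path (take i xs)"
proof (cases "drop i xs = []")
  case False
  then show ?thesis
    using assms is_path_append_iff[of "take i xs" "drop i xs"] is_pathD(1)[OF assms(1)] by simp
qed (use assms in simp)

lemma is_path_drop: "is_path xs \<Longrightarrow> i < length xs \<Longrightarrow> is_path (drop i xs)"
  using is_path_append_iff[of "take i xs" "drop i xs"] by (cases "i = 0"; cases "xs = []") auto

lemma is_path_nth_adj: "is_path xs \<Longrightarrow> Suc i < length xs \<Longrightarrow> adj (xs ! i) (xs ! Suc i)"
  unfolding is_path_def using successively_nth by metis

lemma is_path_nth_eq_iff:
  "is_path xs \<Longrightarrow> i < length xs \<Longrightarrow> j < length xs \<Longrightarrow> xs ! i = xs ! j \<longleftrightarrow> i = j"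
  using is_pathD(2) nth_eq_iff_index_eq by blast

lemma is_path_nth_in_V: "is_path xs \<Longrightarrow> i < length xs \<Longrightarrow> xs ! i \<in> V"
  using is_pathD(3) nth_mem by blast

lemma card_set_path: "is_path xs \<Longrightarrow> card (set xs) = length xs"
  using is_pathD(2) distinct_card by blast

lemma length_path_le: "is_path xs \<Longrightarrow> length xs \<le> card V"
  using card_set_path is_pathD(3) finite_V card_mono by metis

lemma exists_path_of_length:
  assumes "is_path xs" "0 < i" "i \<le> length xs"
  shows "\<exists>ys. is_path ys \<and> length ys = i"
  using is_path_take[OF assms(1,2)] assms by (intro exI[of _ "take i xs"]) simp

lemma paths_boundedD: "paths_bounded m \<Longrightarrow> is_path p \<Longrightarrow> length p \<le> m"
  by (simp add: paths_bounded_def)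

lemma has_cycleI: "is_cycle C \<Longrightarrow> length C = l \<Longrightarrow> has_cycle l"
  by (auto simp: has_cycle_def)

lemma connectedE:
  assumes is_connected "S \<subseteq> V" "S \<noteq> {}" "S \<noteq> V"
  obtains x y where "x \<in> S" "y \<in> V - S" "adj x y"
  using assms unfolding is_connected_def by blast

lemma is_cycle_rotate: "is_cycle C \<Longrightarrow> is_cycle (rotate n C)"
proof (induction n)
  case (Suc n)
  have "is_cycle (rotate1 D)" if cycle_D: "is_cycle D" for D
  proof -
    obtain x xs where D_eq: "D = x # xs" "xs \<noteq> []"
      using cycle_D by (cases D; cases "tl D") (auto simp: is_cycle_def)
    have "is_path (xs @ [x])" "adj x (hd xs)"
      using cycle_D D_eq by (auto simp: is_cycle_def is_path_Cons_iff is_path_snoc_iff)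
    then show ?thesis using cycle_D D_eq by (simp add: is_cycle_def)
  qed
  then show ?case using Suc by simp
qed simp

end

lemma map_cycle_of_list: "distinct C \<Longrightarrow> map (cycle_of_list C) C = rotate1 C"
  using cyclic_rotation[of C 1] by simp

lemma cycle_of_list_last:
  assumes "distinct C" "C \<noteq> []"
  shows "cycle_of_list C (last C) = hd C"
proof -
  have "cycle_of_list C (last C) = last (map (cycle_of_list C) C)"
    using assms(2) by (simp add: last_map)
  also have "\<dots> = hd C"
    using assms by (simp add: map_cycle_of_list rotate1_hd_tl)
  finally show ?thesis .
qed

lemma cycle_of_list_consecutive:
  assumes "distinct C" and C_eq: "C = xs @ x # y # ys"
  shows "cycle_of_list C x = y"
proof -
  have "cycle_of_list C x = cycle_of_list C (C ! length xs)" by (simp only: C_eq nth_append_length)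
  also have "\<dots> = map (cycle_of_list C) C ! length xs" by (subst nth_map) (simp_all add: C_eq)
  also have "\<dots> = rotate1 C ! length xs" using map_cycle_of_list[OF assms(1)] by simp
  also have "\<dots> = y" unfolding C_eq by (cases xs) (auto simp: nth_append)
  finally show ?thesis .
qed

declare cycle_of_list.simps [simp del]

text \<open>\<open>\<sigma>\<close> moves every vertex of the cycle to the next one.\<close>

locale graph_with_cycle = simple_graph V adj for V :: "'a set" and adj +
  fixes C :: "'a list"
  assumes cycle_C: "is_cycle C"
begin

abbreviation \<sigma> :: "'a \<Rightarrow> 'a" where
  "\<sigma> \<equiv> cycle_of_list C"

lemma distinct_C: "distinct C" and C_V: "set C \<subseteq> V" and length_C: "3 \<le> length C"
  using cycle_C is_pathD unfolding is_cycle_def by auto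

lemma card_C: "card (set C) = length C"
  using distinct_C by (rule distinct_card)

lemma next_in_iff [simp]: "\<sigma> x \<in> set C \<longleftrightarrow> x \<in> set C"
  by (rule permutes_in_image[OF cycle_permutes])

lemma next_image_subset: "X \<subseteq> set C \<Longrightarrow> \<sigma> ` X \<subseteq> set C"
  by auto

lemma inj_next: "inj \<sigma>"
  by (rule permutes_inj[OF cycle_permutes])

lemma card_next_image [simp]: "card (\<sigma> ` X) = card X"
  using inj_next by (simp add: card_image inj_on_subset)

lemma ex_previous: "x \<in> set C \<Longrightarrow> \<exists>y\<in>set C. \<sigma> y = x"
  using permutes_image[OF cycle_permutes, of C] by (metis image_iff)

lemma rotation_ending_at:
  assumes "x \<in> set C"
  obtains Q where "is_cycle Q" "set Q = set C" "length Q = length C" "hd Q = \<sigma> x" "last Q = x"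
    "cycle_of_list Q = \<sigma>"
proof -
  obtain as bs where C_split: "C = as @ x # bs" using assms by (meson split_list)
  define Q where "Q = rotate (Suc (length as)) C"
  have "Q = bs @ as @ [x]" using rotate_append[of "as @ [x]" bs] by (simp add: Q_def C_split)
  then have last_Q: "last Q = x" by simp
  have cycle_Q: "is_cycle Q" unfolding Q_def by (rule is_cycle_rotate[OF cycle_C])
  have \<sigma>: "cycle_of_list Q = \<sigma>"
    unfolding Q_def by (rule cycle_of_list_rotate_independent[OF distinct_C, symmetric])
  have "distinct Q" "Q \<noteq> []" using cycle_Q is_pathD by (auto simp: is_cycle_def)
  then have "hd Q = \<sigma> x" using cycle_of_list_last[of Q] last_Q \<sigma> by simp
  moreover have "set Q = set C" "length Q = length C" by (simp_all add: Q_def)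
  ultimately show thesis using that cycle_Q last_Q \<sigma> by blast
qed

lemma next_adj: "x \<in> set C \<Longrightarrow> adj x (\<sigma> x)"
  by (rule rotation_ending_at) (auto simp: is_cycle_def)

lemma next_next_neq:
  assumes "x \<in> set C"
  shows "\<sigma> (\<sigma> x) \<noteq> x"
proof -
  obtain Q where cycle_Q: "is_cycle Q" "length Q = length C" "hd Q = \<sigma> x" "last Q = x"
    "cycle_of_list Q = \<sigma>"
    using rotation_ending_at[OF assms] by metis
  obtain y z zs where Q_eq: "Q = [] @ y # z # zs" "zs \<noteq> []"
    using cycle_Q(2) length_C by (cases Q; cases "tl Q"; cases "tl (tl Q)") auto
  have distinct_Q: "distinct Q" using cycle_Q(1) is_pathD(2) by (auto simp: is_cycle_def)
  have "y = \<sigma> x" using cycle_Q(3) Q_eq by simp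
  then have "\<sigma> (\<sigma> x) = z" using cycle_of_list_consecutive[OF distinct_Q Q_eq(1)] cycle_Q(5) by simp
  moreover have "z \<noteq> last zs" using distinct_Q Q_eq by auto
  ultimately show ?thesis using cycle_Q(4) Q_eq by auto
qed

lemma split_cycle:
  assumes "x \<in> set C" "y \<in> set C" "x \<noteq> y"
  obtains xs ys where "is_path (xs @ ys)" "xs \<noteq> []" "ys \<noteq> []" "set (xs @ ys) = set C"
    "length (xs @ ys) = length C" "hd xs = \<sigma> x" "last xs = y" "hd ys = \<sigma> y" "last ys = x"
proof -
  obtain Q
    where cycle_Q: "is_cycle Q" "set Q = set C" "length Q = length C" "hd Q = \<sigma> x" "last Q = x"
    "cycle_of_list Q = \<sigma>"
    using rotation_ending_at[OF assms(1)] by metis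
  obtain as bs where Q_split: "Q = as @ y # bs" using assms(2) cycle_Q(2) by (metis split_list)
  then have "bs \<noteq> []" using cycle_Q(5) assms(3) by auto
  then obtain z cs where bs_eq: "bs = z # cs" by (cases bs) auto
  have path_Q: "is_path Q" using cycle_Q(1) by (simp add: is_cycle_def)
  then have "\<sigma> y = z"
    using cycle_of_list_consecutive[OF is_pathD(2)[OF path_Q], of as y z cs] cycle_Q(6) Q_split
      bs_eq
    by simp
  moreover have "hd (as @ [y]) = \<sigma> x" using cycle_Q(4) Q_split by (cases as) auto
  ultimately show thesis
    using that[of "as @ [y]" bs] cycle_Q path_Q Q_split bs_eq by auto
qed

lemma spanning_path_to_next:
  assumes "x \<in> set C"
  obtains Q where "is_path Q" "set Q = set C" "length Q = length C" "hd Q = x" "last Q = \<sigma> x"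
proof -
  obtain Q where Q: "is_cycle Q" "set Q = set C" "length Q = length C" "hd Q = \<sigma> x" "last Q = x"
    using rotation_ending_at[OF assms] by metis
  then have "Q \<noteq> []" "is_path Q" using is_pathD(1) by (auto simp: is_cycle_def)
  then show thesis using Q by (intro that[of "rev Q"]) (auto simp: hd_rev last_rev)
qed

lemma path_through_cycle_edge:
  assumes "x \<in> set C" "is_path p" "is_path q" "set p \<inter> set C = {}" "set q \<inter> set C = {}"
    "set p \<inter> set q = {}" "adj (last p) x" "adj (\<sigma> x) (hd q)"
  obtains P where "is_path P" "length P = length p + length C + length q"
proof -
  obtain Q where Q: "is_path Q" "set Q = set C" "length Q = length C" "hd Q = x" "last Q = \<sigma> x"
    using spanning_path_to_next[OF assms(1)] .
  have nonempty: "p \<noteq> []" "q \<noteq> []" "Q \<noteq> []" using is_pathD(1) assms Q by auto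
  have "is_path (Q @ q)" using Q assms nonempty by (auto simp: is_path_append_iff)
  then have "is_path (p @ Q @ q)" using Q assms nonempty by (subst is_path_append_iff) auto
  then show thesis using that[of "p @ Q @ q"] Q by simp
qed

lemma path_into_cycle:
  assumes "x \<in> set C" "is_path p" "set p \<inter> set C = {}" "adj (last p) x"
  obtains P where "is_path P" "length P = length p + length C"
proof -
  obtain Q where Q: "is_path Q" "set Q = set C" "length Q = length C" "hd Q = x"
    using spanning_path_to_next[OF assms(1)] by metis
  then have "is_path (p @ Q)" using assms by (intro is_path_appendI) auto
  then show thesis using that[of "p @ Q"] Q by simp
qed

lemma path_longer_than_cycle:
  assumes "is_connected" "length C < card V"
  obtains P where "is_path P" "length P = Suc (length C)"
proof -
  have "set C \<noteq> V" "set C \<noteq> {}" using card_C assms(2) length_C by auto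
  then obtain x y where "x \<in> set C" "y \<in> V - set C" "adj x y"
    using connectedE[OF assms(1) C_V] by blast
  then show thesis using path_into_cycle[of x "[y]"] that by (auto simp: adj_commute)
qed

end

lemma (in simple_graph) graph_with_cycleI: "is_cycle C \<Longrightarrow> graph_with_cycle V adj C"
  by unfold_locales

lemma (in simple_graph) no_cycle_of_bounded_length:
  assumes "is_connected" "paths_bounded m" "m < card V"
  shows "\<not> has_cycle m"
proof
  assume "has_cycle m"
  then obtain C where C_cycle: "is_cycle C" "length C = m" by (auto simp: has_cycle_def)
  interpret graph_with_cycle V adj C using C_cycle(1) by (rule graph_with_cycleI)
  obtain P where "is_path P" "length P = Suc m"
    using path_longer_than_cycle assms(1,3) C_cycle(2) by blast
  then show False using paths_boundedD[OF assms(2)] by fastforce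
qed

locale nearly_min_degree = simple_graph V adj for V :: "'a set" and adj +
  fixes k :: nat
  assumes connected: is_connected
    and low_unique: "x \<in> V \<Longrightarrow> y \<in> V \<Longrightarrow> deg x < k \<Longrightarrow> deg y < k \<Longrightarrow> x = y"
    and k_pos: "1 \<le> k"
begin

lemma deg_ge_or: "x \<in> V \<Longrightarrow> y \<in> V \<Longrightarrow> x \<noteq> y \<Longrightarrow> k \<le> deg x \<or> k \<le> deg y"
  using low_unique by (meson not_le)

lemma deg_ge: "deg w < k \<Longrightarrow> w \<in> V \<Longrightarrow> x \<in> V \<Longrightarrow> x \<noteq> w \<Longrightarrow> k \<le> deg x"
  using deg_ge_or by fastforce

end

section \<open>Components after deleting vertices\<close>

context simple_graph begin

definition component :: "'a set \<Rightarrow> 'a \<Rightarrow> 'a set" where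
  "component Z x = {y. (x, y) \<in> {(a, b). adj a b \<and> a \<notin> Z \<and> b \<notin> Z}\<^sup>*}"

definition separates :: "'a \<Rightarrow> 'a set \<Rightarrow> bool" where
  "separates c D \<longleftrightarrow> (\<forall>x\<in>D. nbrs x \<subseteq> insert c D)"

lemma component_refl [simp]: "x \<in> component Z x"
  by (simp add: component_def)

lemma component_sym: "y \<in> component Z x \<Longrightarrow> x \<in> component Z y"
proof -
  have "sym {(a, b). adj a b \<and> a \<notin> Z \<and> b \<notin> Z}" using adj_sym by (auto simp: sym_def)
  then show "y \<in> component Z x \<Longrightarrow> x \<in> component Z y"
    unfolding component_def using sym_rtrancl[THEN symD] by fastforce
qed

lemma component_trans: "y \<in> component Z x \<Longrightarrow> z \<in> component Z y \<Longrightarrow> z \<in> component Z x"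
  unfolding component_def by (auto intro: rtrancl_trans)

lemma component_eq: "y \<in> component Z x \<Longrightarrow> component Z y = component Z x"
  using component_trans component_sym by blast

lemma component_step:
  "y \<in> component Z x \<Longrightarrow> adj y z \<Longrightarrow> y \<notin> Z \<Longrightarrow> z \<notin> Z \<Longrightarrow> z \<in> component Z x"
  unfolding component_def by (auto intro: rtrancl_into_rtrancl)

lemma component_adj: "adj x y \<Longrightarrow> x \<notin> Z \<Longrightarrow> y \<notin> Z \<Longrightarrow> component Z x = component Z y"
  using component_step[of x Z x y] component_eq by simp

lemma component_subset:
  assumes "x \<in> S" "\<And>a b. a \<in> S \<Longrightarrow> adj a b \<Longrightarrow> b \<notin> Z \<Longrightarrow> b \<in> S"
  shows "component Z x \<subseteq> S"
proof
  fix y assume "y \<in> component Z x"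
  then have "(x, y) \<in> {(a, b). adj a b \<and> a \<notin> Z \<and> b \<notin> Z}\<^sup>*" by (simp add: component_def)
  then show "y \<in> S" by induction (use assms in auto)
qed

lemma component_in:
  assumes "x \<in> V - Z"
  shows "component Z x \<subseteq> V - Z"
  using assms adj_V by (intro component_subset) auto

lemma finite_component: "x \<in> V - Z \<Longrightarrow> finite (component Z x)"
  by (rule finite_subset[OF component_in]) (simp_all add: finite_V)

lemma component_inner_connected:
  assumes x_in: "x \<in> V - Z" and T_proper: "T \<subseteq> component Z x" "T \<noteq> {}" "T \<noteq> component Z x"
  shows "\<exists>t\<in>T. \<exists>s\<in>component Z x - T. adj t s"
proof (rule ccontr)
  assume no_edge: "\<not> ?thesis"
  obtain t where t_in: "t \<in> T" using T_proper by blast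
  have "component Z t \<subseteq> T"
  proof (rule component_subset[OF t_in])
    fix a b assume step: "a \<in> T" "adj a b" "b \<notin> Z"
    have "a \<notin> Z" using step(1) T_proper(1) component_in[OF x_in] by blast
    then have "b \<in> component Z x" using component_step[of a Z x b] step T_proper(1) by blast
    then show "b \<in> T" using no_edge step by blast
  qed
  moreover have "component Z t = component Z x" using component_eq t_in T_proper(1) by blast
  ultimately show False using T_proper by blast
qed

lemma component_path:
  assumes "y \<in> component Z x" "x \<in> V - Z"
  obtains q where "is_path q" "hd q = x" "last q = y" "set q \<subseteq> component Z x"
proof -
  let ?path = "\<lambda>y q. is_path q \<and> hd q = x \<and> last q = y \<and> set q \<subseteq> component Z x"
  have "component Z x \<subseteq> {y. \<exists>q. ?path y q}"
  proof (rule component_subset)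
    have "?path x [x]" using assms(2) by simp
    then show "x \<in> {y. \<exists>q. ?path y q}" by blast
    fix a b assume "a \<in> {y. \<exists>q. ?path y q}" and step: "adj a b" "b \<notin> Z"
    then obtain q where path_q: "?path a q" by blast
    then have nonempty: "q \<noteq> []" by auto
    then have "a \<in> component Z x" using path_q by auto
    then have b_in: "b \<in> component Z x" using component_step component_in[OF assms(2)] step by blast
    show "b \<in> {y. \<exists>q. ?path y q}"
    proof (cases "b \<in> set q")
      case True
      then obtain as bs where q_split: "q = (as @ [b]) @ bs" by (auto dest: split_list)
      have "is_path (as @ [b])"
        using path_q q_split is_path_append_iff[of "as @ [b]" bs] by (cases "bs = []") auto
      then have "?path b (as @ [b])" using path_q q_split by (cases as) auto
      then show ?thesis by blast
    next
      case False
      then have "?path b (q @ [b])" using path_q step b_in nonempty by (simp add: is_path_snoc_iff)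
      then show ?thesis by blast
    qed
  qed
  then show thesis using assms(1) that by blast
qed

lemma component_attached:
  assumes "is_connected" "x \<in> V - Z" "Z \<noteq> {}" "Z \<subseteq> V"
  obtains y z where "y \<in> component Z x" "z \<in> Z" "adj y z"
proof -
  let ?K = "component Z x"
  have K_subset: "?K \<subseteq> V - Z" by (rule component_in[OF assms(2)])
  then have "?K \<subseteq> V" "?K \<noteq> {}" "?K \<noteq> V" using assms(3,4) component_refl[of x Z] by blast+
  then obtain y z where leaving: "y \<in> ?K" "z \<in> V - ?K" "adj y z" by (rule connectedE[OF assms(1)])
  then have "z \<in> Z" using component_step[of y Z x z] K_subset by blast
  then show thesis using that leaving by blast
qed

lemma separatesI: "(\<And>x y. x \<in> D \<Longrightarrow> adj x y \<Longrightarrow> y \<noteq> c \<Longrightarrow> y \<in> D) \<Longrightarrow> separates c D"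
  unfolding separates_def nbrs_def by blast

lemma separatesD: "separates c D \<Longrightarrow> x \<in> D \<Longrightarrow> adj x y \<Longrightarrow> y \<noteq> c \<Longrightarrow> y \<in> D"
  unfolding separates_def nbrs_def by blast

lemma separates_edge: "separates c D \<Longrightarrow> adj x y \<Longrightarrow> x \<noteq> c \<Longrightarrow> y \<noteq> c \<Longrightarrow> x \<in> D \<longleftrightarrow> y \<in> D"
  using separatesD adj_sym by meson

lemma component_subset_separated:
  "separates c D \<Longrightarrow> c \<in> Z \<Longrightarrow> x \<in> D \<Longrightarrow> component Z x \<subseteq> D"
  using separatesD by (intro component_subset) blast+

lemma component_disjoint_separated:
  assumes "separates c D" "x \<notin> D" "x \<noteq> c"
  shows "component {c} x \<inter> D = {}"
proof -
  have "component {c} x \<subseteq> - D - {c}"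
    using assms separates_edge[OF assms(1)] by (intro component_subset) auto
  then show ?thesis by blast
qed

end

section \<open>The structure of subgraphs of the extremal graphs\<close>

context simple_graph begin

text \<open>
  A graph of order \<open>n\<close> is \<open>covered_except k d\<close> iff it is a subgraph of \<open>H(n, 2 k + d, k)\<close>. Likewise
  \<open>small_components_but_one k\<close> and \<open>linked_small_components k\<close> stand for the subgraphs of the graphs
  (ii) and (iii), \<open>hub_star_matching\<close> and \<open>two_hubs_matching\<close> for those of the graphs (iv).
\<close>

definition covered_except :: "nat \<Rightarrow> nat \<Rightarrow> bool" where
  "covered_except k d \<longleftrightarrow> (\<exists>A U. A \<subseteq> V \<and> U \<subseteq> V - A \<and> card A = k \<and> card U = d \<and>
     (\<forall>x y. adj x y \<longrightarrow> x \<in> A \<or> y \<in> A \<or> x \<in> U \<and> y \<in> U))"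

definition small_components :: "nat \<Rightarrow> bool" where
  "small_components k \<longleftrightarrow> (\<exists>c\<in>V. \<forall>x\<in>V - {c}. card (component {c} x) \<le> k)"

definition small_components_but_one :: "nat \<Rightarrow> bool" where
  "small_components_but_one k \<longleftrightarrow> (\<exists>c\<in>V. \<exists>D \<subseteq> V - {c}. card D \<le> k + 1 \<and> separates c D \<and>
     (\<forall>x\<in>V - {c} - D. card (component {c} x) \<le> k))"

definition linked_small_components :: "nat \<Rightarrow> bool" where
  "linked_small_components k \<longleftrightarrow> (\<exists>c\<in>V. \<exists>c'\<in>V - {c}. \<forall>x\<in>V - {c, c'}.
     card (component {c, c'} x) \<le> k \<and>
     (nbrs c \<inter> component {c, c'} x = {} \<or> nbrs c' \<inter> component {c, c'} x = {}))"

definition induces_matching :: "'a set \<Rightarrow> bool" where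
  "induces_matching M \<longleftrightarrow> (\<forall>x\<in>M. \<forall>y\<in>M. \<forall>z\<in>M. adj x y \<longrightarrow> adj x z \<longrightarrow> y = z)"

definition hub_star_matching :: bool where
  "hub_star_matching \<longleftrightarrow> (\<exists>c\<in>V. \<exists>S \<subseteq> V - {c}. \<exists>a\<in>S. separates c S \<and>
     (\<forall>x\<in>S - {a}. nbrs x \<subseteq> {a, c}) \<and> induces_matching (V - {c} - S))"

definition two_hubs_matching :: bool where
  "two_hubs_matching \<longleftrightarrow> (\<exists>c\<in>V. \<exists>d\<in>V. c \<noteq> d \<and> induces_matching (V - {c, d}))"

lemma induces_matchingD:
  "induces_matching M \<Longrightarrow> adj x y \<Longrightarrow> adj x z \<Longrightarrow> x \<in> M \<Longrightarrow> y \<in> M \<Longrightarrow> z \<in> M \<Longrightarrow> y = z"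
  unfolding induces_matching_def by blast

lemma induces_matching_subset: "induces_matching M \<Longrightarrow> N \<subseteq> M \<Longrightarrow> induces_matching N"
  unfolding induces_matching_def by blast

lemma induces_matching_components:
  assumes "M \<subseteq> V - Z" "\<And>x. x \<in> M \<Longrightarrow> card (component Z x) \<le> 2"
  shows "induces_matching M"
  unfolding induces_matching_def
proof (intro ballI impI, rule ccontr)
  fix x y z assume two_edges: "x \<in> M" "y \<in> M" "z \<in> M" "adj x y" "adj x z" "y \<noteq> z"
  have "{x, y, z} \<subseteq> component Z x"
    using component_step[of x Z x] two_edges assms(1) by auto
  then have "card {x, y, z} \<le> card (component Z x)"
    using two_edges(1) assms(1) finite_component by (intro card_mono) blast+
  also have "\<dots> \<le> 2" by (rule assms(2)[OF two_edges(1)])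
  finally show False using two_edges(6) adj_neq[OF two_edges(4)] adj_neq[OF two_edges(5)] by simp
qed

lemma small_components_imp_but_one:
  assumes "small_components k"
  shows "small_components_but_one k"
proof -
  obtain c where "c \<in> V" "\<forall>x\<in>V - {c}. card (component {c} x) \<le> k"
    using assms unfolding small_components_def by blast
  then show ?thesis
    unfolding small_components_but_one_def
    by (intro bexI[of _ c] exI[of _ "{}"]) (simp_all add: separates_def)
qed

lemma linked_small_components_split:
  assumes "linked_small_components k"
  obtains c X c' Y where "insert c X \<union> insert c' Y = V" "insert c X \<inter> insert c' Y = {}"
    "c \<notin> X" "c' \<notin> Y" "\<forall>x\<in>X \<union> Y. card (component {c, c'} x) \<le> k"
    "\<forall>x\<in>insert c X. \<forall>y\<in>insert c' Y. adj x y \<longrightarrow> x = c \<and> y = c'"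
proof -
  obtain c c' where centers: "c \<in> V" "c' \<in> V - {c}"
    and small: "\<And>x. x \<in> V - {c, c'} \<Longrightarrow> card (component {c, c'} x) \<le> k"
    and one_center: "\<And>x. x \<in> V - {c, c'} \<Longrightarrow>
      nbrs c \<inter> component {c, c'} x = {} \<or> nbrs c' \<inter> component {c, c'} x = {}"
    using assms unfolding linked_small_components_def by blast
  define X where "X = {x \<in> V - {c, c'}. nbrs c \<inter> component {c, c'} x \<noteq> {}}"
  define Y where "Y = V - {c, c'} - X"
  have same_side: "x \<in> X \<longleftrightarrow> y \<in> X" if "adj x y" "x \<notin> {c, c'}" "y \<notin> {c, c'}" for x y
    using component_adj[OF that] adj_V[OF that(1)] that(2,3) by (auto simp: X_def)
  have first_side: "y \<in> X" if "adj c y" "y \<noteq> c'" for y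
    using that adj_V[OF that(1)] adj_neq[OF that(1)] component_refl[of y "{c, c'}"]
    by (auto simp: X_def)
  have second_side: "x \<notin> X" if "adj c' x" "x \<noteq> c" for x
  proof
    assume "x \<in> X"
    then have "x \<in> V - {c, c'}" "nbrs c \<inter> component {c, c'} x \<noteq> {}" by (simp_all add: X_def)
    moreover have "x \<in> nbrs c' \<inter> component {c, c'} x" using that(1) by simp
    ultimately show False using one_center[of x] by blast
  qed
  show thesis
  proof (rule that[of c X c' Y])
    have "x = c \<and> y = c'" if "x \<in> insert c X" "y \<in> insert c' Y" "adj x y" for x y
      using that same_side[of x y] first_side[of y] second_side[of x] adj_sym[OF that(3)] centers
      by (auto simp: X_def Y_def)
    then show "\<forall>x\<in>insert c X. \<forall>y\<in>insert c' Y. adj x y \<longrightarrow> x = c \<and> y = c'" by blast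
  qed (use centers small in \<open>auto simp: X_def Y_def\<close>)
qed

lemma covered_except_mono:
  assumes "covered_except k d" "d \<le> d'" "k + d' \<le> card V"
  shows "covered_except k d'"
proof -
  obtain A U where A_U: "A \<subseteq> V" "U \<subseteq> V - A" "card A = k" "card U = d"
    and covers: "\<forall>x y. adj x y \<longrightarrow> x \<in> A \<or> y \<in> A \<or> x \<in> U \<and> y \<in> U"
    using assms(1) unfolding covered_except_def by blast
  have finite_parts: "finite A" "finite (V - A)" using A_U(1) finite_V finite_subset by auto
  have "d' \<le> card (V - A)" using card_Diff_subset[OF finite_parts(1) A_U(1)] A_U(3) assms(3) by simp
  then obtain U' where "U \<subseteq> U'" "U' \<subseteq> V - A" "card U' = d'"
    using exists_subset_between[OF _ _ A_U(2) finite_parts(2), of d'] A_U(4) assms(2) by blast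
  then show ?thesis
    unfolding covered_except_def using A_U(1,3) covers by (intro exI[of _ A] exI[of _ U']) blast
qed

end

context nearly_min_degree begin

definition extremal :: bool where
  "extremal \<longleftrightarrow> 2 * k + 2 \<le> card V \<and> covered_except k 1 \<or> 2 * k + 3 \<le> card V \<and> covered_except k 2 \<or>
     small_components_but_one k \<or> linked_small_components k \<or>
     k = 2 \<and> hub_star_matching \<or> k = 3 \<and> two_hubs_matching"

lemma extremalI:
  "2 * k + 2 \<le> card V \<Longrightarrow> covered_except k 1 \<Longrightarrow> extremal"
  "2 * k + 3 \<le> card V \<Longrightarrow> covered_except k 2 \<Longrightarrow> extremal"
  "small_components_but_one k \<Longrightarrow> extremal"
  "linked_small_components k \<Longrightarrow> extremal"
  "k = 2 \<Longrightarrow> hub_star_matching \<Longrightarrow> extremal"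
  "k = 3 \<Longrightarrow> two_hubs_matching \<Longrightarrow> extremal"
  unfolding extremal_def by blast+

end

section \<open>Parts attached to a single vertex\<close>

locale lobe = nearly_min_degree V adj k for V :: "'a set" and adj k +
  fixes c :: 'a and D :: "'a set"
  assumes D_V: "D \<subseteq> V" and c_notin: "c \<notin> D" and attached: "\<exists>d\<in>D. adj c d"
    and separated: "separates c D"
    and inner_connected: "T \<subseteq> D \<Longrightarrow> T \<noteq> {} \<Longrightarrow> T \<noteq> D \<Longrightarrow> \<exists>t\<in>T. \<exists>s\<in>D - T. adj t s"
    and entering_bound: "is_path (c # p) \<Longrightarrow> set p \<subseteq> D \<Longrightarrow> length p \<le> k"
begin

definition enters :: "'a list \<Rightarrow> bool" where
  "enters p \<longleftrightarrow> p \<noteq> [] \<and> is_path (c # p) \<and> set p \<subseteq> D"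

definition longest_entering :: "'a list \<Rightarrow> bool" where
  "longest_entering p \<longleftrightarrow> enters p \<and> (\<forall>q. enters q \<longrightarrow> length q \<le> length p)"

lemma enters_snoc_iff: "p \<noteq> [] \<Longrightarrow> enters (p @ [y]) \<longleftrightarrow> enters p \<and> y \<in> D - set p \<and> adj (last p) y"
  using is_path_snoc_iff[of "c # p" y] c_notin by (auto simp: enters_def)

lemma ex_longest_entering: "\<exists>p. longest_entering p"
proof -
  obtain d where "enters [d]" using attached by (auto simp: enters_def)
  then obtain p where "enters p" "\<forall>q. enters q \<longrightarrow> length q \<le> length p"
    using ex_has_greatest_nat[of enters "[d]" length "Suc k"] entering_bound
    by (force simp: enters_def less_Suc_eq_le)
  then show ?thesis by (auto simp: longest_entering_def)
qed

lemma reroute: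
  assumes detour: "enters p" "t \<in> set p" "s \<in> D - set p" "adj t s"
    and full: "\<And>y. y \<in> set (c # butlast p) \<Longrightarrow> adj (last p) y"
  obtains q where "enters q" "length q = Suc (length p)" "last q = s"
proof -
  obtain as bs where p_split: "p = as @ t # bs" using detour(2) by (meson split_list)
  let ?q = "as @ rev (t # bs)"
  have paths: "is_path (c # as)" "is_path (t # bs)" "set (c # as) \<inter> set (t # bs) = {}"
    using detour(1) p_split is_path_append_iff[of "c # as" "t # bs"] by (auto simp: enters_def)
  have "adj (last p) (last (c # as))" using full p_split by (auto simp: butlast_append)
  moreover have "hd (rev (t # bs)) = last p" using p_split by (simp only: hd_rev last_append) simp
  ultimately have "adj (last (c # as)) (hd (rev (t # bs)))" by (simp only: adj_commute)
  then have "is_path ((c # as) @ rev (t # bs))"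
    using paths is_path_rev[of "t # bs"] by (intro is_path_appendI) auto
  then have "enters ?q" using detour(1) p_split by (auto simp: enters_def)
  then have "enters (?q @ [s])" using detour(3,4) p_split by (subst enters_snoc_iff) auto
  then show thesis using that[of "?q @ [s]"] p_split by simp
qed

lemma longest_entering_covers_if_end_regular:
  assumes longest_p: "longest_entering p" and regular: "k \<le> deg (last p)"
  shows "set p = D"
proof (rule ccontr)
  assume not_all: "set p \<noteq> D"
  have enters: "enters p" and maximal: "\<And>q. enters q \<Longrightarrow> length q \<le> length p"
    using longest_p by (auto simp: longest_entering_def)
  have nonempty: "p \<noteq> []" and path_cp: "is_path (c # p)" and p_subset: "set p \<subseteq> D"
    using enters by (auto simp: enters_def)
  have "nbrs (last p) \<subseteq> set (c # butlast p)"
  proof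
    fix y assume "y \<in> nbrs (last p)"
    then have edge_y: "adj (last p) y" by simp
    have "\<not> enters (p @ [y])" using maximal[of "p @ [y]"] by auto
    moreover have "last p \<in> D" using p_subset nonempty by auto
    then have "y = c \<or> y \<in> D" using separatesD[OF separated _ edge_y] by blast
    ultimately have "y \<in> set (c # p)" using edge_y nonempty enters by (auto simp: enters_snoc_iff)
    moreover have "set p = insert (last p) (set (butlast p))"
      using arg_cong[OF append_butlast_last_id[OF nonempty], of set] by simp
    ultimately show "y \<in> set (c # butlast p)" using adj_neq[OF edge_y] by auto
  qed
  moreover have "card (set (c # butlast p)) \<le> deg (last p)"
    using card_length[of "c # butlast p"] entering_bound[OF path_cp p_subset] regular nonempty
    by simp
  ultimately have "nbrs (last p) = set (c # butlast p)" by (intro card_seteq) auto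
  then have full: "adj (last p) y" if "y \<in> set (c # butlast p)" for y using that mem_nbrs by blast
  obtain t s where "t \<in> set p" "s \<in> D - set p" "adj t s"
    using inner_connected[OF p_subset] nonempty not_all by auto
  then obtain q where "enters q" "length q = Suc (length p)"
    using reroute[OF enters _ _ _ full] by metis
  then show False using maximal by fastforce
qed

text \<open>
  If every longest entering path ends in the exceptional vertex \<open>w\<close>, the argument is repeated with
  the predecessor of \<open>w\<close>: a detour through an unvisited vertex would not end in \<open>w\<close>.
\<close>

context
  fixes p w
  assumes longest: "longest_entering (p @ [w])" and low_w: "deg w < k"
    and ends: "enters q \<Longrightarrow> length q = Suc (length p) \<Longrightarrow> last q = w"
begin

lemma path_pw: "is_path (c # p @ [w])" and pw_D: "set p \<subseteq> D" "w \<in> D"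
  using longest by (auto simp: longest_entering_def enters_def)

lemma adj_predecessor:
  assumes nonempty: "p \<noteq> []" and y_in: "y \<in> set (c # butlast p)"
  shows "adj (last p) y"
proof -
  define z where "z = last p"
  have z_in: "z \<in> set p" using nonempty by (simp add: z_def)
  then have "z \<noteq> w" "z \<noteq> c" using is_pathD(2)[OF path_pw] by auto
  have enters_p: "enters p"
    using longest nonempty by (simp add: longest_entering_def enters_snoc_iff)
  have "nbrs z \<subseteq> set (c # p @ [w]) - {z}"
  proof
    fix x assume "x \<in> nbrs z"
    then have edge_x: "adj z x" by simp
    have "enters (p @ [x])" if "x \<in> D - set p"
      using that edge_x nonempty enters_p by (simp add: enters_snoc_iff z_def)
    then have "x \<notin> D - set (p @ [w])" using ends[of "p @ [x]"] by auto
    moreover have "x = c \<or> x \<in> D" using separatesD[OF separated _ edge_x] z_in pw_D by blast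
    ultimately show "x \<in> set (c # p @ [w]) - {z}" using adj_neq[OF edge_x] by auto
  qed
  moreover have "card (set (c # p @ [w]) - {z}) \<le> deg z"
  proof -
    have "card (set (c # p @ [w]) - {z}) = length (p @ [w])"
      using card_set_path[OF path_pw] z_in by (simp add: card_Diff_singleton)
    moreover have "length (p @ [w]) \<le> k" using path_pw pw_D by (intro entering_bound) auto
    moreover have "k \<le> deg z" using deg_ge[OF low_w] \<open>z \<noteq> w\<close> z_in pw_D D_V by blast
    ultimately show ?thesis by linarith
  qed
  ultimately have "nbrs z = set (c # p @ [w]) - {z}" by (intro card_seteq) auto
  moreover have "y \<noteq> z"
  proof -
    have "p = butlast p @ [z]" using nonempty by (simp add: z_def)
    then have "distinct (butlast p @ [z])" using is_pathD(2)[OF path_pw] by auto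
    then show ?thesis using y_in \<open>z \<noteq> c\<close> by auto
  qed
  ultimately show ?thesis using y_in mem_nbrs in_set_butlastD unfolding z_def by fastforce
qed

lemma longest_entering_covers_if_end_low: "set (p @ [w]) = D"
proof (rule ccontr)
  assume "set (p @ [w]) \<noteq> D"
  then obtain t s where leaving: "t \<in> set (p @ [w])" "s \<in> D - set (p @ [w])" "adj t s"
    using inner_connected[of "set (p @ [w])"] pw_D by auto
  have "t \<noteq> w"
  proof
    assume "t = w"
    then have "enters ((p @ [w]) @ [s])"
      using leaving longest enters_snoc_iff[of "p @ [w]" s] by (simp add: longest_entering_def)
    then show False using longest by (fastforce simp: longest_entering_def)
  qed
  then have t_in: "t \<in> set p" using leaving(1) by simp
  then have "p \<noteq> []" by auto
  moreover from this have "enters p"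
    using longest by (simp add: longest_entering_def enters_snoc_iff)
  ultimately obtain q where q: "enters q" "length q = Suc (length p)" "last q = s"
    using reroute[OF _ t_in _ leaving(3) adj_predecessor] leaving(2) by auto
  then show False using ends[OF q(1,2)] leaving(2) by simp
qed

end

lemma card_le: "card D \<le> k"
proof -
  have "\<exists>p. longest_entering p \<and> set p = D"
  proof (cases "\<exists>p. longest_entering p \<and> k \<le> deg (last p)")
    case True
    then show ?thesis using longest_entering_covers_if_end_regular by blast
  next
    case False
    obtain p where longest_p: "longest_entering p" using ex_longest_entering ..
    then have p_eq: "p = butlast p @ [last p]" by (simp add: longest_entering_def enters_def)
    have low: "last q \<in> V \<and> deg (last q) < k" if "longest_entering q" for q
    proof -
      have "last q \<in> D" using that by (auto simp: longest_entering_def enters_def)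
      then show ?thesis using False that D_V by (auto simp: not_le)
    qed
    have "last q = last p" if "enters q" "length q = length p" for q
    proof -
      have "longest_entering q" using that longest_p by (simp add: longest_entering_def)
      then show ?thesis using low low_unique longest_p by blast
    qed
    then have "set p = D"
      using longest_entering_covers_if_end_low[of "butlast p" "last p"] longest_p low p_eq
      by (metis length_append_singleton)
    then show ?thesis using longest_p by blast
  qed
  then obtain p where longest_p: "longest_entering p" "set p = D" by blast
  then have "card D \<le> length p" using card_length[of p] by simp
  also have "\<dots> \<le> k"
    using longest_p(1) entering_bound by (auto simp: longest_entering_def enters_def)
  finally show ?thesis .
qed

end

context nearly_min_degree begin

lemma card_component_le:
  assumes x_in: "x \<in> V - Z" and Z: "c \<in> Z" "Z \<subseteq> V"
    and only_c: "\<And>d. d \<in> Z \<Longrightarrow> d \<noteq> c \<Longrightarrow> nbrs d \<inter> component Z x = {}"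
    and bound: "\<And>p. is_path (c # p) \<Longrightarrow> set p \<subseteq> component Z x \<Longrightarrow> length p \<le> k"
  shows "card (component Z x) \<le> k"
proof -
  let ?K = "component Z x"
  have K_subset: "?K \<subseteq> V - Z" by (rule component_in[OF x_in])
  have only_c': "z = c" if "y \<in> ?K" "adj y z" "z \<in> Z" for y z
    using only_c[OF that(3)] that(1) adj_sym[OF that(2)] mem_nbrs by blast
  obtain y z where "y \<in> ?K" "z \<in> Z" "adj y z"
    using component_attached[OF connected x_in] Z by blast
  then have attached: "\<exists>y\<in>?K. adj c y" using only_c' adj_sym by blast
  have separated: "separates c ?K"
    using component_step[of _ Z x] only_c' K_subset by (intro separatesI) blast
  have "lobe V adj k c ?K"
    using K_subset Z(1) attached separated component_inner_connected[OF x_in] bound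
    by unfold_locales blast+
  then show ?thesis by (rule lobe.card_le)
qed

lemma card_component_outside_separated_le:
  assumes "c \<in> V" "separates c D" "x \<in> V - {c} - D"
    and bound: "\<And>p. is_path (c # p) \<Longrightarrow> set p \<inter> D = {} \<Longrightarrow> length p \<le> k"
  shows "card (component {c} x) \<le> k"
proof (rule card_component_le)
  have "component {c} x \<inter> D = {}" using assms(2,3) by (intro component_disjoint_separated) auto
  then show "length p \<le> k" if "is_path (c # p)" "set p \<subseteq> component {c} x" for p
    using that bound by blast
qed (use assms in auto)

lemma small_components_but_oneI:
  assumes "c \<in> V" "D \<subseteq> V - {c}" "card D \<le> k + 1" "separates c D"
    and "\<And>p. is_path (c # p) \<Longrightarrow> set p \<inter> D = {} \<Longrightarrow> length p \<le> k"
  shows "small_components_but_one k"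
  unfolding small_components_but_one_def
  using assms card_component_outside_separated_le[OF assms(1,4)] by blast

lemma small_componentsI:
  assumes "c \<in> V" "D \<subseteq> V" "card D \<le> k" "separates c D"
    and "\<And>p. is_path (c # p) \<Longrightarrow> set p \<inter> D = {} \<Longrightarrow> length p \<le> k"
  shows "small_components k"
proof -
  have "card (component {c} x) \<le> k" if x_in: "x \<in> V - {c}" for x
  proof (cases "x \<in> D")
    case True
    then have "card (component {c} x) \<le> card D"
      using component_subset_separated[OF assms(4)] assms(2) finite_V
      by (intro card_mono) (auto intro: finite_subset)
    then show ?thesis using assms(3) by linarith
  next
    case False
    then show ?thesis using card_component_outside_separated_le assms x_in by blast
  qed
  then show ?thesis unfolding small_components_def using assms(1) by blast
qed

end

locale linked_path = nearly_min_degree V adj k for V :: "'a set" and adj k +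
  fixes p\<^sub>1 p\<^sub>2 :: "'a list" and c\<^sub>1 c\<^sub>2 :: 'a
  assumes path: "is_path (p\<^sub>1 @ [c\<^sub>1, c\<^sub>2] @ p\<^sub>2)"
    and length_p\<^sub>1: "length p\<^sub>1 = k" and length_p\<^sub>2: "length p\<^sub>2 = k"
    and separates\<^sub>1: "separates c\<^sub>1 (set p\<^sub>1)" and separates\<^sub>2: "separates c\<^sub>2 (set p\<^sub>2)"
    and bounded: "paths_bounded (2 * k + 2)"
begin

abbreviation Z :: "'a set" where "Z \<equiv> {c\<^sub>1, c\<^sub>2}"

lemma linked_path_rev: "linked_path V adj k (rev p\<^sub>2) (rev p\<^sub>1) c\<^sub>2 c\<^sub>1"
proof unfold_locales
  show "is_path (rev p\<^sub>2 @ [c\<^sub>2, c\<^sub>1] @ rev p\<^sub>1)" using path is_path_rev by fastforce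
qed (use length_p\<^sub>1 length_p\<^sub>2 separates\<^sub>1 separates\<^sub>2 bounded in simp_all)

lemma distinct_path: "distinct (p\<^sub>1 @ [c\<^sub>1, c\<^sub>2] @ p\<^sub>2)"
  by (rule is_pathD(2)[OF path])

lemma Z_V: "Z \<subseteq> V"
  using is_pathD(3)[OF path] by auto

lemma left_path: "is_path (p\<^sub>1 @ [c\<^sub>1])" and right_path: "is_path (c\<^sub>2 # p\<^sub>2)"
  using path is_path_append_iff[of "p\<^sub>1 @ [c\<^sub>1]" "c\<^sub>2 # p\<^sub>2"] by auto

lemma adj_centers: "adj c\<^sub>1 c\<^sub>2"
  using path is_path_append_iff[of "p\<^sub>1 @ [c\<^sub>1]" "c\<^sub>2 # p\<^sub>2"] by auto

lemma component_cases:
  "component Z x \<subseteq> set p\<^sub>1 \<or> component Z x \<subseteq> set p\<^sub>2 \<or> component Z x \<inter> (set p\<^sub>1 \<union> set p\<^sub>2) = {}"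
proof -
  have "component Z x \<subseteq> set p\<^sub>1" if "y \<in> component Z x" "y \<in> set p\<^sub>1" for y
    using component_subset_separated[OF separates\<^sub>1 _ that(2), of Z] component_eq[OF that(1)] by simp
  moreover have "component Z x \<subseteq> set p\<^sub>2" if "y \<in> component Z x" "y \<in> set p\<^sub>2" for y
    using component_subset_separated[OF separates\<^sub>2 _ that(2), of Z] component_eq[OF that(1)] by simp
  ultimately show ?thesis by blast
qed

lemma nbrs_opposite: "nbrs c\<^sub>2 \<inter> set p\<^sub>1 = {}" "nbrs c\<^sub>1 \<inter> set p\<^sub>2 = {}"
  using separatesD[OF separates\<^sub>1 _ adj_sym, of _ c\<^sub>2] separatesD[OF separates\<^sub>2 _ adj_sym, of _ c\<^sub>1]
    distinct_path by auto

lemma component_not_between: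
  assumes x_in: "x \<in> V - Z"
  shows "nbrs c\<^sub>1 \<inter> component Z x = {} \<or> nbrs c\<^sub>2 \<inter> component Z x = {}"
proof (rule ccontr)
  assume "\<not> ?thesis"
  then obtain y z where y_in: "y \<in> component Z x" "adj c\<^sub>1 y"
    and z_in: "z \<in> component Z x" "adj c\<^sub>2 z" by auto
  have disjoint: "component Z x \<inter> (set p\<^sub>1 \<union> set p\<^sub>2) = {}"
    using component_cases[of x] nbrs_opposite y_in z_in by auto
  have "y \<in> V - Z" "component Z y = component Z x"
    using component_in[OF x_in] component_eq y_in(1) by blast+
  then obtain q where path_q: "is_path q" "hd q = y" "last q = z" "set q \<subseteq> component Z x"
    using component_path[of z Z y] z_in(1) by metis
  have q_avoids_Z: "set q \<inter> Z = {}" using path_q(4) component_in[OF x_in] by blast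
  have "is_path (q @ c\<^sub>2 # p\<^sub>2)"
    using path_q disjoint q_avoids_Z adj_sym[OF z_in(2)]
    by (intro is_path_appendI[OF _ right_path]) auto
  then have "is_path ((p\<^sub>1 @ [c\<^sub>1]) @ q @ c\<^sub>2 # p\<^sub>2)"
    using path_q disjoint q_avoids_Z distinct_path y_in(2) is_pathD(1)[OF path_q(1)]
    by (intro is_path_appendI[OF left_path]) auto
  from paths_boundedD[OF bounded this] show False
    using length_p\<^sub>1 length_p\<^sub>2 is_pathD(1)[OF path_q(1)] by (cases q) auto
qed

lemma card_component_le_if_first_side:
  assumes x_in: "x \<in> V - Z" and side: "nbrs c\<^sub>2 \<inter> component Z x = {}"
  shows "card (component Z x) \<le> k"
proof -
  have small: ?thesis if "component Z x \<subseteq> set p" "length p = k" for p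
    using card_mono[OF _ that(1)] card_length[of p] that(2) by simp
  consider (first) "component Z x \<subseteq> set p\<^sub>1" | (second) "component Z x \<subseteq> set p\<^sub>2"
    | (outside) "component Z x \<inter> set p\<^sub>2 = {}"
    using component_cases by blast
  then show ?thesis
  proof cases
    case outside
    show ?thesis
    proof (rule card_component_le[OF x_in, of c\<^sub>1])
      fix q assume path_q: "is_path (c\<^sub>1 # q)" "set q \<subseteq> component Z x"
      have "is_path (rev (c\<^sub>2 # p\<^sub>2) @ c\<^sub>1 # q)"
      proof (rule is_path_appendI)
        show "is_path (rev (c\<^sub>2 # p\<^sub>2))" using right_path is_path_rev by blast
        show "set (rev (c\<^sub>2 # p\<^sub>2)) \<inter> set (c\<^sub>1 # q) = {}"
          using path_q(2) component_in[OF x_in] outside distinct_path by auto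
      qed (use path_q adj_sym[OF adj_centers] in simp_all)
      from paths_boundedD[OF bounded this] show "length q \<le> k" using length_p\<^sub>2 by simp
    qed (use Z_V side in auto)
  qed (use small length_p\<^sub>1 length_p\<^sub>2 in blast)+
qed

lemma linked_small_components_holds: "linked_small_components k"
  unfolding linked_small_components_def
proof (rule bexI[of _ c\<^sub>1], rule bexI[of _ c\<^sub>2], intro ballI conjI)
  fix x assume x_in: "x \<in> V - Z"
  show attached: "nbrs c\<^sub>1 \<inter> component Z x = {} \<or> nbrs c\<^sub>2 \<inter> component Z x = {}"
    by (rule component_not_between[OF x_in])
  show "card (component Z x) \<le> k"
    using attached card_component_le_if_first_side[OF x_in]
      linked_path.card_component_le_if_first_side[OF linked_path_rev, of x] x_in
    by (auto simp: insert_commute)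
qed (use Z_V distinct_path in auto)

end

section \<open>Cycles without detours\<close>

locale graph_with_inextensible_cycle = graph_with_cycle V adj C for V :: "'a set" and adj C +
  assumes inextensible: "\<not> has_cycle (Suc (length C))"
begin

lemma next_of_nbr_not_nbr:
  assumes "r \<notin> set C" "x \<in> set C" "adj r x"
  shows "\<not> adj r (\<sigma> x)"
proof
  assume next_adj: "adj r (\<sigma> x)"
  obtain Q where path_Q: "is_path Q" "set Q = set C" "length Q = length C" "hd Q = x" "last Q = \<sigma> x"
    using spanning_path_to_next[OF assms(2)] .
  have "is_cycle (r # Q)"
    unfolding is_cycle_def using path_Q assms next_adj length_C is_pathD(1)[OF path_Q(1)]
    by (auto simp: is_path_Cons_iff adj_commute)
  then show False using inextensible path_Q(3) by (auto simp: has_cycle_def)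
qed

lemma next_of_nbrs_not_adj:
  assumes "r \<notin> set C" "x \<in> set C" "y \<in> set C" "adj r x" "adj r y"
  shows "\<not> adj (\<sigma> x) (\<sigma> y)"
proof
  assume next_edge: "adj (\<sigma> x) (\<sigma> y)"
  then have "x \<noteq> y" using adj_neq by blast
  then obtain xs ys where arcs: "is_path (xs @ ys)" "xs \<noteq> []" "ys \<noteq> []" "set (xs @ ys) = set C"
    "length (xs @ ys) = length C" "hd xs = \<sigma> x" "last xs = y" "hd ys = \<sigma> y" "last ys = x"
    using split_cycle[OF assms(2,3)] by metis
  have "is_path (xs @ r # rev ys)"
    using arcs assms by (auto simp: is_path_append_iff is_path_Cons_iff hd_rev adj_commute)
  then have "is_cycle (xs @ r # rev ys)"
    unfolding is_cycle_def using arcs next_edge length_C by (auto simp: last_rev adj_commute)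
  then show False using inextensible arcs(5) by (auto simp: has_cycle_def)
qed

lemma previous_of_nbrs_not_adj:
  assumes "r \<notin> set C" "x \<in> set C" "y \<in> set C" "adj r (\<sigma> x)" "adj r (\<sigma> y)"
  shows "\<not> adj x y"
proof
  assume edge: "adj x y"
  then have "x \<noteq> y" using adj_neq by blast
  then obtain xs ys where arcs: "is_path (xs @ ys)" "xs \<noteq> []" "ys \<noteq> []" "set (xs @ ys) = set C"
    "length (xs @ ys) = length C" "hd xs = \<sigma> x" "last xs = y" "hd ys = \<sigma> y" "last ys = x"
    using split_cycle[OF assms(2,3)] by metis
  have "is_path (r # xs @ rev ys)"
    using arcs assms edge by (auto simp: is_path_append_iff is_path_Cons_iff hd_rev adj_commute)
  then have "is_cycle (r # xs @ rev ys)"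
    unfolding is_cycle_def using arcs assms(5) length_C by (auto simp: last_rev adj_commute)
  then show False using inextensible arcs(5) by (auto simp: has_cycle_def)
qed

lemma nbrs_disjoint_next:
  assumes "r \<notin> set C" "A \<subseteq> nbrs r \<inter> set C"
  shows "A \<inter> \<sigma> ` A = {}"
proof -
  have "\<sigma> x \<notin> A" if "x \<in> A" for x
    using next_of_nbr_not_nbr[OF assms(1), of x] assms(2) that mem_nbrs by blast
  then show ?thesis by auto
qed

lemma card_disjoint_next:
  assumes "A \<subseteq> set C" "A \<inter> \<sigma> ` A = {}"
  shows "card (A \<union> \<sigma> ` A) = 2 * card A" "2 * card A \<le> length C"
proof -
  show card_eq: "card (A \<union> \<sigma> ` A) = 2 * card A"
    using assms by (simp add: card_Un_disjoint finite_subset[OF _ finite_set])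
  have "card (A \<union> \<sigma> ` A) \<le> card (set C)"
    using assms(1) next_image_subset by (intro card_mono) auto
  then show "2 * card A \<le> length C" using card_eq card_C by simp
qed

end

section \<open>A cycle missing one vertex of a longest path\<close>

locale cycle_missing_vertex =
  nearly_min_degree V adj k + graph_with_cycle V adj C for V :: "'a set" and adj k C +
  assumes bounded: "paths_bounded (Suc (length C))"
    and length_C_le: "length C \<le> 2 * k + 1" and order: "length C + 2 \<le> card V"

sublocale cycle_missing_vertex \<subseteq> graph_with_inextensible_cycle V adj C
  using no_cycle_of_bounded_length[OF connected bounded] order by unfold_locales simp

context cycle_missing_vertex begin

lemma no_path: "is_path p \<Longrightarrow> length p \<noteq> length C + 2"
  using paths_boundedD[OF bounded] by fastforce

lemma off_cycle_independent:
  assumes "q \<notin> set C" "r \<notin> set C"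
  shows "\<not> adj q r"
proof
  assume edge_qr: "adj q r"
  then have q_off: "q \<in> V - set C" "q \<noteq> r" using assms adj_V adj_neq by auto
  let ?K = "component (set C) q"
  have r_in: "r \<in> ?K" using component_step[of q "set C" q r] edge_qr assms by simp
  have "set C \<noteq> {}" using length_C by auto
  then obtain y x where leaving: "y \<in> ?K" "x \<in> set C" "adj y x"
    by (rule component_attached[OF connected q_off(1) _ C_V])
  have "{y} \<noteq> ?K" using r_in q_off(2) component_refl[of q "set C"] by (metis singletonD)
  then obtain y' where edge_in_K: "y' \<in> ?K" "adj y y'"
    using component_inner_connected[OF q_off(1), of "{y}"] leaving(1) by auto
  have "y \<notin> set C" "y' \<notin> set C" using leaving(1) edge_in_K(1) component_in[OF q_off(1)] by blast+
  then obtain P where "is_path P" "length P = length [y', y] + length C"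
    using path_into_cycle[OF leaving(2), of "[y', y]"] leaving(3) adj_sym[OF edge_in_K(2)] by auto
  then show False using no_path by simp
qed

lemma ex_regular_off_cycle: "\<exists>r\<in>V - set C. k \<le> deg r"
proof -
  have "2 \<le> card (V - set C)" using order card_C C_V by (simp add: card_Diff_subset)
  then obtain T where T_off: "T \<subseteq> V - set C" "card T = 2" by (rule obtain_subset_with_card_n)
  then obtain a b where "T = {a, b}" "a \<noteq> b" by (auto simp: card_2_iff)
  then show ?thesis using T_off(1) deg_ge_or[of a b] by blast
qed

context
  fixes r
  assumes r_off: "r \<in> V - set C" and r_reg: "k \<le> deg r"
begin

abbreviation A :: "'a set" where "A \<equiv> nbrs r"
abbreviation previous :: "'a set" where "previous \<equiv> {x \<in> set C. \<sigma> x \<in> A}"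
abbreviation not_after :: "'a set" where "not_after \<equiv> set C - A - \<sigma> ` A"
abbreviation not_before :: "'a set" where "not_before \<equiv> set C - A - previous"

lemma A_C: "A \<subseteq> set C"
  using off_cycle_independent[of r] r_off unfolding nbrs_def by blast

lemma A_next_disjoint: "A \<inter> \<sigma> ` A = {}"
  using r_off A_C by (intro nbrs_disjoint_next) auto

lemma card_A: "card A = k"
  using card_disjoint_next(2)[OF A_C A_next_disjoint] length_C_le r_reg by simp

lemma card_not_after: "card not_after = length C - 2 * k"
proof -
  have "set C - A - \<sigma> ` A = set C - (A \<union> \<sigma> ` A)" by blast
  then show ?thesis
    using card_disjoint_next(1)[OF A_C A_next_disjoint] next_image_subset[OF A_C] A_C card_A
    by (simp add: card_Diff_subset card_C)
qed

lemma card_not_before: "card not_before = length C - 2 * k"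
proof -
  have "x \<in> \<sigma> ` previous" if "x \<in> A" for x
    using ex_previous[OF subsetD[OF A_C that]] that by blast
  then have "\<sigma> ` previous = A" by blast
  then have "card previous = k" using card_next_image[of previous] card_A by simp
  moreover have "A \<inter> previous = {}" using A_next_disjoint by auto
  ultimately have "card (A \<union> previous) = 2 * k" using card_A by (simp add: card_Un_disjoint)
  moreover have "not_before = set C - (A \<union> previous)" by blast
  ultimately show ?thesis using A_C by (simp add: card_Diff_subset card_C)
qed

lemma not_after_Int_not_before: "not_after \<inter> not_before = {}"
proof (rule ccontr)
  assume "not_after \<inter> not_before \<noteq> {}"
  then obtain x where x_in: "x \<in> set C" "x \<in> not_after" "\<sigma> x \<notin> A" by blast
  have "\<sigma> x \<notin> \<sigma> ` A" using x_in(2) injD[OF inj_next] by blast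
  then have "\<sigma> x \<in> not_after" using x_in by simp
  moreover have "card not_after \<le> 1" using card_not_after length_C_le by linarith
  ultimately have "\<sigma> x = x" using x_in(2) card_le_Suc0_iff_eq[of not_after] by auto
  then show False using next_adj[OF x_in(1)] adj_irrefl by simp
qed

lemma off_cycle_adj_A:
  assumes edge_q: "q \<notin> set C" "adj q x"
  shows "x \<in> A"
proof (rule ccontr)
  assume x_notin: "x \<notin> A"
  have x_in_C: "x \<in> set C" using off_cycle_independent edge_q by blast
  have q_neq_r: "q \<noteq> r" and q_in_V: "q \<in> V" using x_notin edge_q(2) adj_V by auto
  have impossible: False
    if "y \<in> set C" "adj s y" "adj (\<sigma> y) t" "{s, t} = {q, r}" for s t y
    using path_through_cycle_edge[OF that(1), of "[s]" "[t]"] that(2-4) edge_q(1) q_neq_r q_in_V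
      r_off no_path
    by (auto simp: doubleton_eq_iff)
  have "x \<notin> not_after \<or> x \<notin> not_before" using not_after_Int_not_before by blast
  then consider (after) a where "a \<in> A" "x = \<sigma> a" | (before) "\<sigma> x \<in> A" using x_notin x_in_C by blast
  then show False
  proof cases
    case after
    then show ?thesis using impossible[of a r q] subsetD[OF A_C after(1)] edge_q(2) adj_sym by auto
  next
    case before
    then show ?thesis using impossible[of x q r] x_in_C edge_q(2) adj_sym by auto
  qed
qed

lemma uncovered_edge:
  assumes edge_xy: "adj x y" "x \<notin> A" "y \<notin> A"
  shows "x \<in> not_after \<or> y \<in> not_after" "x \<in> not_before \<or> y \<in> not_before"
proof -
  have in_C: "x \<in> set C" "y \<in> set C" using off_cycle_adj_A edge_xy adj_sym[OF edge_xy(1)] by blast+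
  have "\<not> (x \<in> \<sigma> ` A \<and> y \<in> \<sigma> ` A)"
    using next_of_nbrs_not_adj[of r] r_off A_C edge_xy(1) mem_nbrs by blast
  then show "x \<in> not_after \<or> y \<in> not_after" using in_C edge_xy(2,3) by blast
  have "\<not> (x \<in> previous \<and> y \<in> previous)"
    using previous_of_nbrs_not_adj[of r] r_off edge_xy(1) by auto
  then show "x \<in> not_before \<or> y \<in> not_before" using in_C edge_xy(2,3) by blast
qed

lemma covered_if_even:
  assumes "length C = 2 * k"
  shows "covered_except k 1"
proof -
  have "not_after = {}" using card_not_after assms by simp
  then have "x \<in> A \<or> y \<in> A" if "adj x y" for x y using uncovered_edge(1)[OF that] by blast
  moreover have "r \<in> V - A" using r_off A_C by blast
  ultimately show ?thesis
    unfolding covered_except_def using card_A nbrs_subset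
    by (intro exI[of _ A] exI[of _ "{r}"]) auto
qed

lemma covered_if_odd:
  assumes "length C = 2 * k + 1"
  shows "covered_except k 2"
proof -
  have "card not_after = 1" "card not_before = 1"
    using card_not_after card_not_before assms by simp_all
  then obtain y z where exceptions: "not_after = {y}" "not_before = {z}"
    by (auto simp: card_1_singleton_iff)
  then have y_neq_z: "y \<noteq> z" using not_after_Int_not_before by blast
  have "x \<in> A \<or> x' \<in> A \<or> x \<in> {y, z} \<and> x' \<in> {y, z}" if edge_xx': "adj x x'" for x x'
  proof (rule disjCI)
    assume "\<not> (x' \<in> A \<or> x \<in> {y, z} \<and> x' \<in> {y, z})"
    then show "x \<in> A" using uncovered_edge[OF edge_xx'] y_neq_z unfolding exceptions by blast
  qed
  moreover have "{y, z} \<subseteq> V - A" using exceptions C_V by blast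
  ultimately show ?thesis
    unfolding covered_except_def using card_A nbrs_subset y_neq_z
    by (intro exI[of _ A] exI[of _ "{y, z}"]) auto
qed

lemma length_C_cases: "length C = 2 * k \<or> length C = 2 * k + 1"
  using card_disjoint_next(2)[OF A_C A_next_disjoint] card_A length_C_le by linarith

end

theorem covered_by_cycle:
  "length C = 2 * k \<and> covered_except k 1 \<or> length C = 2 * k + 1 \<and> covered_except k 2"
proof -
  obtain r where "r \<in> V - set C" "k \<le> deg r" using ex_regular_off_cycle by blast
  note r_props = this
  show ?thesis
    using length_C_cases[OF r_props] covered_if_even[OF r_props] covered_if_odd[OF r_props] by blast
qed

end

section \<open>A cycle missing an edge of a longest path\<close>

context graph_with_cycle begin

lemma path_skipping_next:
  assumes "x \<in> set C"
  obtains Q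
    where "is_path Q" "set Q \<subseteq> set C" "length Q = length C - 1" "hd Q = \<sigma> (\<sigma> x)" "last Q = x"
proof -
  obtain Q
    where cycle_Q: "is_cycle Q" "set Q = set C" "length Q = length C" "hd Q = \<sigma> x" "last Q = x"
    "cycle_of_list Q = \<sigma>"
    using rotation_ending_at[OF assms] by metis
  obtain z zs where Q_eq: "Q = \<sigma> x # z # zs"
    using cycle_Q(3,4) length_C by (cases Q; cases "tl Q") auto
  have path_Q: "is_path Q" using cycle_Q(1) by (simp add: is_cycle_def)
  have "cycle_of_list Q (\<sigma> x) = z"
    by (rule cycle_of_list_consecutive[OF is_pathD(2)[OF path_Q], of "[]" _ _ zs]) (simp add: Q_eq)
  then have "\<sigma> (\<sigma> x) = z" using cycle_Q(6) by simp
  moreover have "is_path (z # zs)" using path_Q Q_eq is_path_Cons_iff[of "z # zs" "\<sigma> x"] by simp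
  moreover have "set (z # zs) \<subseteq> set C" using cycle_Q(2) Q_eq by auto
  moreover have "length (z # zs) = length C - 1" "last (z # zs) = x" using cycle_Q(3,5) Q_eq by auto
  ultimately show thesis using that[of "z # zs"] by simp
qed

lemma next_next_in_if_alternating:
  assumes "set C = U \<union> \<sigma> ` U" "U \<inter> \<sigma> ` U = {}" "x \<in> U"
  shows "\<sigma> (\<sigma> x) \<in> U"
proof (rule ccontr)
  assume "\<sigma> (\<sigma> x) \<notin> U"
  moreover have "x \<in> set C" using assms(1,3) by blast
  then have "\<sigma> (\<sigma> x) \<in> set C" by simp
  ultimately have "\<sigma> (\<sigma> x) \<in> \<sigma> ` U" using assms(1) by blast
  then have "\<sigma> x \<in> U" using inj_image_mem_iff[OF inj_next] by blast
  then show False using assms(2,3) by blast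
qed

end

locale cycle_missing_edge =
  nearly_min_degree V adj k + graph_with_inextensible_cycle V adj C
  for V :: "'a set" and adj k C +
  assumes bounded: "paths_bounded (length C + 2)" and length_C_eq: "length C = 2 * k"
    and order: "length C + 2 < card V"
begin

lemma k_ge_2: "2 \<le> k"
  using length_C length_C_eq by simp

lemma no_path: "is_path p \<Longrightarrow> length p \<noteq> length C + 3"
  using paths_boundedD[OF bounded] by fastforce

lemma no_cycle: "is_cycle D \<Longrightarrow> length D \<noteq> length C + 2"
  using no_cycle_of_bounded_length[OF connected bounded order] has_cycleI by blast

lemma cycle_missing_edge_rotate:
  assumes "is_cycle Q" "length Q = length C"
  shows "cycle_missing_edge V adj k Q"
  using assms inextensible bounded length_C_eq order by unfold_locales simp_all

lemma no_path_of_order_3_into_cycle: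
  assumes "x \<in> set C" "adj r x" "r \<notin> set C" "s \<notin> set C" "t \<notin> set C" "adj r s" "adj s t"
  shows "t = r"
proof (rule ccontr)
  assume "t \<noteq> r"
  then have "is_path [t, s, r]"
    using assms(6,7) adj_sym adj_neq[of r s] adj_neq[of s t]
    by (auto simp: is_path_Cons_iff[of "[s, r]"])
  moreover have "set [t, s, r] \<inter> set C = {}" "adj (last [t, s, r]) x" using assms by auto
  ultimately obtain P where "is_path P" "length P = length [t, s, r] + length C"
    using path_into_cycle[OF assms(1)] by blast
  then show False using no_path[of P] by simp
qed

lemma off_cycle_component_star:
  assumes attached: "a \<in> V - set C" "x \<in> set C" "adj a x"
  shows "component (set C) a \<subseteq> insert a (nbrs a)"
proof -
  have "component (set C) a \<subseteq> insert a (nbrs a - set C)"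
  proof (rule component_subset)
    fix b d assume b_in: "b \<in> insert a (nbrs a - set C)" and edge_d: "adj b d" "d \<notin> set C"
    show "d \<in> insert a (nbrs a - set C)"
    proof (cases "b = a")
      case False
      then have "d = a"
        using no_path_of_order_3_into_cycle[OF attached(2,3), of b d] attached(1) b_in edge_d
        by simp
      then show ?thesis by simp
    qed (use edge_d in simp)
  qed simp
  then show ?thesis by blast
qed

text \<open>
  A component off the cycle is a star centered at a vertex with a neighbour on the cycle, and
  a star with two leaves would have two vertices of degree one.
\<close>

lemma off_cycle_matching: "induces_matching (V - set C)"
  unfolding induces_matching_def
proof (intro ballI impI, rule ccontr)
  fix x y z assume x_off: "x \<in> V - set C"
    and two_edges: "y \<in> V - set C" "z \<in> V - set C" "adj x y" "adj x z" "y \<noteq> z"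
  have "set C \<noteq> {}" using length_C by auto
  then obtain a b where attached: "a \<in> component (set C) x" "b \<in> set C" "adj a b"
    by (rule component_attached[OF connected x_off _ C_V])
  have a_off: "a \<in> V - set C" using attached(1) component_in[OF x_off] by blast
  have "x = a"
  proof (rule ccontr)
    assume "x \<noteq> a"
    then have "adj a x"
      using off_cycle_component_star[OF a_off attached(2,3)] component_sym[OF attached(1)] by auto
    then have "y = a" "z = a"
      using no_path_of_order_3_into_cycle[OF attached(2,3), of x] x_off two_edges a_off by auto
    then show False using two_edges(5) by simp
  qed
  then have edge_xb: "adj x b" using attached(3) by simp
  have leaf: "deg v < k"
    if edge_v: "v \<in> V - set C" "adj x v" and edge_w: "w \<in> V - set C" "adj x w" "w \<noteq> v" for v w
  proof -
    have "d = x" if edge_d: "adj v d" for d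
    proof (cases "d \<in> set C")
      case True
      then show ?thesis
        using no_path_of_order_3_into_cycle[OF True edge_d, of x w] x_off edge_v edge_w adj_sym
        by simp
    next
      case False
      then show ?thesis
        using no_path_of_order_3_into_cycle[OF attached(2) edge_xb, of v d] x_off edge_v edge_d
        by simp
    qed
    then have "deg v \<le> card {x}" by (intro card_mono) auto
    then show ?thesis using k_ge_2 by simp
  qed
  have "deg y < k" "deg z < k" using leaf[of y z] leaf[of z y] two_edges by blast+
  then show False using low_unique two_edges by blast
qed

lemma off_cycle_nbr_unique:
  "adj x y \<Longrightarrow> adj x z \<Longrightarrow> x \<notin> set C \<Longrightarrow> y \<notin> set C \<Longrightarrow> z \<notin> set C \<Longrightarrow> y = z"
  using induces_matchingD[OF off_cycle_matching] adj_V by blast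

end

locale off_edge = cycle_missing_edge V adj k C for V :: "'a set" and adj k C +
  fixes u v
  assumes uv: "adj u v" and u_off: "u \<notin> set C" and v_off: "v \<notin> set C"
begin

lemma off_edge_swap: "off_edge V adj k C v u"
  using uv u_off v_off adj_sym by unfold_locales

lemma off_edge_rotate:
  assumes "is_cycle Q" "set Q = set C" "length Q = length C"
  shows "off_edge V adj k Q u v"
  using assms uv u_off v_off
  by (intro off_edge.intro cycle_missing_edge_rotate off_edge_axioms.intro) simp_all

lemma uv_V: "u \<in> V" "v \<in> V" "u \<noteq> v"
  using uv adj_V adj_neq by blast+

lemma off_nbr: "adj u x \<Longrightarrow> x \<notin> set C \<Longrightarrow> x = v"
  using off_cycle_nbr_unique uv u_off v_off by blast

lemma nbrs_u: "nbrs u = insert v (nbrs u \<inter> set C)"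
  using off_nbr uv mem_nbrs by blast

lemma not_adj_next:
  assumes edge_x: "x \<in> set C" "adj u x"
  shows "\<not> adj v (\<sigma> x)"
proof
  assume next_edge: "adj v (\<sigma> x)"
  obtain Q where path_Q: "is_path Q" "set Q = set C" "length Q = length C" "hd Q = x" "last Q = \<sigma> x"
    using spanning_path_to_next[OF edge_x(1)] .
  have nonempty: "Q \<noteq> []" using path_Q(1) by auto
  have "is_path (v # u # Q)"
    using path_Q nonempty uv u_off v_off uv_V edge_x adj_sym[OF uv] by (auto simp: is_path_Cons_iff)
  then have "is_cycle (v # u # Q)"
    using path_Q nonempty next_edge adj_sym length_C unfolding is_cycle_def by auto
  then show False using no_cycle[of "v # u # Q"] path_Q(3) by simp
qed

lemma not_adj_next_next:
  assumes edge_x: "x \<in> set C" "adj u x"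
  shows "\<not> adj v (\<sigma> (\<sigma> x))"
proof
  assume next_next_edge: "adj v (\<sigma> (\<sigma> x))"
  obtain Q
    where path_Q: "is_path Q" "set Q \<subseteq> set C" "length Q = length C - 1" "hd Q = \<sigma> (\<sigma> x)" "last Q = x"
    using path_skipping_next[OF edge_x(1)] by metis
  have nonempty: "Q \<noteq> []" using path_Q(1) by auto
  have "u \<notin> set Q" "v \<notin> set Q" using path_Q(2) u_off v_off by auto
  then have "is_path (u # v # Q)"
    using path_Q nonempty next_next_edge uv uv_V by (auto simp: is_path_Cons_iff)
  then have "is_cycle (u # v # Q)"
    using path_Q nonempty edge_x(2) adj_sym length_C unfolding is_cycle_def by auto
  then show False using inextensible path_Q(3) length_C by (auto simp: has_cycle_def)
qed

lemma other_not_adj_next: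
  assumes "q \<notin> set C \<union> {u, v}" "x \<in> set C" "adj u x"
  shows "\<not> adj q (\<sigma> x)"
proof
  assume "adj q (\<sigma> x)"
  then obtain P where "is_path P" "length P = length [v, u] + length C + length [q]"
    using path_through_cycle_edge[OF assms(2), of "[v, u]" "[q]"] assms u_off v_off
      adj_sym[OF uv] adj_sym[of q] adj_V by auto
  then show False using no_path[of P] by simp
qed

lemma other_not_adj_previous:
  assumes "q \<notin> set C \<union> {u, v}" "x \<in> set C" "adj u (\<sigma> x)"
  shows "\<not> adj q x"
proof
  assume "adj q x"
  then obtain P where "is_path P" "length P = length [q] + length C + length [u, v]"
    using path_through_cycle_edge[OF assms(2), of "[q]" "[u, v]"] assms u_off v_off
      uv adj_sym[OF assms(3)] adj_V by auto
  then show False using no_path[of P] by simp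
qed

lemma ex_vertex_off_path: "\<exists>q\<in>V. q \<notin> set C \<union> {u, v}"
proof -
  have "card (set C \<union> {u, v}) < card V"
    using card_Un_le[of "set C" "{u, v}"] card_C order uv_V by simp
  then have "\<not> V \<subseteq> set C \<union> {u, v}" using card_mono[of "set C \<union> {u, v}" V] by auto
  then show ?thesis by blast
qed

end

subsection \<open>An edge off the cycle with two ends of large degree\<close>

locale regular_off_edge = off_edge V adj k C u v for V :: "'a set" and adj k C u v +
  assumes reg_u: "k \<le> deg u" and reg_v: "k \<le> deg v"
begin

definition X :: "'a set" where "X = nbrs u \<inter> set C"
definition Y :: "'a set" where "Y = nbrs v \<inter> set C"

lemma mem_X_iff: "x \<in> X \<longleftrightarrow> adj u x \<and> x \<in> set C" and mem_Y_iff: "x \<in> Y \<longleftrightarrow> adj v x \<and> x \<in> set C"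
  by (simp_all add: X_def Y_def)

lemma X_C: "X \<subseteq> set C" and Y_C: "Y \<subseteq> set C"
  by (simp_all add: X_def Y_def)

lemma finite_X [simp]: "finite X" and finite_Y [simp]: "finite Y"
  by (simp_all add: X_def Y_def)

lemma nbrs_u_eq: "nbrs u = insert v X" and nbrs_v_eq: "nbrs v = insert u Y"
  using nbrs_u off_edge.nbrs_u[OF off_edge_swap] by (simp_all add: X_def Y_def)

lemma card_X_ge: "k - 1 \<le> card X" and card_Y_ge: "k - 1 \<le> card Y"
  using card_insert_le_m1[of "deg u" X v] card_insert_le_m1[of "deg v" Y u] k_ge_2 reg_u reg_v
  by (auto simp: nbrs_u_eq nbrs_v_eq card_insert_if split: if_splits)

lemma next_not_in:
  assumes "x \<in> X \<union> Y"
  shows "\<sigma> x \<notin> X \<union> Y"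
  using assms next_of_nbr_not_nbr u_off v_off not_adj_next off_edge.not_adj_next[OF off_edge_swap]
  unfolding X_def Y_def by auto

lemma next_next_not_in: "x \<in> X \<Longrightarrow> \<sigma> (\<sigma> x) \<notin> Y" "x \<in> Y \<Longrightarrow> \<sigma> (\<sigma> x) \<notin> X"
  using not_adj_next_next off_edge.not_adj_next_next[OF off_edge_swap] unfolding X_def Y_def by auto

lemma card_attached_le: "card (X \<union> Y) \<le> k"
proof -
  have "(X \<union> Y) \<inter> \<sigma> ` (X \<union> Y) = {}" using next_not_in by blast
  then show ?thesis using card_disjoint_next(2)[of "X \<union> Y"] X_C Y_C length_C_eq by simp
qed

lemma card_attached_neq: "card (X \<union> Y) \<noteq> k"
proof
  assume card_eq: "card (X \<union> Y) = k"
  have disjoint: "(X \<union> Y) \<inter> \<sigma> ` (X \<union> Y) = {}" using next_not_in by blast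
  have "set C = (X \<union> Y) \<union> \<sigma> ` (X \<union> Y)"
    using card_disjoint_next(1)[OF _ disjoint] card_eq card_C length_C_eq
      next_image_subset[of "X \<union> Y"]
      X_C Y_C by (intro card_subset_eq[symmetric]) auto
  then have step: "\<sigma> (\<sigma> x) \<in> X \<union> Y" if "x \<in> X \<union> Y" for x
    using next_next_in_if_alternating[OF _ disjoint that] by blast
  have "\<sigma> ` \<sigma> ` X \<subseteq> (X \<union> Y) - Y" using step next_next_not_in by blast
  then have "card (\<sigma> ` \<sigma> ` X) \<le> card ((X \<union> Y) - Y)" by (intro card_mono) auto
  then have "card X \<le> k - card Y" using card_eq by (simp add: card_Diff_subset)
  then have "k = 2" "card X = 1" using card_X_ge card_Y_ge k_ge_2 by linarith+
  then obtain x where X_eq: "X = {x}" by (auto simp: card_1_singleton_iff)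
  then have "\<sigma> (\<sigma> x) \<in> X" using step[of x] next_next_not_in(1)[of x] by blast
  moreover have "x \<in> set C" using X_eq X_C by blast
  ultimately show False using X_eq next_next_neq[of x] by simp
qed

lemma card_X: "card X = k - 1" and Y_eq_X: "Y = X"
proof -
  have card_bound: "card (X \<union> Y) \<le> k - 1" using card_attached_le card_attached_neq by linarith
  then have "X = X \<union> Y" using card_X_ge by (intro card_seteq) auto
  moreover have "Y = X \<union> Y" using card_bound card_Y_ge by (intro card_seteq) auto
  ultimately show "Y = X" by simp
  then show "card X = k - 1" using card_bound card_X_ge by simp
qed

lemma next_not_in_X: "x \<in> X \<Longrightarrow> \<sigma> x \<notin> X" and next_next_not_in_X: "x \<in> X \<Longrightarrow> \<sigma> (\<sigma> x) \<notin> X"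
  using next_not_in next_next_not_in(1) Y_eq_X by blast+

lemma k_le_3: "k \<le> 3"
proof -
  have disjoint: "X \<inter> \<sigma> ` X = {}" "X \<inter> \<sigma> ` \<sigma> ` X = {}"
    using next_not_in_X next_next_not_in_X by blast+
  then have "\<sigma> ` X \<inter> \<sigma> ` \<sigma> ` X = {}" by (simp flip: image_Int[OF inj_next])
  then have "card (X \<union> (\<sigma> ` X \<union> \<sigma> ` \<sigma> ` X)) = 3 * card X"
    using disjoint by (simp add: card_Un_disjoint Int_Un_distrib)
  moreover have "card (X \<union> (\<sigma> ` X \<union> \<sigma> ` \<sigma> ` X)) \<le> card (set C)"
    using X_C next_image_subset by (intro card_mono) simp_all
  ultimately show ?thesis using card_X card_C length_C_eq by simp
qed

lemma off_cycle_attached_in_X: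
  assumes edge_q: "q \<notin> set C" "adj q x" "x \<in> set C" and y_in: "y \<in> X"
  shows "x \<noteq> \<sigma> y" "\<sigma> x \<noteq> y"
proof -
  have "q \<in> {u, v} \<Longrightarrow> x \<in> X" using edge_q(2,3) Y_eq_X mem_X_iff mem_Y_iff by blast
  then show "x \<noteq> \<sigma> y" "\<sigma> x \<noteq> y"
    using other_not_adj_next[of q y] other_not_adj_previous[of q x] next_not_in_X edge_q y_in
    unfolding mem_X_iff by blast+
qed

lemma regular_off_edge_rotate:
  assumes "is_cycle Q" "set Q = set C" "length Q = length C"
  shows "regular_off_edge V adj k Q u v"
  using off_edge_rotate[OF assms] reg_u reg_v
  by (intro regular_off_edge.intro regular_off_edge_axioms.intro)

lemma rotate_to_X:
  obtains c Q where "c \<in> X" "is_cycle Q" "set Q = set C" "length Q = length C" "hd Q = c"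
proof -
  have "X \<noteq> {}" using card_X k_ge_2 by fastforce
  then obtain c where c_in: "c \<in> X" by blast
  then obtain y where "y \<in> set C" "\<sigma> y = c" using ex_previous X_C by blast
  then show thesis using rotation_ending_at[of y] that c_in by metis
qed

end

subsection \<open>An edge off the cycle with an end of small degree\<close>

locale pendant_off_edge = off_edge V adj k C u v for V :: "'a set" and adj k C u v +
  assumes low_v: "deg v < k"
    and only_edge: "adj x y \<Longrightarrow> x \<notin> set C \<Longrightarrow> y \<notin> set C \<Longrightarrow> {x, y} = {u, v}"
begin

lemma regular: "x \<in> V \<Longrightarrow> x \<noteq> v \<Longrightarrow> k \<le> deg x"
  using deg_ge[OF low_v] uv_V by blast

lemma isolated_off_cycle: "q \<notin> set C \<union> {u, v} \<Longrightarrow> nbrs q \<subseteq> set C"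
  using only_edge[of q] mem_nbrs by blast

context
  fixes r
  assumes r_off: "r \<in> V" "r \<notin> set C \<union> {u, v}"
begin

abbreviation A :: "'a set" where "A \<equiv> nbrs r"

lemma A_C: "A \<subseteq> set C"
  by (rule isolated_off_cycle[OF r_off(2)])

lemma A_next_disjoint: "A \<inter> \<sigma> ` A = {}"
  using r_off(2) A_C by (intro nbrs_disjoint_next) auto

lemma card_A: "card A = k"
  using card_disjoint_next(2)[OF A_C A_next_disjoint] regular[of r] r_off length_C_eq by simp

lemma C_alternates: "set C = A \<union> \<sigma> ` A"
  using card_disjoint_next(1)[OF A_C A_next_disjoint] A_C next_image_subset[OF A_C] card_A card_C
    length_C_eq by (intro card_subset_eq[symmetric]) auto

lemma edge_attached_in_A:
  assumes edge_x: "x \<in> set C" "adj u x \<or> adj v x"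
  shows "x \<in> A"
proof (rule ccontr)
  assume "x \<notin> A"
  then obtain a where before_x: "a \<in> A" "x = \<sigma> a" using edge_x(1) C_alternates by blast
  have a_in_C: "a \<in> set C" using before_x(1) A_C by blast
  have edge_ra: "adj r a" using before_x(1) by simp
  have "\<not> adj u (\<sigma> a)" using other_not_adj_previous[OF r_off(2) a_in_C] edge_ra by blast
  moreover have "\<not> adj v (\<sigma> a)"
    using off_edge.other_not_adj_previous[OF off_edge_swap, of r a] r_off(2) a_in_C edge_ra by auto
  ultimately show False using edge_x(2) before_x(2) by simp
qed

lemma card_attached_u: "k - 1 \<le> card (nbrs u \<inter> set C)"
proof -
  have "v \<notin> nbrs u \<inter> set C" using v_off by simp
  then have "deg u = Suc (card (nbrs u \<inter> set C))"
    by (subst nbrs_u) (simp add: card_insert_disjoint del: Int_iff)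
  then show ?thesis using regular[of u] uv_V by simp
qed

lemma other_attached_in_A:
  assumes edge_q: "q \<notin> set C \<union> {u, v}" "adj q x"
  shows "x \<in> A"
proof (rule ccontr)
  assume "x \<notin> A"
  moreover have x_in_C: "x \<in> set C" using isolated_off_cycle[OF edge_q(1)] edge_q(2) by auto
  ultimately obtain a where before_x: "a \<in> A" "x = \<sigma> a" using C_alternates by blast
  have a_in_C: "a \<in> set C" using before_x(1) A_C by blast
  have "\<not> adj u a" using other_not_adj_next[OF edge_q(1) a_in_C] edge_q(2) before_x(2) by blast
  moreover have "\<not> adj u (\<sigma> (\<sigma> a))"
    using other_not_adj_previous[OF edge_q(1) x_in_C] edge_q(2) before_x(2) by blast
  ultimately have "nbrs u \<inter> set C \<subseteq> A - {a, \<sigma> (\<sigma> a)}" using edge_attached_in_A by auto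
  then have "card (nbrs u \<inter> set C) \<le> card (A - {a, \<sigma> (\<sigma> a)})" by (intro card_mono) auto
  also have "\<dots> = k - 2"
    using next_next_in_if_alternating[OF C_alternates A_next_disjoint before_x(1)] before_x(1)
      next_next_neq[OF a_in_C] card_A by (subst card_Diff_subset) auto
  finally show False using card_attached_u k_ge_2 by simp
qed

lemma A_covers:
  assumes edge_xy: "adj x y" "x \<notin> A" "y \<notin> A"
  shows "{x, y} = {u, v}"
proof (rule ccontr)
  assume not_uv: "{x, y} \<noteq> {u, v}"
  have off_A: "b \<in> A" if "adj a b" "a \<notin> set C" "b \<in> set C" for a b
    using edge_attached_in_A[OF that(3)] other_attached_in_A[of a b] that by blast
  have "x \<in> set C" "y \<in> set C"
    using only_edge[OF edge_xy(1)] off_A[of x y] off_A[of y x] edge_xy adj_sym[OF edge_xy(1)] not_uv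
    by blast+
  then obtain a b where "a \<in> A" "x = \<sigma> a" "b \<in> A" "y = \<sigma> b" using C_alternates edge_xy by blast
  then show False using next_of_nbrs_not_adj[of r a b] r_off(2) A_C edge_xy(1) mem_nbrs by blast
qed

lemma covered_except_edge: "covered_except k 2"
proof -
  have "{u, v} \<subseteq> V - A" using uv_V A_C u_off v_off by blast
  moreover have "x \<in> A \<or> y \<in> A \<or> x \<in> {u, v} \<and> y \<in> {u, v}" if "adj x y" for x y
    using A_covers[OF that] by blast
  ultimately show ?thesis
    unfolding covered_except_def using card_A nbrs_subset uv_V(3)
    by (intro exI[of _ A] exI[of _ "{u, v}"]) auto
qed

end

lemma covered: "covered_except k 2"
  using ex_vertex_off_path covered_except_edge by blast

end

subsection \<open>Cycles of length four\<close>

context regular_off_edge begin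

context
  fixes c\<^sub>0 c\<^sub>1 c\<^sub>2 c\<^sub>3
  assumes C_eq: "C = [c\<^sub>0, c\<^sub>1, c\<^sub>2, c\<^sub>3]" and c\<^sub>0_X: "c\<^sub>0 \<in> X"
begin

lemma k_eq_2: "k = 2"
  using length_C_eq C_eq by simp

lemma four_cycle_vertices: "distinct [c\<^sub>0, c\<^sub>1, c\<^sub>2, c\<^sub>3]" "{c\<^sub>0, c\<^sub>1, c\<^sub>2, c\<^sub>3} \<subseteq> V"
  using distinct_C C_V C_eq by auto

lemma four_cycle_edges: "adj c\<^sub>0 c\<^sub>1" "adj c\<^sub>1 c\<^sub>2" "adj c\<^sub>2 c\<^sub>3" "adj c\<^sub>3 c\<^sub>0"
  using cycle_C C_eq by (auto simp: is_cycle_def is_path_def)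

lemma four_cycle_next: "\<sigma> c\<^sub>0 = c\<^sub>1" "\<sigma> c\<^sub>3 = c\<^sub>0"
  using cycle_of_list_consecutive[OF distinct_C, of "[]" c\<^sub>0 c\<^sub>1 "[c\<^sub>2, c\<^sub>3]"]
    cycle_of_list_last[OF distinct_C] C_eq by simp_all

lemma X_eq_singleton: "X = {c\<^sub>0}"
  using card_X c\<^sub>0_X k_eq_2 by (auto simp: card_1_singleton_iff)

lemma triangle_nbrs: "nbrs u = {c\<^sub>0, v}" "nbrs v = {c\<^sub>0, u}"
  using nbrs_u_eq nbrs_v_eq Y_eq_X X_eq_singleton by auto

lemma triangle_adj: "adj u c\<^sub>0" "adj v c\<^sub>0"
  using triangle_nbrs mem_nbrs by blast+

lemma off_four_cycle_nbr:
  assumes "q \<notin> set C" "adj q x" "x \<in> set C"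
  shows "x = c\<^sub>0 \<or> x = c\<^sub>2"
  using off_cycle_attached_in_X[OF assms c\<^sub>0_X] four_cycle_next assms(3) C_eq by auto

lemma adj_c\<^sub>2_off_triangle: "adj q c\<^sub>2 \<Longrightarrow> q \<notin> set C \<Longrightarrow> q \<notin> {u, v}"
proof -
  have "c\<^sub>2 \<notin> X" "c\<^sub>2 \<notin> Y" "c\<^sub>2 \<in> set C"
    using Y_eq_X X_eq_singleton four_cycle_vertices(1) C_eq by auto
  then show "adj q c\<^sub>2 \<Longrightarrow> q \<notin> set C \<Longrightarrow> q \<notin> {u, v}" using mem_X_iff mem_Y_iff by blast
qed

lemma not_adj_c\<^sub>2_if_chord:
  assumes chord: "adj c\<^sub>1 c\<^sub>3" and q_off: "q \<notin> set C"
  shows "\<not> adj q c\<^sub>2"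
proof
  assume edge_q: "adj q c\<^sub>2"
  have "is_path [v, u, c\<^sub>0, c\<^sub>1, c\<^sub>3, c\<^sub>2, q]"
    using four_cycle_vertices four_cycle_edges uv_V uv u_off v_off triangle_adj chord q_off
      adj_c\<^sub>2_off_triangle[OF edge_q q_off] adj_V[OF edge_q] adj_sym[OF edge_q] adj_sym C_eq
    by (auto simp: is_path_def)
  then show False using no_path C_eq by fastforce
qed

lemma small_components_if_chord:
  assumes chord: "adj c\<^sub>1 c\<^sub>3"
  shows "small_components_but_one k"
proof (rule small_components_but_oneI)
  show "c\<^sub>0 \<in> V" "{c\<^sub>1, c\<^sub>2, c\<^sub>3} \<subseteq> V - {c\<^sub>0}" using four_cycle_vertices by auto
  show "card {c\<^sub>1, c\<^sub>2, c\<^sub>3} \<le> k + 1" using k_eq_2 by (simp add: card_insert_if)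
  show "separates c\<^sub>0 {c\<^sub>1, c\<^sub>2, c\<^sub>3}"
  proof (rule separatesI)
    fix x y assume edge_xy: "x \<in> {c\<^sub>1, c\<^sub>2, c\<^sub>3}" "adj x y" "y \<noteq> c\<^sub>0"
    have "y \<in> set C"
    proof (rule ccontr)
      assume y_off: "y \<notin> set C"
      have "x \<in> set C" "x \<noteq> c\<^sub>0" using edge_xy(1) C_eq four_cycle_vertices(1) by auto
      then have "x = c\<^sub>2" using off_four_cycle_nbr[OF y_off adj_sym[OF edge_xy(2)]] by blast
      then show False using not_adj_c\<^sub>2_if_chord[OF chord y_off] adj_sym[OF edge_xy(2)] by blast
    qed
    then show "y \<in> {c\<^sub>1, c\<^sub>2, c\<^sub>3}" using edge_xy(3) C_eq by simp
  qed
  fix p assume path_p: "is_path (c\<^sub>0 # p)" "set p \<inter> {c\<^sub>1, c\<^sub>2, c\<^sub>3} = {}"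
  have "is_path [c\<^sub>1, c\<^sub>2, c\<^sub>3]"
    using four_cycle_vertices four_cycle_edges by (auto simp: is_path_def)
  then have "is_path ([c\<^sub>1, c\<^sub>2, c\<^sub>3] @ c\<^sub>0 # p)"
    using path_p four_cycle_vertices(1) four_cycle_edges(4)
    by (intro is_path_appendI[OF _ path_p(1)]) auto
  from paths_boundedD[OF bounded this] show "length p \<le> k" using C_eq k_eq_2 by simp
qed

lemma not_adj_c\<^sub>2_if_off_edge:
  assumes "q \<notin> set C" "q' \<notin> set C" "adj q q'"
  shows "\<not> adj q c\<^sub>2"
proof
  assume edge_q: "adj q c\<^sub>2"
  note q_notin = adj_c\<^sub>2_off_triangle[OF edge_q assms(1)]
  have "q' \<notin> {u, v}"
    using q_notin off_nbr[of q] off_edge.off_nbr[OF off_edge_swap, of q] adj_sym[OF assms(3)]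
      assms(1)
    by blast
  then have "is_path [v, u, c\<^sub>0, c\<^sub>1, c\<^sub>2, q, q']"
    using four_cycle_vertices four_cycle_edges uv_V uv u_off v_off triangle_adj assms q_notin
      adj_V[OF assms(3)] adj_neq[OF assms(3)] adj_sym[OF edge_q] adj_sym C_eq
    by (auto simp: is_path_def)
  then show False using no_path C_eq by fastforce
qed

lemma hub_star_matching_if_no_chord:
  assumes no_chord: "\<not> adj c\<^sub>1 c\<^sub>3"
  shows hub_star_matching
proof -
  define M where "M = {x. x \<notin> set C \<and> (\<exists>y. y \<notin> set C \<and> adj x y)}"
  define S where "S = V - {c\<^sub>0} - M"
  have M_edge: "y \<in> M" if "x \<in> M" "adj x y" "y \<noteq> c\<^sub>0" for x y
  proof -
    have "x \<notin> set C" "\<not> adj x c\<^sub>2" using that(1) not_adj_c\<^sub>2_if_off_edge unfolding M_def by blast+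
    then have "y \<notin> set C" using off_four_cycle_nbr[OF _ that(2)] that(2,3) by blast
    then show ?thesis using \<open>x \<notin> set C\<close> that(2) adj_sym unfolding M_def by blast
  qed
  have "separates c\<^sub>0 S"
    using M_edge adj_sym adj_V unfolding S_def by (intro separatesI) blast
  moreover have "nbrs x \<subseteq> {c\<^sub>2, c\<^sub>0}" if x_in: "x \<in> S - {c\<^sub>2}" for x
  proof (cases "x \<in> set C")
    case True
    then have "x = c\<^sub>1 \<or> x = c\<^sub>3" using x_in C_eq by (auto simp: S_def)
    moreover have "y \<in> set C" if "adj x y" for y
      using off_four_cycle_nbr[OF _ adj_sym[OF that] True] x_in by (auto simp: S_def)
    ultimately show ?thesis
      using no_chord adj_commute[of c\<^sub>1 c\<^sub>3] adj_irrefl C_eq by fastforce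
  next
    case False
    have "y \<in> set C" if "adj x y" for y using x_in that False by (auto simp: S_def M_def)
    then show ?thesis using off_four_cycle_nbr[OF False] unfolding nbrs_def by blast
  qed
  moreover have "V - {c\<^sub>0} - S \<subseteq> V - set C" by (auto simp: S_def M_def)
  then have "induces_matching (V - {c\<^sub>0} - S)"
    by (rule induces_matching_subset[OF off_cycle_matching])
  moreover have "c\<^sub>0 \<in> V" "c\<^sub>2 \<in> S" using four_cycle_vertices C_eq by (auto simp: S_def M_def)
  ultimately show ?thesis
    unfolding hub_star_matching_def
    by (intro bexI[of _ c\<^sub>0] exI[of _ S] conjI bexI[of _ c\<^sub>2]) (auto simp: S_def)
qed

lemma extremal_if_four_cycle: extremal
  using small_components_if_chord hub_star_matching_if_no_chord extremalI(3,5) k_eq_2 by blast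

end

end

subsection \<open>Cycles of length six\<close>

context regular_off_edge begin

context
  fixes c\<^sub>0 c\<^sub>1 c\<^sub>2 c\<^sub>3 c\<^sub>4 c\<^sub>5
  assumes C_eq: "C = [c\<^sub>0, c\<^sub>1, c\<^sub>2, c\<^sub>3, c\<^sub>4, c\<^sub>5]" and c\<^sub>0_X: "c\<^sub>0 \<in> X"
begin

lemma k_eq_3: "k = 3"
  using length_C_eq C_eq by simp

lemma six_cycle_vertices:
  "distinct [c\<^sub>0, c\<^sub>1, c\<^sub>2, c\<^sub>3, c\<^sub>4, c\<^sub>5]" "{c\<^sub>0, c\<^sub>1, c\<^sub>2, c\<^sub>3, c\<^sub>4, c\<^sub>5} \<subseteq> V"
  using distinct_C C_V C_eq by auto

lemma six_cycle_edges: "adj c\<^sub>0 c\<^sub>1" "adj c\<^sub>1 c\<^sub>2" "adj c\<^sub>2 c\<^sub>3" "adj c\<^sub>3 c\<^sub>4" "adj c\<^sub>4 c\<^sub>5" "adj c\<^sub>5 c\<^sub>0"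
  using cycle_C C_eq by (auto simp: is_cycle_def is_path_def)

lemma six_cycle_next: "\<sigma> c\<^sub>0 = c\<^sub>1" "\<sigma> c\<^sub>1 = c\<^sub>2" "\<sigma> c\<^sub>2 = c\<^sub>3" "\<sigma> c\<^sub>3 = c\<^sub>4" "\<sigma> c\<^sub>4 = c\<^sub>5" "\<sigma> c\<^sub>5 = c\<^sub>0"
  using cycle_of_list_consecutive[OF distinct_C, of "[]" c\<^sub>0 c\<^sub>1 "[c\<^sub>2, c\<^sub>3, c\<^sub>4, c\<^sub>5]"]
    cycle_of_list_consecutive[OF distinct_C, of "[c\<^sub>0]" c\<^sub>1 c\<^sub>2 "[c\<^sub>3, c\<^sub>4, c\<^sub>5]"]
    cycle_of_list_consecutive[OF distinct_C, of "[c\<^sub>0, c\<^sub>1]" c\<^sub>2 c\<^sub>3 "[c\<^sub>4, c\<^sub>5]"]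
    cycle_of_list_consecutive[OF distinct_C, of "[c\<^sub>0, c\<^sub>1, c\<^sub>2]" c\<^sub>3 c\<^sub>4 "[c\<^sub>5]"]
    cycle_of_list_consecutive[OF distinct_C, of "[c\<^sub>0, c\<^sub>1, c\<^sub>2, c\<^sub>3]" c\<^sub>4 c\<^sub>5 "[]"]
    cycle_of_list_last[OF distinct_C] C_eq by simp_all

lemma X_eq_antipodal: "X = {c\<^sub>0, c\<^sub>3}"
proof -
  have "c\<^sub>1 \<notin> X" "c\<^sub>5 \<notin> X" using next_not_in_X[of c\<^sub>0] next_not_in_X[of c\<^sub>5] six_cycle_next c\<^sub>0_X by auto
  moreover have "c\<^sub>2 \<notin> X" "c\<^sub>4 \<notin> X"
    using next_next_not_in_X[of c\<^sub>0] next_next_not_in_X[of c\<^sub>4] six_cycle_next c\<^sub>0_X by auto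
  ultimately have "X \<subseteq> {c\<^sub>0, c\<^sub>3}" using X_C C_eq by auto
  then show ?thesis using card_X k_eq_3 six_cycle_vertices(1) by (intro card_seteq) auto
qed

lemma antipodal_adj: "adj u c\<^sub>0" "adj u c\<^sub>3" "adj v c\<^sub>0" "adj v c\<^sub>3"
  using X_eq_antipodal Y_eq_X mem_X_iff mem_Y_iff by blast+

lemma off_six_cycle_nbr:
  assumes "q \<notin> set C" "adj q x" "x \<in> set C"
  shows "x = c\<^sub>0 \<or> x = c\<^sub>3"
proof -
  have "x \<in> {c\<^sub>0, c\<^sub>1, c\<^sub>2, c\<^sub>3, c\<^sub>4, c\<^sub>5}" using assms(3) C_eq by simp
  moreover have "c\<^sub>3 \<in> X" using X_eq_antipodal by simp
  ultimately show ?thesis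
    using off_cycle_attached_in_X[OF assms c\<^sub>0_X] off_cycle_attached_in_X[OF assms, of c\<^sub>3]
      six_cycle_next by auto
qed

text \<open>Every chord would give a path on nine vertices ending in \<open>c\<^sub>3, u, v, c\<^sub>0, q\<close>.\<close>

lemma no_chords_if_adj_c\<^sub>0:
  assumes edge_q: "q \<notin> set C \<union> {u, v}" "adj q c\<^sub>0"
  shows "\<not> adj c\<^sub>1 c\<^sub>4" "\<not> adj c\<^sub>1 c\<^sub>5" "\<not> adj c\<^sub>2 c\<^sub>4" "\<not> adj c\<^sub>2 c\<^sub>5"
proof -
  have not_path: "\<not> is_path [w, x, y, z, c\<^sub>3, u, v, c\<^sub>0, q]" for w x y z
    using no_path C_eq by fastforce
  have path: "is_path [w, x, y, z, c\<^sub>3, u, v, c\<^sub>0, q]"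
    if "distinct [w, x, y, z]" "{w, x, y, z} \<subseteq> {c\<^sub>1, c\<^sub>2, c\<^sub>4, c\<^sub>5}"
      and "adj w x" "adj x y" "adj y z" "adj z c\<^sub>3" for w x y z
  proof (rule is_path_appendI[of "[w, x, y, z]" "[c\<^sub>3, u, v, c\<^sub>0, q]", simplified])
    show "is_path [w, x, y, z]" using that six_cycle_vertices(2) by (auto simp: is_path_def)
    show "is_path [c\<^sub>3, u, v, c\<^sub>0, q]"
      using six_cycle_vertices uv_V uv u_off v_off antipodal_adj edge_q adj_V[OF edge_q(2)] adj_sym
        C_eq
      by (auto simp: is_path_def)
  qed (use that six_cycle_vertices(1) u_off v_off edge_q(1) C_eq in auto)
  note edges = six_cycle_edges six_cycle_edges[THEN adj_sym]
  show no_14: "\<not> adj c\<^sub>1 c\<^sub>4"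
    using path[of c\<^sub>5 c\<^sub>4 c\<^sub>1 c\<^sub>2] not_path edges adj_sym[of c\<^sub>1 c\<^sub>4] six_cycle_vertices(1) by auto
  show no_15: "\<not> adj c\<^sub>1 c\<^sub>5"
    using path[of c\<^sub>4 c\<^sub>5 c\<^sub>1 c\<^sub>2] not_path edges adj_sym[of c\<^sub>1 c\<^sub>5] six_cycle_vertices(1) by auto
  show no_25: "\<not> adj c\<^sub>2 c\<^sub>5"
    using path[of c\<^sub>1 c\<^sub>2 c\<^sub>5 c\<^sub>4] not_path edges six_cycle_vertices(1) by auto
  show "\<not> adj c\<^sub>2 c\<^sub>4"
  proof
    assume chord: "adj c\<^sub>2 c\<^sub>4"
    have not_c\<^sub>3: "\<not> adj c\<^sub>1 c\<^sub>3" "\<not> adj c\<^sub>5 c\<^sub>3"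
      using path[of c\<^sub>5 c\<^sub>4 c\<^sub>2 c\<^sub>1] path[of c\<^sub>1 c\<^sub>2 c\<^sub>4 c\<^sub>5] not_path edges chord adj_sym[OF chord]
        six_cycle_vertices(1) by auto
    have inside: "y \<in> set C" if "adj c y" "c \<in> {c\<^sub>1, c\<^sub>5}" for c y
      using off_six_cycle_nbr[OF _ adj_sym[OF that(1)]] that(2) six_cycle_vertices(1) C_eq by auto
    have "nbrs c\<^sub>1 \<subseteq> {c\<^sub>0, c\<^sub>2}" "nbrs c\<^sub>5 \<subseteq> {c\<^sub>0, c\<^sub>4}"
      using inside no_14 no_15 no_25 not_c\<^sub>3 adj_sym adj_irrefl C_eq by fastforce+
    then have "deg c\<^sub>1 \<le> card {c\<^sub>0, c\<^sub>2}" "deg c\<^sub>5 \<le> card {c\<^sub>0, c\<^sub>4}" by (simp_all add: card_mono)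
    then have "deg c\<^sub>1 < k" "deg c\<^sub>5 < k"
      using k_eq_3 by (simp_all add: card_insert_if split: if_splits)
    then show False using low_unique[of c\<^sub>1 c\<^sub>5] six_cycle_vertices by auto
  qed
qed

lemma ex_other_adj_antipodal:
  "\<exists>q. q \<notin> set C \<union> {u, v} \<and> (adj q c\<^sub>0 \<or> adj q c\<^sub>3)"
proof -
  have "set C \<union> {u, v} \<subseteq> V" "set C \<union> {u, v} \<noteq> {}" "set C \<union> {u, v} \<noteq> V"
    using C_V uv_V ex_vertex_off_path by auto
  then obtain x q where leaving: "x \<in> set C \<union> {u, v}" "q \<in> V - (set C \<union> {u, v})" "adj x q"
    by (rule connectedE[OF connected])
  have "x \<in> set C"
    using leaving off_nbr[of q] off_edge.off_nbr[OF off_edge_swap, of q] by auto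
  then show ?thesis using off_six_cycle_nbr[of q x] leaving(2) adj_sym[OF leaving(3)] by auto
qed

end

lemma no_chords:
  assumes C_eq: "C = [c\<^sub>0, c\<^sub>1, c\<^sub>2, c\<^sub>3, c\<^sub>4, c\<^sub>5]" and c\<^sub>0_X: "c\<^sub>0 \<in> X"
  shows "\<not> adj c\<^sub>1 c\<^sub>4" "\<not> adj c\<^sub>1 c\<^sub>5" "\<not> adj c\<^sub>2 c\<^sub>4" "\<not> adj c\<^sub>2 c\<^sub>5"
proof -
  let ?Q = "[c\<^sub>3, c\<^sub>4, c\<^sub>5, c\<^sub>0, c\<^sub>1, c\<^sub>2]"
  have Q_eq: "?Q = rotate 3 C" by (simp add: C_eq numeral_eq_Suc)
  interpret rotated: regular_off_edge V adj k ?Q u v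
    unfolding Q_eq by (rule regular_off_edge_rotate) (simp_all add: is_cycle_rotate[OF cycle_C])
  have "c\<^sub>3 \<in> rotated.X"
    using X_eq_antipodal[OF C_eq c\<^sub>0_X] mem_X_iff rotated.mem_X_iff C_eq by auto
  note opposite = rotated.no_chords_if_adj_c\<^sub>0[OF refl this]
  obtain q where attached: "q \<notin> set C \<union> {u, v}" "adj q c\<^sub>0 \<or> adj q c\<^sub>3"
    using ex_other_adj_antipodal[OF C_eq c\<^sub>0_X] by blast
  have "q \<notin> set ?Q \<union> {u, v}" using attached(1) C_eq by auto
  then show "\<not> adj c\<^sub>1 c\<^sub>4" "\<not> adj c\<^sub>1 c\<^sub>5" "\<not> adj c\<^sub>2 c\<^sub>4" "\<not> adj c\<^sub>2 c\<^sub>5"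
    using attached no_chords_if_adj_c\<^sub>0[OF C_eq c\<^sub>0_X attached(1)] opposite[of q] adj_commute
    by blast+
qed

lemma two_hubs_if_six_cycle:
  assumes C_eq: "C = [c\<^sub>0, c\<^sub>1, c\<^sub>2, c\<^sub>3, c\<^sub>4, c\<^sub>5]" and c\<^sub>0_X: "c\<^sub>0 \<in> X"
  shows two_hubs_matching
proof -
  note no_chord = no_chords[OF assms]
  have same_part: "y \<in> set C \<longleftrightarrow> x \<in> set C" if "adj x y" "x \<notin> {c\<^sub>0, c\<^sub>3}" "y \<notin> {c\<^sub>0, c\<^sub>3}" for x y
    using off_six_cycle_nbr[OF assms, of x y] off_six_cycle_nbr[OF assms, of y x] that adj_commute
    by auto
  have partner: "x = c\<^sub>1 \<and> y = c\<^sub>2 \<or> x = c\<^sub>2 \<and> y = c\<^sub>1 \<or> x = c\<^sub>4 \<and> y = c\<^sub>5 \<or> x = c\<^sub>5 \<and> y = c\<^sub>4"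
    if "adj x y" "x \<in> set C - {c\<^sub>0, c\<^sub>3}" "y \<in> set C - {c\<^sub>0, c\<^sub>3}" for x y
    using that no_chord adj_sym[OF that(1)] adj_irrefl unfolding C_eq by auto
  have "induces_matching (V - {c\<^sub>0, c\<^sub>3})"
    unfolding induces_matching_def
  proof (intro ballI impI)
    fix x y z
    assume in_V: "x \<in> V - {c\<^sub>0, c\<^sub>3}" "y \<in> V - {c\<^sub>0, c\<^sub>3}" "z \<in> V - {c\<^sub>0, c\<^sub>3}"
      and two_edges: "adj x y" "adj x z"
    show "y = z"
    proof (cases "x \<in> set C")
      case True
      then have "y \<in> set C" "z \<in> set C" using same_part in_V two_edges by blast+
      then show ?thesis
        using True in_V partner[OF two_edges(1)] partner[OF two_edges(2)] distinct_C unfolding C_eq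
        by auto
    next
      case False
      then show ?thesis using same_part in_V two_edges off_cycle_nbr_unique by blast
    qed
  qed
  moreover have "c\<^sub>0 \<in> V" "c\<^sub>3 \<in> V" "c\<^sub>0 \<noteq> c\<^sub>3" using C_V distinct_C C_eq by auto
  ultimately show ?thesis unfolding two_hubs_matching_def by blast
qed

theorem extremal_if_regular_off_edge: extremal
proof -
  obtain c Q where c_in: "c \<in> X"
    and cycle_Q: "is_cycle Q" "set Q = set C" "length Q = length C" "hd Q = c"
    by (rule rotate_to_X)
  interpret rotated: regular_off_edge V adj k Q u v
    by (rule regular_off_edge_rotate[OF cycle_Q(1-3)])
  have c_in_rotated: "c \<in> rotated.X" using c_in cycle_Q(2) mem_X_iff rotated.mem_X_iff by simp
  have "k = 2 \<or> k = 3" using k_ge_2 k_le_3 by linarith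
  then show ?thesis
  proof
    assume "k = 2"
    then obtain c\<^sub>1 c\<^sub>2 c\<^sub>3 where "Q = [c, c\<^sub>1, c\<^sub>2, c\<^sub>3]"
      using cycle_Q(3,4) length_C_eq by (auto simp: length_Suc_conv numeral_eq_Suc)
    then show ?thesis using c_in_rotated by (rule rotated.extremal_if_four_cycle)
  next
    assume k_eq: "k = 3"
    then obtain c\<^sub>1 c\<^sub>2 c\<^sub>3 c\<^sub>4 c\<^sub>5 where "Q = [c, c\<^sub>1, c\<^sub>2, c\<^sub>3, c\<^sub>4, c\<^sub>5]"
      using cycle_Q(3,4) length_C_eq by (auto simp: length_Suc_conv numeral_eq_Suc)
    then have two_hubs_matching using c_in_rotated by (rule rotated.two_hubs_if_six_cycle)
    then show ?thesis by (rule extremalI(6)[OF k_eq])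
  qed
qed

end

theorem (in off_edge) extremal_if_off_edge: extremal
proof (cases "\<exists>x y. adj x y \<and> x \<notin> set C \<and> y \<notin> set C \<and> k \<le> deg x \<and> k \<le> deg y")
  case True
  then obtain x y where "regular_off_edge V adj k C x y"
    by (meson cycle_missing_edge_axioms off_edge.intro off_edge_axioms.intro
        regular_off_edge.intro regular_off_edge_axioms.intro)
  then show ?thesis by (rule regular_off_edge.extremal_if_regular_off_edge)
next
  case False
  then have low: "deg x < k \<or> deg y < k" if "adj x y" "x \<notin> set C" "y \<notin> set C" for x y
    using that by (meson not_le)
  obtain x y where edge_xy: "adj x y" "x \<notin> set C" "y \<notin> set C" "deg y < k"
    using low[OF uv u_off v_off] uv u_off v_off adj_sym by blast
  have only_edge: "{s, t} = {x, y}" if edge_st: "adj s t" "s \<notin> set C" "t \<notin> set C" for s t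
  proof -
    have "s = y \<or> t = y"
      using low[OF edge_st] low_unique[OF _ _ _ edge_xy(4)] adj_V[OF edge_st(1)]
        adj_V[OF edge_xy(1)]
      by blast
    then show ?thesis
      using off_cycle_nbr_unique[of y x] edge_xy adj_sym[OF edge_xy(1)] edge_st
        adj_sym[OF edge_st(1)]
      by blast
  qed
  have "pendant_off_edge V adj k C x y"
    using edge_xy only_edge by unfold_locales
  then have "covered_except k 2" by (rule pendant_off_edge.covered)
  then show ?thesis using extremalI(2) order length_C_eq by simp
qed

section \<open>Crossing-free sets of positions\<close>

text \<open>
  \<open>S\<close> and \<open>T\<close> stand for the positions along a longest path that are seen by its two ends.
\<close>

locale crossing_free_sets =
  fixes S T :: "nat set" and k M :: nat
  assumes S_less: "S \<subseteq> {..<M}" and T_less: "T \<subseteq> {..<M}" and disjoint: "S \<inter> T = {}"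
    and not_Suc: "i \<in> T \<Longrightarrow> Suc i \<notin> S"
    and card_S: "k \<le> card S" and card_T: "k \<le> card T" and k_pos: "1 \<le> k" and M_le: "M \<le> 2 * k + 1"
begin

lemma finite_sets: "finite S" "finite T"
  using S_less T_less finite_subset by blast+

lemma nearest_crossing:
  assumes "t \<in> T" "s \<in> S" "t < s"
  obtains t' s' where "t' \<in> T" "s' \<in> S" "t' < s'" "(S \<union> T) \<inter> {t'<..<s'} = {}"
proof -
  define s' where "s' = Min {x \<in> S. t < x}"
  define t' where "t' = Max {x \<in> T. x < s'}"
  have "s' \<in> {x \<in> S. t < x}" unfolding s'_def using finite_sets assms by (intro Min_in) auto
  then have s'_in: "s' \<in> S" "t < s'" by simp_all
  then have "t' \<in> {x \<in> T. x < s'}" unfolding t'_def using finite_sets assms by (intro Max_in) auto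
  then have t'_in: "t' \<in> T" "t' < s'" by simp_all
  have "t \<le> t'" unfolding t'_def using finite_sets assms s'_in by (intro Max_ge) auto
  have "x \<notin> S \<union> T" if x_between: "t' < x" "x < s'" for x
  proof
    assume "x \<in> S \<union> T"
    then show False
    proof
      assume "x \<in> S"
      then have "s' \<le> x"
        unfolding s'_def using finite_sets \<open>t \<le> t'\<close> x_between by (intro Min_le) auto
      then show False using x_between by simp
    next
      assume "x \<in> T"
      then have "x \<le> t'" unfolding t'_def using finite_sets x_between by (intro Max_ge) auto
      then show False using x_between by simp
    qed
  qed
  then have "(S \<union> T) \<inter> {t'<..<s'} = {}" by auto
  then show thesis using that s'_in t'_in by blast
qed

lemma crossing_at_distance_two:
  assumes "t \<in> T" "s \<in> S" "t < s"
  shows "M = 2 * k + 1 \<and> (\<exists>t\<in>T. t + 2 \<in> S)"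
proof -
  obtain t' s' where nearest: "t' \<in> T" "s' \<in> S" "t' < s'" "(S \<union> T) \<inter> {t'<..<s'} = {}"
    using nearest_crossing[OF assms] .
  have "2 * k \<le> card (S \<union> T)"
    using card_S card_T disjoint finite_sets by (simp add: card_Un_disjoint)
  also have "\<dots> \<le> card ({..<M} - {t'<..<s'})"
    using nearest(4) S_less T_less by (intro card_mono) blast+
  also have "\<dots> = M - (s' - t' - 1)" using nearest(2) S_less by (subst card_Diff_subset) auto
  finally have "2 * k \<le> M - (s' - t' - 1)" .
  moreover have "s' \<noteq> Suc t'" using not_Suc nearest(1,2) by blast
  ultimately have "s' = t' + 2" "M = 2 * k + 1" using nearest(3) M_le k_pos by linarith+
  then show ?thesis using nearest(1,2) by blast
qed

lemma separated_cases:
  assumes "\<And>s t. s \<in> S \<Longrightarrow> t \<in> T \<Longrightarrow> s < t"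
  shows "M = 2 * k \<and> S = {..<k} \<and> T = {k..<M} \<or>
    M = 2 * k + 1 \<and> (T = {k + 1..<M} \<and> S \<subseteq> {..<k + 1} \<or> S = {..<k} \<and> T \<subseteq> {k..<M})"
proof -
  have nonempty: "T \<noteq> {}" using card_T k_pos by auto
  define b where "b = Min T"
  have "b \<in> T" using nonempty finite_sets by (simp add: b_def)
  then have S_b: "S \<subseteq> {..<b}" using assms by auto
  have T_b: "T \<subseteq> {b..<M}" using T_less finite_sets nonempty by (auto simp: b_def)
  have "k \<le> b" "k \<le> M - b" using card_mono[OF _ S_b] card_mono[OF _ T_b] card_S card_T by simp_all
  then consider (tight) "M = 2 * k" "b = k" | (left) "M = 2 * k + 1" "b = k"
    | (right) "M = 2 * k + 1" "b = k + 1"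
    using M_le k_pos by linarith
  then show ?thesis
  proof cases
    case tight
    then show ?thesis using card_seteq[OF _ S_b] card_seteq[OF _ T_b] card_S card_T by simp
  next
    case left
    then show ?thesis using card_seteq[OF _ S_b] card_S T_b by simp
  next
    case right
    then show ?thesis using card_seteq[OF _ T_b] card_T S_b by simp
  qed
qed

lemma crossing_free_cases:
  obtains (even) "M = 2 * k" "S = {..<k}" "T = {k..<M}"
  | (tight_right) "M = 2 * k + 1" "T = {k + 1..<M}" "S \<subseteq> {..<k + 1}"
  | (tight_left) "M = 2 * k + 1" "S = {..<k}" "T \<subseteq> {k..<M}"
  | (crossing) t where "M = 2 * k + 1" "t \<in> T" "t + 2 \<in> S"
proof (cases "\<exists>t\<in>T. \<exists>s\<in>S. t < s")
  case True
  then show thesis using crossing_at_distance_two crossing by blast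
next
  case False
  then have "s < t" if "s \<in> S" "t \<in> T" for s t
    using that disjoint by (metis disjoint_iff linorder_neqE_nat)
  then show thesis using separated_cases even tight_right tight_left by blast
qed

end

section \<open>Longest paths and rotations\<close>

lemma nth_mem_take: "i < length xs \<Longrightarrow> i < n \<Longrightarrow> xs ! i \<in> set (take n xs)"
  by (metis length_take min_less_iff_conj nth_mem nth_take)

lemma mem_take_nth: "x \<in> set (take n xs) \<Longrightarrow> \<exists>i<length xs. i < n \<and> x = xs ! i"
  by (auto simp: in_set_conv_nth)

text \<open>
  Reversing the first \<open>i + 1\<close> vertices and skipping the next \<open>d - 1\<close> ones; for \<open>d = 1\<close> this is
  Posa's rotation.
\<close>

definition rotation :: "nat \<Rightarrow> nat \<Rightarrow> 'a list \<Rightarrow> 'a list" where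
  "rotation i d p = rev (take (Suc i) p) @ drop (i + d) p"

lemma length_rotation: "i + d < length p \<Longrightarrow> 0 < d \<Longrightarrow> length (rotation i d p) = length p + 1 - d"
  by (simp add: rotation_def)

lemma hd_rotation: "i < length p \<Longrightarrow> hd (rotation i d p) = p ! i"
  by (simp add: rotation_def take_Suc_conv_app_nth)

lemma last_rotation: "i + d < length p \<Longrightarrow> last (rotation i d p) = last p"
  by (simp add: rotation_def)

lemma nth_rotation_1: "Suc s \<le> i \<Longrightarrow> i < length p \<Longrightarrow> rotation s 1 p ! i = p ! i"
  by (simp add: rotation_def nth_append min_absorb2)

lemma set_take_rotation_1:
  assumes "Suc s \<le> j" "Suc s < length p"
  shows "set (take j (rotation s 1 p)) = set (take j p)"
proof -
  have "take j p = take (Suc s) p @ take (j - Suc s) (drop (Suc s) p)"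
    using assms(1) by (metis take_add le_add_diff_inverse)
  moreover have "take j (rotation s 1 p) = rev (take (Suc s) p) @ take (j - Suc s) (drop (Suc s) p)"
    using assms by (simp add: rotation_def min_absorb2)
  ultimately show ?thesis by simp
qed

lemma skipped_not_in_rotation:
  assumes "distinct p" "i < j" "j < i + d" "i + d < length p"
  shows "p ! j \<notin> set (rotation i d p)"
  using assms by (auto simp: rotation_def in_set_conv_nth nth_eq_iff_index_eq)

context simple_graph begin

definition head_chords :: "'a list \<Rightarrow> nat set" where
  "head_chords p = {i. Suc i < length p \<and> adj (hd p) (p ! Suc i)}"

definition tail_chords :: "'a list \<Rightarrow> nat set" where
  "tail_chords p = {i. Suc i < length p \<and> adj (last p) (p ! i)}"

lemma head_chords_rev_iff:
  assumes "i + j + 2 = length p"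
  shows "j \<in> head_chords (rev p) \<longleftrightarrow> i \<in> tail_chords p"
proof -
  have "rev p ! Suc j = p ! i" using assms by (simp add: rev_nth flip: assms)
  moreover have "p \<noteq> []" using assms by auto
  ultimately show ?thesis using assms by (auto simp: head_chords_def tail_chords_def hd_rev)
qed

lemma tail_chords_rev_iff:
  "i + j + 2 = length p \<Longrightarrow> j \<in> tail_chords (rev p) \<longleftrightarrow> i \<in> head_chords p"
  using head_chords_rev_iff[of j i "rev p"] by (simp add: add.commute)

lemma zero_head_chord: "is_path p \<Longrightarrow> 2 \<le> length p \<Longrightarrow> 0 \<in> head_chords p"
  using is_path_nth_adj[of p 0] is_pathD(1)[of p] by (auto simp: head_chords_def hd_conv_nth)

lemma is_path_rotation:
  assumes "is_path p" "0 < d" "i + d < length p" "adj (hd p) (p ! (i + d))"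
  shows "is_path (rotation i d p)"
  unfolding rotation_def
proof (rule is_path_appendI)
  show "is_path (rev (take (Suc i) p))" "is_path (drop (i + d) p)"
    using assms is_path_take is_path_drop by simp_all
  show "set (rev (take (Suc i) p)) \<inter> set (drop (i + d) p) = {}"
    using is_pathD(2)[OF assms(1)] assms(2) by (simp add: set_take_disj_set_drop_if_distinct)
  have "p \<noteq> []" using assms(1) by auto
  then show "adj (last (rev (take (Suc i) p))) (hd (drop (i + d) p))"
    using assms(3,4) by (simp add: last_rev hd_drop_conv_nth)
qed

lemma is_cycle_rotation:
  assumes "is_path p" "0 < d" "i + d < length p" "adj (hd p) (p ! (i + d))" "adj (last p) (p ! i)"
    and "d + 2 \<le> length p"
  shows "is_cycle (rotation i d p)"
  using is_path_rotation[OF assms(1-4)] assms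
  by (simp add: is_cycle_def length_rotation hd_rotation last_rotation)

end

locale longest_path_graph = nearly_min_degree V adj k for V :: "'a set" and adj k +
  fixes m :: nat
  assumes bounded: "paths_bounded m" and order: "m < card V" and m_ge_3: "3 \<le> m"
    and no_cycle: "\<not> has_cycle (m - 1)"
begin

definition longest :: "'a list \<Rightarrow> bool" where
  "longest p \<longleftrightarrow> is_path p \<and> length p = m"

lemma longestD:
  assumes "longest p"
  shows "is_path p" "length p = m" "p \<noteq> []" "distinct p" "set p \<subseteq> V"
  using assms is_pathD by (auto simp: longest_def)

lemma longest_rev [simp]: "longest (rev p) \<longleftrightarrow> longest p"
  by (simp add: longest_def)

lemma nbrs_hd:
  assumes longest_p: "longest p"
  shows "nbrs (hd p) \<subseteq> set p"
proof (rule subsetI, rule ccontr)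
  fix y assume "y \<in> nbrs (hd p)" "y \<notin> set p"
  then have "is_path (y # p)"
    using longestD[OF longest_p] is_path_Cons_iff[of p y] adj_commute[of y] by simp
  from paths_boundedD[OF bounded this] show False using longestD(2)[OF longest_p] by simp
qed

lemma image_head_chords: "longest p \<Longrightarrow> (\<lambda>i. p ! Suc i) ` head_chords p = nbrs (hd p)"
proof
  assume longest_p: "longest p"
  show "nbrs (hd p) \<subseteq> (\<lambda>i. p ! Suc i) ` head_chords p"
  proof
    fix y assume y_in: "y \<in> nbrs (hd p)"
    then obtain i where y_eq: "i < length p" "y = p ! i"
      using nbrs_hd[OF longest_p] in_set_conv_nth[of y p] by auto
    have "i \<noteq> 0"
    proof
      assume "i = 0"
      then have "y = hd p" using y_eq hd_conv_nth[OF longestD(3)[OF longest_p]] by simp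
      then show False using y_in adj_irrefl by simp
    qed
    then obtain j where "i = Suc j" by (cases i) auto
    then show "y \<in> (\<lambda>i. p ! Suc i) ` head_chords p" using y_eq y_in by (auto simp: head_chords_def)
  qed
qed (auto simp: head_chords_def)

lemma card_head_chords:
  assumes longest_p: "longest p"
  shows "card (head_chords p) = deg (hd p)"
proof -
  have "inj_on (\<lambda>i. p ! Suc i) (head_chords p)"
    using longestD(4)[OF longest_p] by (auto simp: inj_on_def head_chords_def nth_eq_iff_index_eq)
  then show ?thesis using card_image image_head_chords[OF longest_p] by fastforce
qed

lemma card_tail_chords:
  assumes longest_p: "longest p"
  shows "card (tail_chords p) = deg (last p)"
proof -
  have "bij_betw (\<lambda>i. m - 2 - i) (tail_chords p) (head_chords (rev p))"
  proof (rule bij_betwI[where g = "\<lambda>i. m - 2 - i"])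
    have bound: "i \<le> m - 2" if "i \<in> tail_chords p \<or> i \<in> head_chords (rev p)" for i
      using that longestD(2)[OF longest_p] by (auto simp: tail_chords_def head_chords_def)
    show "(\<lambda>i. m - 2 - i) \<in> tail_chords p \<rightarrow> head_chords (rev p)"
    proof
      fix i assume "i \<in> tail_chords p"
      then show "m - 2 - i \<in> head_chords (rev p)"
        using bound[of i] head_chords_rev_iff[of i "m - 2 - i" p] longestD(2)[OF longest_p] m_ge_3
        by simp
    qed
    show "(\<lambda>i. m - 2 - i) \<in> head_chords (rev p) \<rightarrow> tail_chords p"
    proof
      fix i assume "i \<in> head_chords (rev p)"
      then show "m - 2 - i \<in> tail_chords p"
        using bound[of i] head_chords_rev_iff[of "m - 2 - i" i p] longestD(2)[OF longest_p] m_ge_3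
        by simp
    qed
    show "m - 2 - (m - 2 - i) = i" if "i \<in> tail_chords p" for i
      using bound that by (intro diff_diff_cancel) blast
    show "m - 2 - (m - 2 - i) = i" if "i \<in> head_chords (rev p)" for i
      using bound that by (intro diff_diff_cancel) blast
  qed
  then have "card (tail_chords p) = card (head_chords (rev p))" by (rule bij_betw_same_card)
  then show ?thesis
    using card_head_chords[of "rev p"] longest_p longestD(3)[OF longest_p] by (simp add: hd_rev)
qed

lemma head_tail_chords_disjoint:
  assumes longest_p: "longest p"
  shows "head_chords p \<inter> tail_chords p = {}"
proof -
  have False if "i \<in> head_chords p" "i \<in> tail_chords p" for i
  proof -
    have "is_cycle (rotation i 1 p)" "length (rotation i 1 p) = m"
      using that longestD[OF longest_p] m_ge_3
      by (auto simp: head_chords_def tail_chords_def length_rotation intro!: is_cycle_rotation)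
    then show False
      using no_cycle_of_bounded_length[OF connected bounded order] has_cycleI by blast
  qed
  then show ?thesis by blast
qed

lemma Suc_not_head_chord:
  assumes longest_p: "longest p" and tail_i: "i \<in> tail_chords p"
  shows "Suc i \<notin> head_chords p"
proof
  assume head_Suc: "Suc i \<in> head_chords p"
  show False
  proof (cases "m = 3")
    case True
    then have "i = 0" "last p = p ! 2"
      using head_Suc longestD[OF longest_p] by (auto simp: head_chords_def last_conv_nth)
    then have "0 \<in> tail_chords p" "0 \<in> head_chords p"
      using tail_i zero_head_chord[of p] longestD[OF longest_p] m_ge_3 by auto
    then show False using head_tail_chords_disjoint[OF longest_p] by blast
  next
    case False
    then have "is_cycle (rotation i 2 p)" "length (rotation i 2 p) = m - 1"
      using head_Suc tail_i longestD[OF longest_p] m_ge_3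
      by (auto simp: head_chords_def tail_chords_def length_rotation intro!: is_cycle_rotation)
    then show False using no_cycle has_cycleI by blast
  qed
qed

lemma longest_rotation:
  assumes longest_p: "longest p" and head_s: "s \<in> head_chords p"
  shows "longest (rotation s 1 p)" "hd (rotation s 1 p) = p ! s" "last (rotation s 1 p) = last p"
  using longestD[OF longest_p] head_s is_path_rotation[of p 1 s]
  by (auto simp: longest_def head_chords_def length_rotation hd_rotation last_rotation)

lemma nbrs_subset_take_if_tail_chords:
  assumes longest_p: "longest p" and head_s: "s \<in> head_chords p" "Suc s \<le> j"
    and tail: "\<And>i. j \<le> i \<Longrightarrow> Suc i < m \<Longrightarrow> i \<in> tail_chords p \<or> j < i \<and> i - 1 \<in> tail_chords p"
  shows "nbrs (p ! s) \<subseteq> set (take (Suc j) p)"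
proof
  fix y assume edge_y: "y \<in> nbrs (p ! s)"
  let ?q = "rotation s 1 p"
  note longest_q = longest_rotation[OF longest_p head_s(1)]
  have s_less: "Suc s < length p" using head_s(1) by (simp add: head_chords_def)
  obtain i where y_eq: "i < m" "y = ?q ! i"
    using nbrs_hd[OF longest_q(1)] edge_y longest_q(2) longestD(2)[OF longest_q(1)]
    by (auto simp: in_set_conv_nth subset_iff)
  have tail_q: "l \<in> tail_chords ?q" if "l \<in> tail_chords p" "j \<le> l" for l
    using that nth_rotation_1[of s l p] head_s(2) longest_q longestD(2)[OF longest_p]
      longestD(2)[OF longest_q(1)]
    by (simp add: tail_chords_def)
  have "i \<le> j"
  proof (rule ccontr)
    assume "\<not> i \<le> j"
    then obtain l where i_eq: "i = Suc l" "j \<le> l" by (cases i) auto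
    then have "l \<in> head_chords ?q"
      using y_eq edge_y longest_q longestD(2)[OF longest_q(1)] by (simp add: head_chords_def)
    then have "l \<notin> tail_chords ?q" "j < l \<Longrightarrow> l - 1 \<notin> tail_chords ?q"
      using head_tail_chords_disjoint[OF longest_q(1)]
        Suc_not_head_chord[OF longest_q(1), of "l - 1"]
      by auto
    then show False using tail[of l] tail_q[of l] tail_q[of "l - 1"] y_eq i_eq by auto
  qed
  then have "y \<in> set (take (Suc j) ?q)"
    using nth_mem_take[of i ?q "Suc j"] y_eq longestD(2)[OF longest_q(1)] by simp
  then show "y \<in> set (take (Suc j) p)"
    using set_take_rotation_1[OF _ s_less, of "Suc j"] head_s(2) by simp
qed

lemma separates_prefix:
  assumes longest_p: "longest p" and j_less: "j < m"
    and nbrs: "\<And>s. s < j \<Longrightarrow> nbrs (p ! s) \<subseteq> set (take (Suc j) p)"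
  shows "separates (p ! j) (set (take j p))"
proof (rule separatesI)
  fix x y assume edge_xy: "x \<in> set (take j p)" "adj x y" "y \<noteq> p ! j"
  then obtain s where "s < j" "x = p ! s" using mem_take_nth[of x j p] by blast
  then have "y \<in> set (take (Suc j) p)" using nbrs[of s] edge_xy(2) by auto
  then show "y \<in> set (take j p)"
    using j_less longestD(2)[OF longest_p] edge_xy(3) by (simp add: take_Suc_conv_app_nth)
qed

lemma prefix_bound:
  assumes longest_p: "longest p" and j_bounds: "0 < j" "j < m"
    and path_q: "is_path (p ! j # q)" "set q \<inter> set (take j p) = {}"
  shows "j + Suc (length q) \<le> m"
proof -
  have "is_path (take j p @ p ! j # q)"
  proof (rule is_path_appendI)
    show "is_path (take j p)" using longestD(1)[OF longest_p] j_bounds is_path_take by blast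
    have "p ! j \<notin> set (take j p)"
      using mem_take_nth[of "p ! j" j p] longestD[OF longest_p] j_bounds
      by (auto simp: nth_eq_iff_index_eq)
    then show "set (take j p) \<inter> set (p ! j # q) = {}" using path_q(2) by auto
    obtain i where j_eq: "j = Suc i" using j_bounds by (cases j) auto
    then have "last (take j p) = p ! i"
      using j_bounds longestD[OF longest_p] by (simp add: take_Suc_conv_app_nth)
    then show "adj (last (take j p)) (hd (p ! j # q))"
      using is_path_nth_adj[of p i] j_eq j_bounds longestD[OF longest_p] by simp
  qed (rule path_q(1))
  from paths_boundedD[OF bounded this] show ?thesis using j_bounds longestD[OF longest_p] by simp
qed

lemma small_components_if_balanced:
  assumes longest_p: "longest p" and m_eq: "m = 2 * k + 1"
    and head: "{..<k} \<subseteq> head_chords p" and tail: "{k..<2 * k} \<subseteq> tail_chords p"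
  shows "small_components k"
proof (rule small_componentsI)
  have "nbrs (p ! s) \<subseteq> set (take (Suc k) p)" if "s < k" for s
    using that head tail m_eq by (intro nbrs_subset_take_if_tail_chords[OF longest_p]) fastforce+
  then show "separates (p ! k) (set (take k p))" using separates_prefix[OF longest_p] m_eq by simp
  show "p ! k \<in> V" "set (take k p) \<subseteq> V"
    using longestD[OF longest_p] m_eq nth_mem set_take_subset by fastforce+
  show "card (set (take k p)) \<le> k" using card_length[of "take k p"] by simp
  show "length q \<le> k" if "is_path (p ! k # q)" "set q \<inter> set (take k p) = {}" for q
    using prefix_bound[OF longest_p _ _ that] m_eq k_pos by simp
qed

end

section \<open>Longest paths with a cut vertex next to the middle\<close>

locale unbalanced_path = longest_path_graph V adj k m for V :: "'a set" and adj k m +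
  fixes p :: "'a list"
  assumes longest_p: "longest p" and m_eq: "m = 2 * k + 2" and reg_hd: "k \<le> deg (hd p)"
    and hd_adj_c: "k \<in> head_chords p" and tail: "{k + 1..2 * k} \<subseteq> tail_chords p"
begin

abbreviation c :: 'a where "c \<equiv> p ! Suc k"
abbreviation L :: "'a set" where "L \<equiv> set (take (Suc k) p)"
abbreviation R :: "'a set" where "R \<equiv> set (drop (k + 2) p)"

lemmas path_p = longestD(1)[OF longest_p] and length_p = longestD(2)[OF longest_p]

lemma hd_p: "hd p = p ! 0"
  by (rule hd_conv_nth[OF longestD(3)[OF longest_p]])

lemma nth_p_eq_iff: "i < m \<Longrightarrow> j < m \<Longrightarrow> p ! i = p ! j \<longleftrightarrow> i = j"
  using is_path_nth_eq_iff[OF path_p] length_p by simp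

lemma p_split: "p = take (Suc k) p @ c # drop (k + 2) p"
  using length_p m_eq id_take_nth_drop[of "Suc k" p] by simp

lemma set_p: "set p = insert c (L \<union> R)"
  using arg_cong[OF p_split, of set] by auto

lemma parts_disjoint: "c \<notin> L" "c \<notin> R" "L \<inter> R = {}"
  using longestD(4)[OF longest_p] p_split
  by (metis distinct.simps(2) distinct_append disjoint_iff list.set_intros)+

lemma mem_L_iff: "x \<in> L \<longleftrightarrow> (\<exists>i\<le>k. x = p ! i)"
  using mem_take_nth[of x "Suc k" p] nth_mem_take[of _ p "Suc k"] length_p m_eq
  by (auto simp: less_Suc_eq_le)

lemma card_L: "card L = Suc k"
  using is_path_take[OF path_p, of "Suc k"] length_p m_eq by (simp add: card_set_path)

lemma set_take_Suc_Suc: "set (take (Suc (Suc k)) p) = insert c L"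
  using length_p m_eq take_Suc_conv_app_nth[of "Suc k" p] by simp

lemma adj_c_ends: "adj c (p ! 0)" "adj c (p ! k)"
  using hd_adj_c hd_p is_path_nth_adj[OF path_p, of k] length_p m_eq adj_commute
  by (auto simp: head_chords_def)

lemma head_chords_le: "head_chords p \<subseteq> {..k}"
proof
  fix i assume head_i: "i \<in> head_chords p"
  then have "i \<notin> {k + 1..2 * k}" using tail head_tail_chords_disjoint[OF longest_p] by blast
  moreover have "i \<le> 2 * k" using head_i length_p m_eq by (simp add: head_chords_def)
  ultimately show "i \<in> {..k}" by simp
qed

lemma missing_head_chord_unique:
  assumes "i \<le> k" "j \<le> k" "i \<notin> head_chords p" "j \<notin> head_chords p"
  shows "i = j"
proof (rule ccontr)
  assume "i \<noteq> j"
  have "head_chords p \<subseteq> {..k} - {i, j}" using head_chords_le assms by blast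
  then have "card (head_chords p) \<le> card ({..k} - {i, j})" by (intro card_mono) auto
  also have "\<dots> = k - 1" using assms \<open>i \<noteq> j\<close> by (subst card_Diff_subset) auto
  finally show False using card_head_chords[OF longest_p] reg_hd k_pos by simp
qed

lemma nbrs_if_head_chord:
  assumes "s \<in> head_chords p"
  shows "nbrs (p ! s) \<subseteq> insert c L"
proof -
  have "nbrs (p ! s) \<subseteq> set (take (Suc (Suc k)) p)"
  proof (rule nbrs_subset_take_if_tail_chords[OF longest_p assms])
    show "Suc s \<le> Suc k" using assms head_chords_le by auto
    fix i assume "Suc k \<le> i" "Suc i < m"
    then show "i \<in> tail_chords p \<or> Suc k < i \<and> i - 1 \<in> tail_chords p"
      using subsetD[OF tail] m_eq by auto
  qed
  then show ?thesis by (simp only: set_take_Suc_Suc)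
qed

lemma separates_R: "separates c R"
proof -
  have longest_rev_p: "longest (rev p)" using longest_p by simp
  have rev_iff: "i \<in> tail_chords (rev p) \<longleftrightarrow> 2 * k - i \<in> head_chords p" if "i \<le> 2 * k" for i
    using tail_chords_rev_iff[of "2 * k - i" i p] that length_p m_eq by simp
  have "nbrs (rev p ! s) \<subseteq> set (take (Suc k) (rev p))" if s_less: "s < k" for s
  proof (rule nbrs_subset_take_if_tail_chords[OF longest_rev_p])
    have "2 * k - s \<in> tail_chords p" using tail s_less by auto
    then show "s \<in> head_chords (rev p)"
      using head_chords_rev_iff[of "2 * k - s" s p] s_less length_p m_eq by simp
    fix i assume i_bounds: "k \<le> i" "Suc i < m"
    show "i \<in> tail_chords (rev p) \<or> k < i \<and> i - 1 \<in> tail_chords (rev p)"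
    proof (rule disjCI)
      assume "\<not> (k < i \<and> i - 1 \<in> tail_chords (rev p))"
      then have "i = k \<or> 2 * k - (i - 1) \<notin> head_chords p"
        using rev_iff[of "i - 1"] i_bounds m_eq by auto
      moreover have "2 * k - i \<noteq> 2 * k - (i - 1)" if "i \<noteq> k" using that i_bounds m_eq by linarith
      moreover have "2 * k - i \<le> k" "i \<noteq> k \<Longrightarrow> 2 * k - (i - 1) \<le> k" using i_bounds by linarith+
      ultimately have "2 * k - i \<in> head_chords p"
        using missing_head_chord_unique[of "2 * k - i" "2 * k - (i - 1)"] hd_adj_c
        by (cases "i = k") auto
      then show "i \<in> tail_chords (rev p)" using rev_iff[of i] i_bounds m_eq by simp
    qed
  qed (use s_less in simp)
  from separates_prefix[OF longest_rev_p _ this] have "separates (rev p ! k) (set (take k (rev p)))"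
    using m_eq by simp
  moreover have "rev p ! k = c" "set (take k (rev p)) = R"
    using length_p m_eq by (simp_all add: rev_nth take_rev)
  ultimately show ?thesis by simp
qed

lemma head_bound:
  assumes path_q: "is_path q" "adj c (hd q)" "set q \<inter> insert c R = {}"
  shows "length q \<le> Suc k"
proof -
  have "is_path (take (Suc k) p @ c # drop (k + 2) p)" using path_p p_split by simp
  then have "is_path (c # drop (k + 2) p)"
    using is_path_append_iff[of "take (Suc k) p" "c # drop (k + 2) p"] longestD(3)[OF longest_p]
    by simp
  then have "is_path (rev (c # drop (k + 2) p))" using is_path_rev by blast
  then have "is_path (rev (c # drop (k + 2) p) @ q)"
    by (rule is_path_appendI[OF _ path_q(1)]) (use path_q(2,3) in auto)
  from paths_boundedD[OF bounded this] show ?thesis using length_p m_eq by simp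
qed

lemma small_components_if_separates_L:
  assumes "separates c L"
  shows "small_components_but_one k"
proof (rule small_components_but_oneI[OF _ _ _ assms])
  show "c \<in> V" "L \<subseteq> V - {c}" using longestD(5)[OF longest_p] set_p parts_disjoint by auto
  show "length q \<le> k" if "is_path (c # q)" "set q \<inter> L = {}" for q
    using prefix_bound[OF longest_p _ _ that] m_eq by simp
qed (simp add: card_L)

end

text \<open>
  Otherwise some \<open>p ! j\<close> with \<open>0 < j < k\<close> has a neighbour \<open>q\<close> off the path, and \<open>p ! Suc j\<close> is the only
  vertex among \<open>p ! 1\<close>, ..., \<open>p ! Suc k\<close> that is not adjacent to the head of \<open>p\<close>.
\<close>

locale escaping_path = unbalanced_path V adj k m p for V :: "'a set" and adj k m p +
  fixes j :: nat and q :: 'a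
  assumes j_le: "j \<le> k" and escape: "adj (p ! j) q" and q_outside: "q \<notin> insert c L"
begin

lemma not_head_chord_j: "j \<notin> head_chords p"
  using nbrs_subsetD[OF nbrs_if_head_chord escape] q_outside by blast

lemma j_bounds: "0 < j" "j < k"
proof -
  have "j \<noteq> 0" using not_head_chord_j zero_head_chord[OF path_p] length_p m_eq by (cases j) auto
  moreover have "j \<noteq> k" using not_head_chord_j hd_adj_c by blast
  ultimately show "0 < j" "j < k" using j_le by auto
qed

lemma head_chord_if_neq: "i \<le> k \<Longrightarrow> i \<noteq> j \<Longrightarrow> i \<in> head_chords p"
  using missing_head_chord_unique[of i j] not_head_chord_j j_le by blast

lemma nbrs_if_neq: "i \<le> k \<Longrightarrow> i \<noteq> j \<Longrightarrow> nbrs (p ! i) \<subseteq> insert c L"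
  using nbrs_if_head_chord head_chord_if_neq by blast

lemma adj_hd: "i \<le> k \<Longrightarrow> i \<noteq> j \<Longrightarrow> adj (p ! 0) (p ! Suc i)"
  using head_chord_if_neq[of i] hd_p by (simp add: head_chords_def)

lemma not_adj_hd: "\<not> adj (p ! 0) (p ! Suc j)"
  using not_head_chord_j j_bounds length_p m_eq hd_p by (simp add: head_chords_def)

lemma nth_in_L: "i \<le> k \<Longrightarrow> p ! i \<in> L"
  using mem_L_iff by blast

lemma escape_vertex_unique: "x \<in> L \<Longrightarrow> adj x y \<Longrightarrow> y \<notin> insert c L \<Longrightarrow> x = p ! j"
  using nbrs_if_neq nbrs_subsetD mem_L_iff by metis

lemma q_off_path: "q \<notin> set p"
proof
  assume "q \<in> set p"
  then have "q \<in> R" using q_outside set_p by auto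
  then have "p ! j \<in> R \<or> p ! j = c" using separatesD[OF separates_R _ adj_sym[OF escape]] by blast
  then show False using parts_disjoint nth_in_L[OF j_le] by auto
qed

lemma no_spanning_path_of_L:
  assumes "is_path Q" "set Q = L" "adj c (hd Q)" "last Q = p ! j"
  shows False
proof -
  have nonempty: "Q \<noteq> []" using assms(1) by auto
  have "length (Q @ [q]) \<le> Suc k"
  proof (rule head_bound)
    show "is_path (Q @ [q])"
      using assms nonempty escape q_off_path set_p by (auto simp: is_path_snoc_iff)
    show "set (Q @ [q]) \<inter> insert c R = {}" using assms(2) parts_disjoint q_off_path set_p by auto
  qed (use assms(3) nonempty in simp)
  then show False using card_set_path[OF assms(1)] assms(2) card_L by simp
qed

lemma adj_next_if_regular:
  assumes regular: "k \<le> deg (p ! Suc j)" and y_in: "y \<in> insert c L" "y \<noteq> p ! 0" "y \<noteq> p ! Suc j"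
  shows "adj (p ! Suc j) y"
proof -
  let ?N = "insert c L - {p ! 0, p ! Suc j}"
  have "nbrs (p ! Suc j) \<subseteq> ?N"
    using nbrs_if_neq[of "Suc j"] j_bounds not_adj_hd adj_sym adj_irrefl by auto
  moreover have "card ?N = k"
  proof -
    have "{p ! 0, p ! Suc j} \<subseteq> insert c L" "p ! 0 \<noteq> p ! Suc j"
      using nth_in_L j_bounds nth_p_eq_iff[of 0 "Suc j"] m_eq by auto
    then show ?thesis using parts_disjoint(1) card_L by (simp add: card_Diff_subset)
  qed
  ultimately have "nbrs (p ! Suc j) = ?N" using regular by (intro card_seteq) auto
  then show ?thesis using y_in mem_nbrs by blast
qed

lemma next_not_regular_if_inner:
  assumes "Suc j < k"
  shows "deg (p ! Suc j) < k"
proof (rule ccontr)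
  assume "\<not> deg (p ! Suc j) < k"
  then have regular: "k \<le> deg (p ! Suc j)" by simp
  let ?A = "take (Suc j) p" and ?B = "drop (Suc j) (take (Suc k) p)"
  have split: "take (Suc k) p = ?A @ ?B"
    using append_take_drop_id[of "Suc j" "take (Suc k) p"] j_bounds by (simp add: min_absorb1)
  have nonempty: "?A \<noteq> []" "?B \<noteq> []" using j_bounds length_p m_eq by auto
  have ends: "hd ?A = p ! 0" "last ?A = p ! j" "hd ?B = p ! Suc j" "last ?B = p ! k"
    using hd_p j_bounds length_p m_eq nonempty
    by (simp_all add: hd_drop_conv_nth last_conv_nth hd_take del: drop_take)
  have "is_path ?A" "is_path ?B" "set ?A \<inter> set ?B = {}"
    using is_path_take[OF path_p, of "Suc k"] is_path_append_iff[OF nonempty]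
    by (simp_all flip: split)
  moreover have "adj (p ! k) (p ! 0)" using adj_hd[of "k - 1"] assms adj_commute by auto
  ultimately have "is_path (?B @ ?A)" using ends by (intro is_path_appendI) auto
  moreover have "set (?B @ ?A) = L" using arg_cong[OF split, of set] by auto
  moreover have "adj (p ! Suc j) c"
    using adj_next_if_regular[OF regular] nth_p_eq_iff[of "Suc k"] j_bounds m_eq by simp
  then have "adj c (hd (?B @ ?A))" using ends nonempty adj_sym by simp
  moreover have "last (?B @ ?A) = p ! j" using ends nonempty by simp
  ultimately show False by (rule no_spanning_path_of_L)
qed

lemma next_not_regular_if_last:
  assumes "Suc j = k" "3 \<le> k"
  shows "deg (p ! Suc j) < k"
proof (rule ccontr)
  assume "\<not> deg (p ! Suc j) < k"
  then have regular: "k \<le> deg (p ! Suc j)" by simp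
  let ?A = "take j p"
  have split: "take (Suc k) p = ?A @ [p ! j, p ! k]"
    using assms(1) length_p m_eq by (simp add: take_Suc_conv_app_nth flip: assms(1))
  have nonempty: "?A \<noteq> []" using j_bounds length_p m_eq by auto
  have "distinct (?A @ [p ! j, p ! k])" using split longestD(4)[OF longest_p] distinct_take by metis
  moreover have "last ?A = p ! (j - 1)"
    using j_bounds length_p m_eq take_Suc_conv_app_nth[of "j - 1" p] by simp
  moreover have "adj (p ! Suc j) (p ! (j - 1))"
    using assms j_bounds nth_in_L[of "j - 1"] nth_p_eq_iff[of "j - 1"] m_eq
    by (intro adj_next_if_regular[OF regular]) auto
  moreover have "adj (p ! k) (p ! j)"
    using is_path_nth_adj[OF path_p, of j] assms(1) length_p m_eq adj_commute by auto
  ultimately have "is_path (?A @ [p ! k, p ! j])"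
    using is_path_take[OF path_p] j_bounds assms(1) adj_sym by (intro is_path_appendI) auto
  moreover have "set (?A @ [p ! k, p ! j]) = L" using arg_cong[OF split, of set] by auto
  moreover have "adj c (hd (?A @ [p ! k, p ! j]))"
    using adj_c_ends(1) hd_p nonempty j_bounds by simp
  moreover have "last (?A @ [p ! k, p ! j]) = p ! j" by simp
  ultimately show False by (rule no_spanning_path_of_L)
qed

lemma escaping_tail_bound:
  assumes path_e: "is_path (p ! j # e)" "e \<noteq> []" "set e \<inter> set p = {}"
  shows "length e \<le> j" "length e \<le> k - j"
proof -
  have e_path: "is_path e" "adj (p ! j) (hd e)"
    using path_e(1,2) by (simp_all add: is_path_Cons_iff)
  have extend: "length (A @ e) \<le> Suc k"
    if path_A: "is_path A" "A \<noteq> []" "set A \<subseteq> L" "adj c (hd A)" "last A = p ! j" for A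
  proof (rule head_bound)
    show "is_path (A @ e)"
      using path_A e_path path_e(3) set_p by (intro is_path_appendI) auto
    show "set (A @ e) \<inter> insert c R = {}" using path_A(3) path_e(3) parts_disjoint set_p by auto
  qed (use path_A in simp)
  have "length (rev (drop j (take (Suc k) p)) @ e) \<le> Suc k"
  proof (rule extend)
    have nonempty: "drop j (take (Suc k) p) \<noteq> []" using j_bounds length_p m_eq by auto
    show "is_path (rev (drop j (take (Suc k) p)))"
      using is_path_drop[OF is_path_take[OF path_p]] j_bounds length_p m_eq by simp
    show "set (rev (drop j (take (Suc k) p))) \<subseteq> L" using set_drop_subset by fastforce
    have "last (drop j (take (Suc k) p)) = p ! k" "hd (drop j (take (Suc k) p)) = p ! j"
      using nonempty j_bounds length_p m_eq
      by (simp_all add: last_conv_nth hd_drop_conv_nth del: drop_take)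
    then show "adj c (hd (rev (drop j (take (Suc k) p))))"
      "last (rev (drop j (take (Suc k) p))) = p ! j"
      using nonempty adj_c_ends(2) by (simp_all add: hd_rev last_rev)
  qed (use j_bounds length_p m_eq in auto)
  then show "length e \<le> j" using j_bounds length_p m_eq by simp
  have "length (take (Suc j) p @ e) \<le> Suc k"
  proof (rule extend)
    show "set (take (Suc j) p) \<subseteq> L" using j_bounds by (intro set_take_subset_set_take) simp
    show "adj c (hd (take (Suc j) p))" using adj_c_ends(1) hd_p by simp
    show "last (take (Suc j) p) = p ! j"
      using j_bounds length_p m_eq by (simp add: take_Suc_conv_app_nth)
  qed (use is_path_take[OF path_p] longestD(3)[OF longest_p] in auto)
  then show "length e \<le> k - j" using j_bounds length_p m_eq by simp
qed

lemma ex_vertex_of_small_degree: "\<exists>z\<in>V - set p. deg z \<le> k div 2 + 1"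
proof -
  let ?tail = "\<lambda>e. is_path (p ! j # e) \<and> e \<noteq> [] \<and> set e \<inter> set p = {}"
  have "?tail [q]" using escape q_off_path by simp
  then obtain e where tail_e: "?tail e" and maximal: "\<And>e'. ?tail e' \<Longrightarrow> length e' \<le> length e"
    using ex_has_greatest_nat[of ?tail "[q]" length "Suc j"] escaping_tail_bound(1)
    by (auto simp: less_Suc_eq_le)
  define z where "z = last e"
  have "z \<in> set e" unfolding z_def using tail_e by (intro last_in_set) simp
  then have z_in: "z \<in> set e" "z \<in> V - set p" using tail_e is_pathD(3)[of "p ! j # e"] by auto
  have "nbrs z \<subseteq> insert c (insert (p ! j) (set e - {z}))"
  proof
    fix y assume "y \<in> nbrs z"
    then have edge_y: "adj z y" by simp
    show "y \<in> insert c (insert (p ! j) (set e - {z}))"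
    proof (cases "y \<in> set p")
      case True
      have "y \<notin> R" using separatesD[OF separates_R _ adj_sym[OF edge_y]] z_in(2) set_p by blast
      moreover have "y = p ! j" if "y \<in> L"
        using escape_vertex_unique[OF that adj_sym[OF edge_y]] z_in(2) set_p by blast
      ultimately show ?thesis using True set_p by blast
    next
      case False
      have "\<not> ?tail (e @ [y])" using maximal[of "e @ [y]"] by auto
      then have "y \<in> set (p ! j # e)"
        using tail_e edge_y False is_path_snoc_iff[of "p ! j # e" y] by (auto simp: z_def)
      then show ?thesis using adj_neq[OF edge_y] by auto
    qed
  qed
  then have "deg z \<le> card (insert c (insert (p ! j) (set e - {z})))" by (intro card_mono) auto
  also have "\<dots> \<le> Suc (Suc (card (set e - {z})))" by (simp add: card_insert_if)
  also have "card (set e - {z}) = length e - 1"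
    using z_in(1) tail_e is_pathD(2)[of "p ! j # e"] by (simp add: distinct_card)
  finally have "deg z \<le> length e + 1" using tail_e by (cases e) auto
  moreover have "length e \<le> j" "length e \<le> k - j" using escaping_tail_bound tail_e by blast+
  ultimately have "deg z \<le> k div 2 + 1" by linarith
  then show ?thesis using z_in(2) by blast
qed

lemma k_eq_2: "k = 2"
proof (rule ccontr)
  assume "k \<noteq> 2"
  then have k_ge_3: "3 \<le> k" using j_bounds by linarith
  obtain z where low_z: "z \<in> V - set p" "deg z < k"
    using ex_vertex_of_small_degree k_ge_3 by (fastforce dest: le_less_trans)
  have "p ! Suc j \<in> V" "p ! Suc j \<noteq> z"
    using is_path_nth_in_V[OF path_p] nth_mem[of "Suc j" p] low_z(1) j_bounds length_p m_eq by auto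
  then have "k \<le> deg (p ! Suc j)" using deg_ge[OF low_z(2)] low_z(1) by blast
  then show False
    using next_not_regular_if_inner next_not_regular_if_last k_ge_3 j_bounds by fastforce
qed

lemma j_eq_1: "j = 1"
  using j_bounds k_eq_2 by simp

lemma L_eq: "L = {p ! 0, p ! 1, p ! 2}"
proof -
  have "i \<le> 2 \<longleftrightarrow> i = 0 \<or> i = 1 \<or> i = 2" for i :: nat by auto
  then show ?thesis using mem_L_iff k_eq_2 by auto
qed

lemma nbrs_of_escape_nbr:
  assumes edge_x: "adj (p ! 1) x" "x \<noteq> c"
  shows "nbrs x \<subseteq> {p ! 1, c}"
proof (cases "x \<in> L")
  case True
  have "\<not> adj (p ! 0) (p ! 2)" using not_adj_hd j_eq_1 by (simp add: numeral_2_eq_2)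
  then have "\<not> adj (p ! 2) (p ! 0)" using adj_sym by blast
  moreover have "nbrs (p ! 0) \<subseteq> insert c L" "nbrs (p ! 2) \<subseteq> insert c L"
    using nbrs_if_neq j_eq_1 k_eq_2 by auto
  moreover have "x = p ! 0 \<or> x = p ! 2" using True edge_x(1) L_eq adj_irrefl by auto
  ultimately show ?thesis using \<open>\<not> adj (p ! 0) (p ! 2)\<close> L_eq adj_irrefl by auto
next
  case False
  have "p ! 1 \<in> L" using L_eq by simp
  then have "p ! 1 \<notin> R" using parts_disjoint(3) by blast
  moreover have "p ! 1 \<noteq> c" using nth_p_eq_iff[of 1 "Suc k"] m_eq k_eq_2 by simp
  ultimately have "x \<notin> R" using separatesD[OF separates_R _ adj_sym[OF edge_x(1)]] by blast
  then have x_off: "x \<notin> set p" using False edge_x(2) set_p by blast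
  show ?thesis
  proof
    fix y assume "y \<in> nbrs x"
    then have edge_y: "adj x y" by simp
    have "y \<in> set p \<or> y = p ! 1"
    proof (rule ccontr)
      assume "\<not> ?thesis"
      moreover have "x \<noteq> p ! 1" using edge_x(1) adj_irrefl by blast
      ultimately have "length [x, y] \<le> j"
        using edge_x(1) edge_y x_off adj_neq[OF edge_y] j_eq_1
        by (intro escaping_tail_bound) (auto simp: is_path_Cons_iff[of "[x, y]"])
      then show False using j_eq_1 by simp
    qed
    moreover have "y \<notin> R" using separatesD[OF separates_R _ adj_sym[OF edge_y]] x_off set_p by blast
    moreover have "y = p ! 1" if "y \<in> L"
      using escape_vertex_unique[OF that adj_sym[OF edge_y]] False edge_x(2) j_eq_1 by auto
    ultimately show "y \<in> {p ! 1, c}" using set_p by blast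
  qed
qed

lemma hub_star_matching_holds: hub_star_matching
proof -
  define a where "a = p ! 1"
  define S where "S = insert a (nbrs a - {c})"
  have "a \<in> L" unfolding a_def L_eq by simp
  then have a_in: "a \<in> L" "a \<noteq> c" using parts_disjoint(1) by blast+
  have centers: "c \<in> V" "a \<in> V" using longestD(5)[OF longest_p] set_p a_in by auto
  have leaves: "nbrs x \<subseteq> {a, c}" if "x \<in> S - {a}" for x
    using nbrs_of_escape_nbr that by (auto simp: S_def a_def)
  have separated: "separates c S"
  proof (rule separatesI)
    fix x y assume "x \<in> S" "adj x y" "y \<noteq> c"
    then show "y \<in> S" using nbrs_subsetD[OF leaves[of x]] by (cases "x = a") (auto simp: S_def)
  qed
  have "adj a (p ! 0)" "adj a (p ! 2)"
    using is_path_nth_adj[OF path_p, of 0] is_path_nth_adj[OF path_p, of 1] adj_sym length_p m_eq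
      k_eq_2
    by (auto simp: a_def numeral_2_eq_2)
  moreover have "x = a \<or> x = p ! 0 \<or> x = p ! 2" "x \<noteq> c" if "x \<in> L" for x
    using that L_eq parts_disjoint(1) unfolding a_def by (blast, metis)
  ultimately have "L \<subseteq> S"
    unfolding S_def by (metis Diff_iff insert_iff mem_nbrs singletonD subsetI)
  have "card (component {c} x) \<le> 2" if "x \<in> V - {c} - S" for x
  proof -
    have "length r \<le> k" if "is_path (c # r)" "set r \<inter> S = {}" for r
    proof -
      have "Suc k + Suc (length r) \<le> m"
        by (rule prefix_bound[OF longest_p _ _ that(1)]) (use that(2) \<open>L \<subseteq> S\<close> m_eq in auto)
      then show ?thesis using m_eq by simp
    qed
    then show ?thesis
      using card_component_outside_separated_le[OF centers(1) separated that] k_eq_2 by simp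
  qed
  then have "induces_matching (V - {c} - S)" by (intro induces_matching_components[of _ "{c}"]) auto
  moreover have "S \<subseteq> V - {c}" using centers a_in(2) nbrs_subset by (auto simp: S_def)
  ultimately show ?thesis
    unfolding hub_star_matching_def using centers(1) separated leaves
    by (intro bexI[of _ c] exI[of _ S] conjI bexI[of _ a]) (auto simp: S_def)
qed

end

theorem (in unbalanced_path) extremal_if_unbalanced: extremal
proof (cases "separates c L")
  case True
  then show ?thesis using small_components_if_separates_L extremalI(3) by blast
next
  case False
  then obtain x q where "x \<in> L" "adj x q" "q \<notin> insert c L"
    unfolding separates_def nbrs_def by blast
  then obtain j where "escaping_path V adj k m p j q"
    using mem_L_iff unbalanced_path_axioms
    by (auto simp: escaping_path_def escaping_path_axioms_def)
  then interpret escaping_path V adj k m p j q .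
  show ?thesis using extremalI(5)[OF k_eq_2 hub_star_matching_holds] .
qed

section \<open>Longest paths with both ends of large degree\<close>

context longest_path_graph begin

lemma extremal_if_cycle_misses_edge:
  assumes C_cycle: "is_cycle C" "length C = 2 * k" and m_eq: "m = 2 * k + 2"
    and uv: "adj u v" "u \<notin> set C" "v \<notin> set C"
  shows extremal
proof -
  interpret off_edge V adj k C u v
    using C_cycle uv bounded order no_cycle m_eq by unfold_locales simp_all
  show ?thesis by (rule extremal_if_off_edge)
qed

lemma extremal_if_unbalanced_and_regular:
  assumes "longest p" "m = 2 * k + 2" "k \<le> deg (hd p)"
    "k \<in> head_chords p" "{k + 1..2 * k} \<subseteq> tail_chords p"
  shows extremal
proof -
  interpret unbalanced_path V adj k m p using assms by unfold_locales
  show ?thesis by (rule extremal_if_unbalanced)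
qed

lemma tail_chords_rotation:
  assumes longest_p: "longest p" and head_s: "s \<in> head_chords p" "Suc s \<le> i"
    and tail_i: "i \<in> tail_chords p"
  shows "i \<in> tail_chords (rotation s 1 p)"
proof -
  have "Suc i < length p" using tail_i by (simp add: tail_chords_def)
  then show ?thesis
    using tail_i nth_rotation_1[OF head_s(2), of p] longest_rotation[OF longest_p head_s(1)]
      longestD(2)[OF longest_p]
      longestD(2)[OF longest_rotation(1)[OF longest_p head_s(1)]] by (simp add: tail_chords_def)
qed

lemma extremal_if_unbalanced:
  assumes longest_p: "longest p" and m_eq: "m = 2 * k + 2"
    and head: "k \<in> head_chords p" and tail: "{k + 1..2 * k} \<subseteq> tail_chords p"
  shows extremal
proof (cases "k \<le> deg (hd p)")
  case True
  then show ?thesis using extremal_if_unbalanced_and_regular assms by blast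
next
  case False
  let ?q = "rotation k 1 p"
  note longest_q = longest_rotation[OF longest_p head]
  have k_less: "Suc k < length p" using head by (simp add: head_chords_def)
  have "p ! k \<noteq> hd p"
    using is_path_nth_eq_iff[OF longestD(1)[OF longest_p], of k 0] k_less k_pos
      longestD(3)[OF longest_p]
      hd_conv_nth[OF longestD(3)[OF longest_p]] by simp
  moreover have "hd p \<in> V" "p ! k \<in> V"
    using longestD[OF longest_p] is_path_nth_in_V k_less hd_in_set by auto
  ultimately have "k \<le> deg (hd ?q)" using deg_ge[of "hd p" "p ! k"] False longest_q(2) by simp
  moreover have "k \<in> head_chords ?q"
    using nth_rotation_1[of k "Suc k" p] longest_q longestD(2)[OF longest_q(1)]
      longestD(2)[OF longest_p] k_less
      is_path_nth_adj[OF longestD(1)[OF longest_p], of k] by (simp add: head_chords_def)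
  moreover have "{k + 1..2 * k} \<subseteq> tail_chords ?q"
    using tail_chords_rotation[OF longest_p head] tail by auto
  ultimately show ?thesis using extremal_if_unbalanced_and_regular[OF longest_q(1) m_eq] by blast
qed

lemma extremal_or_separates_half:
  assumes longest_p: "longest p" and m_eq: "m = 2 * k + 2"
    and head: "{..<k} \<subseteq> head_chords p" and tail: "{k + 1..2 * k} \<subseteq> tail_chords p"
  shows "extremal \<or> separates (p ! k) (set (take k p))"
proof (cases "\<forall>s<k. p ! Suc k \<notin> nbrs (p ! s)")
  case True
  have "nbrs (p ! s) \<subseteq> set (take (Suc k) p)" if s_less: "s < k" for s
  proof -
    have "nbrs (p ! s) \<subseteq> set (take (Suc (Suc k)) p)"
    proof (rule nbrs_subset_take_if_tail_chords[OF longest_p])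
      fix i assume "Suc k \<le> i" "Suc i < m"
      then have "i \<in> {k + 1..2 * k}" using m_eq by simp
      then show "i \<in> tail_chords p \<or> Suc k < i \<and> i - 1 \<in> tail_chords p" using tail by blast
    qed (use s_less head in auto)
    also have "set (take (Suc (Suc k)) p) = insert (p ! Suc k) (set (take (Suc k) p))"
      using longestD(2)[OF longest_p] m_eq take_Suc_conv_app_nth[of "Suc k" p] by simp
    finally show ?thesis using True s_less by blast
  qed
  then show ?thesis using separates_prefix[OF longest_p] m_eq by simp
next
  case False
  then obtain s where edge_s: "s < k" "adj (p ! s) (p ! Suc k)" by auto
  let ?q = "rotation s 1 p"
  have s_head: "s \<in> head_chords p" using head edge_s(1) by blast
  note longest_q = longest_rotation[OF longest_p s_head]
  have "k \<in> head_chords ?q"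
    using nth_rotation_1[of s "Suc k" p] edge_s longest_q longestD(2)[OF longest_q(1)]
      longestD(2)[OF longest_p] m_eq
    by (simp add: head_chords_def)
  moreover have "{k + 1..2 * k} \<subseteq> tail_chords ?q"
    using tail_chords_rotation[OF longest_p s_head] tail edge_s(1) by auto
  ultimately show ?thesis using extremal_if_unbalanced[OF longest_q(1) m_eq] by blast
qed

lemma extremal_if_bridge:
  assumes longest_p: "longest p" and m_eq: "m = 2 * k + 2"
    and head: "{..<k} \<subseteq> head_chords p" and tail: "{k + 1..2 * k} \<subseteq> tail_chords p"
  shows extremal
proof (rule ccontr)
  assume not_extremal: "\<not> extremal"
  have length_p: "length p = 2 * k + 2" using longestD(2)[OF longest_p] m_eq by simp
  have "{..<k} \<subseteq> head_chords (rev p)"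
  proof
    fix i assume "i \<in> {..<k}"
    then have "2 * k - i \<in> tail_chords p" "2 * k - i + i + 2 = length p" using tail length_p by auto
    then show "i \<in> head_chords (rev p)" using head_chords_rev_iff by blast
  qed
  moreover have "{k + 1..2 * k} \<subseteq> tail_chords (rev p)"
  proof
    fix i assume "i \<in> {k + 1..2 * k}"
    then have "2 * k - i \<in> head_chords p" "2 * k - i + i + 2 = length p" using head length_p by auto
    then show "i \<in> tail_chords (rev p)" using tail_chords_rev_iff by blast
  qed
  ultimately have "separates (rev p ! k) (set (take k (rev p)))"
    using extremal_or_separates_half[OF longest_rev[THEN iffD2, OF longest_p] m_eq] not_extremal
    by blast
  then have right: "separates (p ! Suc k) (set (drop (k + 2) p))"
    using length_p by (simp add: rev_nth take_rev)
  have left: "separates (p ! k) (set (take k p))"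
    using extremal_or_separates_half[OF longest_p m_eq head tail] not_extremal by blast
  have "p = take k p @ p ! k # p ! Suc k # drop (k + 2) p"
    using length_p id_take_nth_drop[of k p] Cons_nth_drop_Suc[of "Suc k" p] by simp
  then have "is_path (take k p @ [p ! k, p ! Suc k] @ drop (k + 2) p)"
    using longestD(1)[OF longest_p] by simp
  then interpret linked_path V adj k "take k p" "drop (k + 2) p" "p ! k" "p ! Suc k"
    using left right bounded m_eq length_p by unfold_locales simp_all
  show False using linked_small_components_holds extremalI(4) not_extremal by blast
qed

lemma extremal_if_tight:
  assumes longest_p: "longest p" and m_eq: "m = 2 * k + 2" and regular: "k \<le> deg (hd p)"
    and tail: "{k + 1..2 * k} \<subseteq> tail_chords p"
  shows extremal
proof (cases "k \<in> head_chords p")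
  case True
  then show ?thesis using extremal_if_unbalanced longest_p m_eq tail by blast
next
  case False
  have "head_chords p \<subseteq> {..<k}"
  proof
    fix i assume head_i: "i \<in> head_chords p"
    have "i \<notin> {k + 1..2 * k}" "i \<noteq> k"
      using head_i tail False head_tail_chords_disjoint[OF longest_p] by blast+
    moreover have "i \<le> 2 * k"
      using head_i longestD(2)[OF longest_p] m_eq by (simp add: head_chords_def)
    ultimately show "i \<in> {..<k}" by auto
  qed
  then have "head_chords p = {..<k}"
    using card_head_chords[OF longest_p] regular by (intro card_seteq) auto
  then show ?thesis using extremal_if_bridge[OF longest_p m_eq _ tail] by simp
qed

lemma extremal_if_crossing:
  assumes longest_p: "longest p" and m_eq: "m = 2 * k + 2"
    and crossing: "t \<in> tail_chords p" "t + 2 \<in> head_chords p"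
  shows extremal
proof -
  note path_p = longestD(1)[OF longest_p] and length_p = longestD(2)[OF longest_p]
  have chords: "t + 3 < m" "adj (hd p) (p ! (t + 3))" "adj (last p) (p ! t)"
    using crossing length_p by (auto simp: head_chords_def tail_chords_def numeral_eq_Suc)
  have "0 \<notin> tail_chords p"
    using zero_head_chord[OF path_p] length_p m_eq head_tail_chords_disjoint[OF longest_p] by auto
  then have "t \<noteq> 0" using crossing(1) by (cases t) auto
  then have "2 \<le> k" using chords(1) m_eq by linarith
  then have "is_cycle (rotation t 3 p)" "length (rotation t 3 p) = 2 * k"
    using is_cycle_rotation[OF path_p, of 3 t] chords length_p m_eq
    by (simp_all add: length_rotation)
  moreover have "adj (p ! (t + 1)) (p ! (t + 2))"
    using is_path_nth_adj[OF path_p, of "t + 1"] chords(1) length_p by simp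
  moreover have "p ! (t + 1) \<notin> set (rotation t 3 p)" "p ! (t + 2) \<notin> set (rotation t 3 p)"
    using chords(1) length_p by (intro skipped_not_in_rotation[OF longestD(4)[OF longest_p]]; simp)+
  ultimately show ?thesis using extremal_if_cycle_misses_edge m_eq by blast
qed

lemma crossing_free_chords:
  assumes longest_p: "longest p" and m_le: "m \<le> 2 * k + 2"
    and regular: "k \<le> deg (hd p)" "k \<le> deg (last p)"
  shows "crossing_free_sets (head_chords p) (tail_chords p) k (m - 1)"
proof unfold_locales
  show "head_chords p \<subseteq> {..<m - 1}" "tail_chords p \<subseteq> {..<m - 1}"
    using longestD(2)[OF longest_p] by (auto simp: head_chords_def tail_chords_def)
  show "k \<le> card (head_chords p)" "k \<le> card (tail_chords p)"
    using card_head_chords[OF longest_p] card_tail_chords[OF longest_p] regular by simp_all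
qed (use head_tail_chords_disjoint[OF longest_p] Suc_not_head_chord[OF longest_p] k_pos m_le in auto)

lemma small_components_if_ends_regular:
  assumes longest_p: "longest p" and m_le: "m \<le> 2 * k + 1"
    and regular: "k \<le> deg (hd p)" "k \<le> deg (last p)"
  shows "small_components k"
proof -
  interpret crossing_free_sets "head_chords p" "tail_chords p" k "m - 1"
    using crossing_free_chords[OF longest_p _ regular] m_le by simp
  show ?thesis
  proof (cases rule: crossing_free_cases)
    case even
    then show ?thesis using small_components_if_balanced[OF longest_p] m_ge_3 by simp
  qed (use m_le m_ge_3 in simp_all)
qed

theorem extremal_if_ends_regular:
  assumes longest_p: "longest p" and m_le: "m \<le> 2 * k + 2"
    and regular: "k \<le> deg (hd p)" "k \<le> deg (last p)"
  shows extremal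
proof (cases "m = 2 * k + 2")
  case False
  then show ?thesis
    using small_components_if_ends_regular[OF longest_p _ regular] small_components_imp_but_one
      extremalI(3) m_le
    by simp
next
  case m_eq: True
  interpret crossing_free_sets "head_chords p" "tail_chords p" k "m - 1"
    using crossing_free_chords[OF longest_p m_le regular] .
  show ?thesis
  proof (cases rule: crossing_free_cases)
    case tight_right
    moreover have "{k + 1..2 * k} = {k + 1..<m - 1}" using m_eq by auto
    ultimately show ?thesis using extremal_if_tight[OF longest_p m_eq regular(1)] by simp
  next
    case tight_left
    have length_p: "length p = 2 * k + 2" using longestD(2)[OF longest_p] m_eq by simp
    have "{k + 1..2 * k} \<subseteq> tail_chords (rev p)"
    proof
      fix i assume i_in: "i \<in> {k + 1..2 * k}"
      then have "2 * k - i \<in> head_chords p" unfolding tight_left(2) by auto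
      moreover have "2 * k - i + i + 2 = length p" using i_in length_p by simp
      ultimately show "i \<in> tail_chords (rev p)" using tail_chords_rev_iff by blast
    qed
    moreover have "hd (rev p) = last p" using longestD(3)[OF longest_p] by (simp add: hd_rev)
    ultimately show ?thesis
      using extremal_if_tight[OF longest_rev[THEN iffD2, OF longest_p] m_eq] regular(2) by simp
  next
    case (crossing t)
    then show ?thesis using extremal_if_crossing[OF longest_p m_eq] by blast
  qed (use m_eq in simp)
qed

end

section \<open>Deleting a leaf\<close>

locale graph_with_leaf = nearly_min_degree V adj k for V :: "'a set" and adj k +
  fixes w z :: 'a
  assumes leaf: "nbrs w = {z}" and k_ge_2: "2 \<le> k"
begin

definition del_adj :: "'a \<Rightarrow> 'a \<Rightarrow> bool" where
  "del_adj x y \<longleftrightarrow> adj x y \<and> x \<noteq> w \<and> y \<noteq> w"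

lemma adj_leaf: "adj w z"
  using leaf mem_nbrs by blast

lemma leaf_V: "w \<in> V" "z \<in> V" "z \<noteq> w"
  using adj_leaf adj_V adj_neq by blast+

lemma adj_leafD: "adj x w \<Longrightarrow> x = z"
  using leaf adj_sym mem_nbrs by blast

lemma deg_ge_if_neq_leaf: "x \<in> V \<Longrightarrow> x \<noteq> w \<Longrightarrow> k \<le> deg x"
  using deg_ge[of w x] leaf leaf_V k_ge_2 by simp

end

sublocale graph_with_leaf \<subseteq> del: simple_graph "V - {w}" del_adj
  using finite_V adj_V adj_irrefl adj_sym by unfold_locales (auto simp: del_adj_def)

context graph_with_leaf begin

lemma del_nbrs: "x \<noteq> w \<Longrightarrow> del.nbrs x = nbrs x - {w}"
  by (auto simp: del.nbrs_def del_adj_def)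

lemma del_deg_ge: "x \<in> V - {w, z} \<Longrightarrow> k \<le> del.deg x"
proof -
  assume x_in: "x \<in> V - {w, z}"
  then have "w \<notin> nbrs x" using adj_leafD[of x] by auto
  then have "del.nbrs x = nbrs x" using del_nbrs[of x] x_in by simp
  then show ?thesis using deg_ge_if_neq_leaf[of x] x_in by simp
qed

lemma del_is_path_iff: "del.is_path q \<longleftrightarrow> is_path q \<and> w \<notin> set q"
proof -
  have "successively del_adj q \<longleftrightarrow> successively adj q" if "w \<notin> set q"
    using that by (intro successively_cong[OF _ refl]) (auto simp: del_adj_def)
  then show ?thesis by (auto simp: del.is_path_def is_path_def)
qed

lemma del_connected: del.is_connected
  unfolding del.is_connected_def
proof (intro allI impI)
  fix S assume S_proper: "S \<subseteq> V - {w}" "S \<noteq> {}" "S \<noteq> V - {w}"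
  show "\<exists>x\<in>S. \<exists>y\<in>V - {w} - S. del_adj x y"
  proof (cases "z \<in> S")
    case True
    have "insert w S \<subseteq> V" "insert w S \<noteq> {}" "insert w S \<noteq> V" using S_proper leaf_V by auto
    then obtain x y where leaving: "x \<in> insert w S" "y \<in> V - insert w S" "adj x y"
      by (rule connectedE[OF connected])
    then have "x \<noteq> w" using adj_leafD[OF adj_sym[of w y]] True by auto
    then show ?thesis using leaving by (auto simp: del_adj_def)
  next
    case False
    have "S \<subseteq> V" "S \<noteq> V" using S_proper leaf_V by auto
    then obtain x y where leaving: "x \<in> S" "y \<in> V - S" "adj x y"
      using S_proper(2) connectedE[OF connected] by metis
    have "y \<noteq> w" using adj_leafD leaving(1,3) False by blast
    then show ?thesis using leaving S_proper(1) by (auto simp: del_adj_def)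
  qed
qed

end

sublocale graph_with_leaf \<subseteq> del: nearly_min_degree "V - {w}" del_adj k
proof unfold_locales
  fix x y assume "x \<in> V - {w}" "y \<in> V - {w}" "del.deg x < k" "del.deg y < k"
  then show "x = y" using del_deg_ge[of x] del_deg_ge[of y] by (cases "x = z"; cases "y = z") auto
qed (use del_connected k_pos in auto)

context graph_with_leaf begin

lemma covered_except_2_if_del_covered:
  assumes "del.covered_except k 1"
  shows "covered_except k 2"
proof -
  obtain A U where A_subset: "A \<subseteq> V - {w}" "card A = k" and U_subset: "U \<subseteq> V - {w} - A" "card U = 1"
    and covers: "\<forall>x y. del_adj x y \<longrightarrow> x \<in> A \<or> y \<in> A \<or> x \<in> U \<and> y \<in> U"
    using assms unfolding del.covered_except_def by blast
  obtain v where U_eq: "U = {v}" using U_subset(2) by (auto simp: card_1_singleton_iff)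
  define v' where "v' = (if z \<in> A then v else z)"
  have "x \<in> A \<or> y \<in> A \<or> x \<in> {w, v'} \<and> y \<in> {w, v'}" if edge_xy: "adj x y" for x y
  proof (cases "x = w \<or> y = w")
    case True
    then have "{x, y} = {w, z}" using adj_leafD[of x] adj_leafD[of y] edge_xy adj_sym by blast
    then show ?thesis by (auto simp: v'_def doubleton_eq_iff)
  next
    case False
    then show ?thesis using covers edge_xy U_eq adj_irrefl by (auto simp: del_adj_def)
  qed
  moreover have "{w, v'} \<subseteq> V - A" "w \<noteq> v'"
    using A_subset(1) U_subset(1) U_eq leaf_V by (auto simp: v'_def)
  ultimately show ?thesis
    unfolding covered_except_def using A_subset by (intro exI[of _ A] exI[of _ "{w, v'}"]) auto
qed

lemma component_subset_del_component:
  assumes x_in: "x \<in> V - {w} - {c}" and z_notin: "z \<notin> del.component {c} x"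
  shows "component {c} x \<subseteq> del.component {c} x"
proof (rule component_subset)
  fix a b assume edge_ab: "a \<in> del.component {c} x" "adj a b" "b \<notin> {c}"
  have a_notin: "a \<notin> {w, c}" using edge_ab(1) del.component_in[OF x_in] by blast
  have "b \<noteq> w" using adj_leafD edge_ab(1,2) z_notin by blast
  then show "b \<in> del.component {c} x"
    using del.component_step[of a "{c}" x b] edge_ab a_notin by (simp add: del_adj_def)
qed simp

lemma separates_leaf_and_component:
  assumes "z \<noteq> c"
  shows "separates c (insert w (del.component {c} z))"
proof (rule separatesI)
  fix x y assume edge_xy: "x \<in> insert w (del.component {c} z)" "adj x y" "y \<noteq> c"
  show "y \<in> insert w (del.component {c} z)"
  proof (cases "x = w \<or> y = w")
    case True
    then show ?thesis using adj_leafD[of y] adj_sym[OF edge_xy(2)] by auto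
  next
    case False
    moreover have "x \<noteq> c"
      using edge_xy(1) False del.component_in[of z "{c}"] assms leaf_V by auto
    ultimately show ?thesis
      using del.component_step[of x "{c}" z y] edge_xy by (simp add: del_adj_def)
  qed
qed

lemma small_components_but_one_if_del_small:
  assumes "del.small_components k"
  shows "small_components_but_one k"
proof -
  obtain c where c_in: "c \<in> V - {w}"
    and small: "\<And>x. x \<in> V - {w} - {c} \<Longrightarrow> card (del.component {c} x) \<le> k"
    using assms unfolding del.small_components_def by blast
  define D where "D = (if z = c then {w} else insert w (del.component {c} z))"
  have "D \<subseteq> V - {c}"
    using del.component_in[of z "{c}"] leaf_V c_in by (auto simp: D_def)
  moreover have "card D \<le> k + 1"
    using small[of z] leaf_V card_insert_le_m1[of "k + 1" "del.component {c} z" w]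
    by (simp add: D_def)
  moreover have "separates c {w}" if "z = c"
    using that leaf by (auto simp: separates_def)
  then have "separates c D" using separates_leaf_and_component by (simp add: D_def)
  moreover have "card (component {c} x) \<le> k" if x_in: "x \<in> V - {c} - D" for x
  proof -
    have x_in_del: "x \<in> V - {w} - {c}" using x_in by (auto simp: D_def split: if_splits)
    have "z \<notin> del.component {c} x"
    proof
      assume "z \<in> del.component {c} x"
      then have "z \<noteq> c" "x \<in> del.component {c} z"
        using del.component_in[OF x_in_del] del.component_sym by blast+
      then show False using x_in by (simp add: D_def)
    qed
    then have "card (component {c} x) \<le> card (del.component {c} x)"
      using component_subset_del_component[OF x_in_del] del.finite_component[OF x_in_del]
      by (intro card_mono)
    then show ?thesis using small[OF x_in_del] by linarith
  qed
  ultimately show ?thesis unfolding small_components_but_one_def using c_in by blast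
qed

end

section \<open>A leaf at the end of every longest path\<close>

context longest_path_graph begin

definition no_regular_longest :: bool where
  "no_regular_longest \<longleftrightarrow> (\<forall>p. longest p \<longrightarrow> deg (hd p) < k \<or> deg (last p) < k)"

lemma ex_longest_ending_in_leaf:
  assumes longest_p: "longest p" and irregular: no_regular_longest
  obtains r where "longest r" "deg (hd r) < k" "nbrs (hd r) = {r ! 1}"
proof -
  obtain r where r_low: "longest r" "deg (hd r) < k"
  proof (cases "deg (hd p) < k")
    case False
    then have "deg (last p) < k" using irregular longest_p by (auto simp: no_regular_longest_def)
    then show thesis
      using that[of "rev p"] longest_p longestD(3)[OF longest_p] by (simp add: hd_rev)
  qed (use longest_p that in blast)
  note path = longestD(1)[OF r_low(1)] and length_r = longestD(2)[OF r_low(1)]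
  have hd_r: "hd r = r ! 0" by (rule hd_conv_nth[OF longestD(3)[OF r_low(1)]])
  have regular: "k \<le> deg (r ! i)" if "0 < i" "i < m" for i
    using deg_ge[OF r_low(2), of "r ! i"] is_path_nth_in_V[OF path]
      is_path_nth_eq_iff[OF path, of i 0]
      that length_r hd_r longestD(5)[OF r_low(1)] by simp
  have "head_chords r \<subseteq> {0}"
  proof (rule subsetI, rule ccontr)
    fix s assume head_s: "s \<in> head_chords r" "s \<notin> {0}"
    note longest_q = longest_rotation[OF r_low(1) head_s(1)]
    have "s < m" using head_s(1) length_r by (simp add: head_chords_def)
    moreover have "last r = r ! (m - 1)"
      using last_conv_nth[OF longestD(3)[OF r_low(1)]] length_r by simp
    ultimately have "k \<le> deg (hd (rotation s 1 r))" "k \<le> deg (last (rotation s 1 r))"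
      using regular[of s] regular[of "m - 1"] head_s(2) longest_q(2,3) m_ge_3 by simp_all
    then show False using irregular longest_q(1) by (fastforce simp: no_regular_longest_def)
  qed
  then have "head_chords r = {0}" using zero_head_chord[OF path] length_r m_ge_3 by auto
  then have "nbrs (hd r) = {r ! 1}" using image_head_chords[OF r_low(1)] by simp
  then show thesis using that r_low by blast
qed

end

locale longest_path_from_leaf =
  longest_path_graph V adj k m + graph_with_leaf V adj k w z
  for V :: "'a set" and adj k m w z +
  fixes r :: "'a list"
  assumes longest_r: "longest r" and hd_r: "hd r = w" and irregular: no_regular_longest
    and m_le: "m \<le> 2 * k + 2"
begin

lemma r_eq: "r = w # tl r"
  using longestD(3)[OF longest_r] hd_r by (metis list.collapse)

lemma tl_r: "del.is_path (tl r)" "length (tl r) = m - 1" "hd (tl r) = z"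
proof -
  have nonempty: "tl r \<noteq> []" using longestD(2)[OF longest_r] m_ge_3 by (cases r) auto
  have "is_path (w # tl r)" using longestD(1)[OF longest_r] r_eq by simp
  then have "is_path (tl r)" "w \<notin> set (tl r)" "adj w (hd (tl r))"
    using is_path_Cons_iff[OF nonempty] by auto
  then show "del.is_path (tl r)" "hd (tl r) = z"
    using adj_leafD adj_sym by (auto simp: del_is_path_iff)
qed (simp add: longestD(2)[OF longest_r])

lemma del_paths_bounded: "del.paths_bounded (m - 1)"
  unfolding del.paths_bounded_def
proof (intro allI impI)
  fix q assume "del.is_path q"
  then have path_q: "is_path q" "w \<notin> set q" by (simp_all add: del_is_path_iff)
  have "length q \<noteq> m"
  proof
    assume "length q = m"
    then have "longest q" using path_q(1) by (simp add: longest_def)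
    moreover have "hd q \<in> V - {w}" "last q \<in> V - {w}" using is_pathD[OF path_q(1)] path_q(2) by auto
    ultimately show False
      using irregular deg_ge_if_neq_leaf by (fastforce simp: no_regular_longest_def)
  qed
  moreover have "length q \<le> m" using paths_boundedD[OF bounded path_q(1)] .
  ultimately show "length q \<le> m - 1" by simp
qed

lemma card_del: "card (V - {w}) = card V - 1"
  using leaf_V by simp

lemma extremal_if_del_has_cycle:
  assumes "del.has_cycle (m - 2)"
  shows extremal
proof -
  obtain D where cycle_D: "del.is_cycle D" "length D = m - 2"
    using assms by (auto simp: del.has_cycle_def)
  have "3 \<le> length D" using cycle_D(1) by (simp add: del.is_cycle_def)
  then interpret cycle_missing_vertex "V - {w}" del_adj k D
    using cycle_D del_paths_bounded m_le order card_del
    by unfold_locales (simp_all add: Suc_diff_Suc numeral_2_eq_2)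
  have covered: "del.covered_except k 1" and m_eq: "m = 2 * k + 2"
    using covered_by_cycle cycle_D(2) \<open>3 \<le> length D\<close> m_le by auto
  have "2 * k + 3 \<le> card V"
    using longest_path_graph.order[OF longest_path_graph_axioms] m_eq by simp
  then show ?thesis by (rule extremalI(2)[OF _ covered_except_2_if_del_covered[OF covered]])
qed

lemma m_ge_4_if_del_deg:
  assumes "2 \<le> del.deg z"
  shows "4 \<le> m"
proof -
  have nonempty: "tl r \<noteq> []" by (rule del.is_pathD(1)[OF tl_r(1)])
  have "del.nbrs z \<subseteq> set (tl r) - {z}"
  proof
    fix y assume "y \<in> del.nbrs z"
    then have edge_y: "del_adj z y" by simp
    have "\<not> del.is_path (y # tl r)"
      using del.paths_boundedD[OF del_paths_bounded, of "y # tl r"] tl_r(2) m_ge_3 by auto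
    then have "y \<in> set (tl r)"
      using del.is_path_Cons_iff[OF nonempty, of y] tl_r(1,3) del.adj_sym[OF edge_y] by blast
    then show "y \<in> set (tl r) - {z}" using del.adj_neq[OF edge_y] by blast
  qed
  then have "del.deg z \<le> card (set (tl r) - {z})" by (intro card_mono) auto
  also have "\<dots> = m - 2"
    using del.card_set_path[OF tl_r(1)] hd_in_set[OF nonempty] tl_r(2,3) by simp
  finally show ?thesis using assms by linarith
qed

lemma extremal_if_del_has_no_cycle:
  assumes no_cycle: "\<not> del.has_cycle (m - 2)" and deg_z: "2 \<le> del.deg z"
  shows extremal
proof -
  have m_ge_4: "4 \<le> m" by (rule m_ge_4_if_del_deg[OF deg_z])
  interpret del_path: longest_path_graph "V - {w}" del_adj k "m - 1"
    using del_paths_bounded m_ge_4 no_cycle order card_del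
    by unfold_locales (simp_all add: numeral_2_eq_2)
  have tl_longest: "del_path.longest (tl r)" unfolding del_path.longest_def using tl_r(1,2) ..
  have "card (del.head_chords (tl r)) = del.deg z"
    using del_path.card_head_chords[OF tl_longest] tl_r(3) by simp
  then have "\<not> del.head_chords (tl r) \<subseteq> {0}"
    using deg_z card_mono[of "{0}" "del.head_chords (tl r)"] by auto
  then obtain s where head_s: "s \<in> del.head_chords (tl r)" "s \<noteq> 0" by auto
  note longest_q = del_path.longest_rotation[OF tl_longest head_s(1)]
  have regular: "k \<le> del.deg (tl r ! i)" if "0 < i" "i < m - 1" for i
  proof (rule del_deg_ge)
    have "tl r ! i \<noteq> z"
      using del.is_path_nth_eq_iff[OF tl_r(1), of i 0] that tl_r(2,3)
        hd_conv_nth[OF del.is_pathD(1)[OF tl_r(1)]] by simp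
    then show "tl r ! i \<in> V - {w, z}"
      using del.is_path_nth_in_V[OF tl_r(1), of i] that tl_r(2) by simp
  qed
  have "last (tl r) = tl r ! (m - 2)"
    using last_conv_nth[OF del.is_pathD(1)[OF tl_r(1)]] unfolding tl_r(2)
    by (simp add: numeral_2_eq_2)
  moreover have "s < m - 1" using head_s(1) tl_r(2) by (simp add: del.head_chords_def)
  ultimately have "del.small_components k"
    using del_path.small_components_if_ends_regular[OF longest_q(1)] regular[of s]
      regular[of "m - 2"]
      head_s(2) longest_q(2,3) m_le m_ge_4 by simp
  then show ?thesis using small_components_but_one_if_del_small extremalI(3) by blast
qed

end

lemma (in longest_path_graph) separates_triangle_at_end:
  assumes longest_r: "longest (xs @ [c, b, a])" and edge_ac: "adj a c"
    and xs_not_adj: "\<And>x. x \<in> set xs \<Longrightarrow> \<not> adj a x \<and> \<not> adj b x"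
  shows "separates c {a, b}"
proof -
  have "is_path [c, b, a]" "set xs \<inter> {a, b, c} = {}"
    using longestD(1)[OF longest_r] is_path_append_iff[of xs "[c, b, a]"]
    by (cases "xs = []"; auto)+
  then have "is_path [c, a, b]"
    using edge_ac adj_commute
    by (auto simp: is_path_Cons_iff[of "[a, b]"] is_path_Cons_iff[of "[b, a]"])
  then have "longest (xs @ [c, a, b])"
    using longest_r is_path_append_iff[of xs "[c, b, a]"] is_path_append_iff[of xs "[c, a, b]"]
    by (cases "xs = []") (auto simp: longest_def)
  then have "nbrs b \<subseteq> insert c {a, b} \<union> set xs" "nbrs a \<subseteq> insert c {a, b} \<union> set xs"
    using nbrs_hd[of "rev (xs @ [c, a, b])"] nbrs_hd[of "rev (xs @ [c, b, a])"] longest_r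
      longest_rev[of "xs @ [c, a, b]"] longest_rev[of "xs @ [c, b, a]"]
    by (auto simp del: longest_rev)
  then show ?thesis using xs_not_adj unfolding separates_def by auto
qed

context longest_path_from_leaf begin

context
  assumes deg_z_le: "del.deg z < 2"
begin

lemma k_eq_2: "k = 2" and nbrs_z: "nbrs z = {w, r ! 2}"
proof -
  have "card (nbrs z - {w}) < 2" using deg_z_le del_nbrs[of z] leaf_V by simp
  then have "card (nbrs z) \<le> 2" using adj_leaf adj_commute by (simp add: card_Diff_singleton)
  then show "k = 2" using deg_ge_if_neq_leaf[of z] leaf_V k_ge_2 by simp
  have path: "is_path r" and length_r: "length r = m" using longestD[OF longest_r] by auto
  have r0: "r ! 0 = w" using hd_r hd_conv_nth[OF longestD(3)[OF longest_r]] by simp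
  have "r ! 1 = z" using is_path_nth_adj[OF path, of 0] r0 length_r m_ge_3 adj_leafD adj_sym by simp
  then have "{w, r ! 2} \<subseteq> nbrs z"
    using is_path_nth_adj[OF path, of 1] length_r m_ge_3 adj_leaf adj_sym
    by (simp add: numeral_2_eq_2)
  moreover have "card {w, r ! 2} = 2"
    using is_path_nth_eq_iff[OF path, of 2 0] r0 length_r m_ge_3 by simp
  ultimately show "nbrs z = {w, r ! 2}"
    using \<open>card (nbrs z) \<le> 2\<close> by (intro card_seteq[symmetric]) auto
qed

lemma r_tail_chord:
  obtains i where "2 \<le> i" "i + 2 < m" "adj (last r) (r ! i)"
proof -
  have path: "is_path r" and length_r: "length r = m" and nonempty: "r \<noteq> []"
    using longestD[OF longest_r] by auto
  have nth: "r ! 0 = w" "r ! 1 = z" "last r = r ! (m - 1)"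
    using hd_r hd_conv_nth[OF nonempty] last_conv_nth[OF nonempty] length_r
      is_path_nth_adj[OF path, of 0] m_ge_3 adj_leafD adj_sym by auto
  have "last r \<in> V - {w}"
    using is_path_nth_in_V[OF path] is_path_nth_eq_iff[OF path, of "m - 1" 0] nth length_r m_ge_3
    by simp
  then have "2 \<le> card (tail_chords r)"
    using card_tail_chords[OF longest_r] deg_ge_if_neq_leaf[of "last r"] k_eq_2 by simp
  then have "\<not> tail_chords r \<subseteq> {m - 2}" using card_mono[of "{m - 2}" "tail_chords r"] by auto
  then obtain i where tail_i: "Suc i < m" "adj (last r) (r ! i)" "i \<noteq> m - 2"
    using length_r by (auto simp: tail_chords_def)
  have "i \<noteq> 0"
  proof
    assume "i = 0"
    then have "r ! (m - 1) = r ! 1" using tail_i nth adj_leafD by simp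
    then show False using is_path_nth_eq_iff[OF path, of "m - 1" 1] length_r m_ge_3 by simp
  qed
  moreover have "i \<noteq> 1"
  proof
    assume "i = 1"
    then have "last r \<in> nbrs z" using tail_i(2) nth adj_sym by simp
    then have "r ! (m - 1) = r ! 0 \<or> r ! (m - 1) = r ! 2" using nbrs_z nth by auto
    then have "m = 3"
      using is_path_nth_eq_iff[OF path, of "m - 1"] length_r m_ge_3 by auto
    then show False using tail_i \<open>i = 1\<close> by simp
  qed
  ultimately have "2 \<le> i" "i + 2 < m" using tail_i by linarith+
  then show thesis using that tail_i(2) by blast
qed

lemma extremal_if_order_5:
  assumes r_eq: "r = [w, z, c, b, a]" and edge_ac: "adj a c"
  shows extremal
proof -
  have distinct_r: "distinct [w, z, c, b, a]" and r_in_V: "{w, z, c, b, a} \<subseteq> V"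
    using longestD(4,5)[OF longest_r] r_eq by simp_all
  have m_eq: "m = 5" using longestD(2)[OF longest_r] r_eq by simp
  have "\<not> adj x w" "\<not> adj x z" if "x \<in> {a, b}" for x
    using that adj_leafD nbrs_z adj_commute[of x] r_eq distinct_r mem_nbrs[of x z] by auto
  then have "separates c {a, b}"
    using separates_triangle_at_end[of "[w, z]" c b a] longest_r r_eq edge_ac by auto
  moreover have "length q \<le> k" if path_q: "is_path (c # q)" "set q \<inter> {a, b} = {}" for q
  proof -
    have "longest (rev r)" using longest_r by simp
    then have "longest [a, b, c, z, w]" unfolding r_eq by (simp only: rev.simps append.simps)
    then have "2 + Suc (length q) \<le> m" by (rule prefix_bound) (use path_q m_eq in auto)
    then show ?thesis using m_eq k_eq_2 by simp
  qed
  ultimately have "small_components_but_one k"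
    using r_in_V distinct_r k_eq_2
    by (intro small_components_but_oneI[of c "{a, b}"]) (auto simp: card_insert_if)
  then show ?thesis by (rule extremalI(3))
qed

lemma extremal_if_order_6:
  assumes r_eq: "r = [w, z, d, c, b, a]" and chord: "adj a c \<or> adj a d"
  shows extremal
proof -
  have distinct_r: "distinct [w, z, d, c, b, a]" and r_in_V: "{w, z, d, c, b, a} \<subseteq> V"
    using longestD(4,5)[OF longest_r] r_eq by simp_all
  have edges: "adj d c" "adj c b" "adj b a" "adj w z"
    using longestD(1)[OF longest_r] r_eq by (auto simp: is_path_def)
  have m_eq: "m = 6" using longestD(2)[OF longest_r] r_eq by simp
  have four_cycle: extremal if "is_cycle [s, t, c, d]" "{s, t} = {a, b}" for s t
    using that edges(4) distinct_r m_eq k_eq_2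
    by (intro extremal_if_cycle_misses_edge[OF that(1) _ _ edges(4)]) auto
  consider (from_a) "adj a d" | (from_b) "adj a c" "adj b d"
    | (none_to_d) "adj a c" "\<not> adj a d" "\<not> adj b d"
    using chord by blast
  then show ?thesis
  proof cases
    case from_a
    then have "is_cycle [a, b, c, d]"
      using edges distinct_r r_in_V adj_sym by (auto simp: is_cycle_def is_path_def)
    then show ?thesis by (rule four_cycle) simp
  next
    case from_b
    then have "is_cycle [b, a, c, d]"
      using edges distinct_r r_in_V adj_sym by (auto simp: is_cycle_def is_path_def)
    then show ?thesis by (rule four_cycle) auto
  next
    case none_to_d
    have "\<not> adj x w" "\<not> adj x z" if "x \<in> {a, b}" for x
      using that adj_leafD nbrs_z adj_commute[of x] r_eq distinct_r mem_nbrs[of x z] by auto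
    then have "separates c {a, b}"
      using separates_triangle_at_end[of "[w, z, d]" c b a] longest_r r_eq none_to_d by auto
    moreover have "separates d {w, z}"
      using leaf nbrs_z r_eq by (auto simp: separates_def)
    ultimately interpret linked_path V adj k "[w, z]" "[b, a]" d c
      using longestD(1)[OF longest_r] r_eq k_eq_2 m_eq bounded
      by unfold_locales (simp_all add: insert_commute)
    show ?thesis using extremalI(4) linked_small_components_holds by blast
  qed
qed

lemma extremal_if_del_deg_small: extremal
proof -
  obtain i where chord: "2 \<le> i" "i + 2 < m" "adj (last r) (r ! i)" by (rule r_tail_chord)
  have length_r: "length r = m" by (rule longestD(2)[OF longest_r])
  then obtain xs where r_xs: "r = [w, z] @ xs"
    using r_eq tl_r(3) m_ge_3 by (cases r; cases "tl r") auto
  consider (order_5) "m = 5" "i = 2" | (order_6) "m = 6" "i = 2 \<or> i = 3"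
    using chord m_le k_eq_2 by linarith
  then show ?thesis
  proof cases
    case order_5
    then obtain c b a where "xs = [c, b, a]"
      using length_r r_xs by (auto simp: length_Suc_conv numeral_eq_Suc)
    then show ?thesis using extremal_if_order_5[of c b a] r_xs chord(3) order_5 by simp
  next
    case order_6
    then obtain d c b a where "xs = [d, c, b, a]"
      using length_r r_xs by (auto simp: length_Suc_conv numeral_eq_Suc)
    then show ?thesis using extremal_if_order_6[of d c b a] r_xs chord(3) order_6 by auto
  qed
qed

end

theorem extremal_if_longest_path_from_leaf: extremal
  using extremal_if_del_has_cycle extremal_if_del_has_no_cycle extremal_if_del_deg_small
  by (meson not_le)

end

context longest_path_graph begin

lemma extremal_if_no_regular_longest:
  assumes longest_p: "longest p" and irregular: no_regular_longest and m_le: "m \<le> 2 * k + 2"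
  shows extremal
proof -
  obtain r where r_leaf: "longest r" "deg (hd r) < k" "nbrs (hd r) = {r ! 1}"
    using ex_longest_ending_in_leaf[OF longest_p irregular] .
  interpret longest_path_from_leaf V adj k m "hd r" "r ! 1" r
    using r_leaf irregular m_le by unfold_locales simp_all
  show ?thesis by (rule extremal_if_longest_path_from_leaf)
qed

theorem extremal_if_order_le:
  assumes "longest p" "m \<le> 2 * k + 2"
  shows extremal
proof (cases no_regular_longest)
  case True
  then show ?thesis using extremal_if_no_regular_longest assms by blast
next
  case False
  then obtain q where "longest q" "k \<le> deg (hd q)" "k \<le> deg (last q)"
    by (auto simp: no_regular_longest_def not_less)
  then show ?thesis using extremal_if_ends_regular assms(2) by blast
qed

end

section \<open>Graphs without long paths\<close>

context nearly_min_degree begin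

lemma ex_longest_path:
  assumes "V \<noteq> {}"
  obtains p where "is_path p" "paths_bounded (length p)"
proof -
  obtain v where "v \<in> V" using assms by blast
  then have "is_path [v]" by simp
  then obtain p where "is_path p" "\<And>q. is_path q \<Longrightarrow> length q \<le> length p"
    using ex_has_greatest_nat[of is_path "[v]" length "Suc (card V)"] length_path_le
    by (metis le_imp_less_Suc)
  then show thesis using that by (auto simp: paths_bounded_def)
qed

lemma longest_path_order_ge_3:
  assumes longest_p: "is_path p" "paths_bounded (length p)" and order: "length p < card V"
  shows "3 \<le> length p"
proof (rule ccontr)
  assume "\<not> 3 \<le> length p"
  moreover have nonempty: "p \<noteq> []" using longest_p(1) by auto
  ultimately consider a where "p = [a]" | a b where "p = [a, b]"
    by (cases p; cases "tl p"; cases "tl (tl p)") auto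
  then have ends: "set p = {hd p, last p}" by cases auto
  have "set p \<noteq> V" using card_set_path[OF longest_p(1)] order by auto
  then obtain x y where "x \<in> set p" "y \<in> V - set p" "adj x y"
    using connectedE[OF connected is_pathD(3)[OF longest_p(1)]] nonempty by auto
  then have "is_path (y # p) \<or> is_path (p @ [y])"
    using ends longest_p(1) is_path_Cons_iff[OF nonempty, of y] is_path_snoc_iff[OF nonempty, of y]
      adj_sym
    by auto
  then show False using paths_boundedD[OF longest_p(2)] by force
qed

theorem extremal_if_no_path:
  assumes "V \<noteq> {}" and no_path: "\<nexists>p. is_path p \<and> length p = min (card V) (2 * k + 3)"
  shows extremal
proof -
  obtain p where longest_p: "is_path p" "paths_bounded (length p)"
    by (rule ex_longest_path[OF assms(1)])
  define m where "m = length p"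
  have "0 < card V" using assms(1) finite_V by (simp add: card_gt_0_iff)
  then have "\<not> min (card V) (2 * k + 3) \<le> m"
    using exists_path_of_length[OF longest_p(1), of "min (card V) (2 * k + 3)"] no_path
    by (auto simp: m_def)
  then have order: "m < card V" and m_le: "m \<le> 2 * k + 2" by auto
  have m_ge_3: "3 \<le> m" using longest_path_order_ge_3[OF longest_p] order by (simp add: m_def)
  show ?thesis
  proof (cases "has_cycle (m - 1)")
    case True
    then obtain C where C_cycle: "is_cycle C" "length C = m - 1" by (auto simp: has_cycle_def)
    have "Suc (length C) = m" using C_cycle(2) m_ge_3 by simp
    then interpret cycle_missing_vertex V adj k C
      using C_cycle(1) longest_p(2)[folded m_def] order m_le by unfold_locales simp_all
    show ?thesis using covered_by_cycle extremalI(1,2) C_cycle(2) order m_ge_3 by auto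
  next
    case False
    interpret longest_path_graph V adj k m
      using longest_p(2) order m_ge_3 False by unfold_locales (simp_all add: m_def)
    have "longest p" unfolding longest_def using longest_p(1) m_def by blast
    then show ?thesis using m_le by (rule extremal_if_order_le)
  qed
qed

end

section \<open>Embeddings into the extremal graphs\<close>

definition glue :: "('a \<Rightarrow> 'b) \<Rightarrow> 'a set \<Rightarrow> ('a \<Rightarrow> 'c) \<Rightarrow> 'a \<Rightarrow> 'b + 'c" where
  "glue f X g x = (if x \<in> X then Inl (f x) else Inr (g x))"

lemma glue_in [simp]: "x \<in> X \<Longrightarrow> glue f X g x = Inl (f x)"
  and glue_notin [simp]: "x \<notin> X \<Longrightarrow> glue f X g x = Inr (g x)"
  by (simp_all add: glue_def)

lemma inj_on_glue:
  assumes "inj_on f X" "inj_on g Y" "X \<inter> Y = {}"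
  shows "inj_on (glue f X g) (X \<union> Y)"
  using assms by (auto simp: inj_on_def glue_def split: if_splits)

lemma arcs_graph_union:
  "(u, u') \<in> parcs G \<Longrightarrow> (Inl u, Inl u') \<in> parcs (graph_union G H)"
  "(v, v') \<in> parcs H \<Longrightarrow> (Inr v, Inr v') \<in> parcs (graph_union G H)"
  by (auto simp: graph_union_def)

lemma arcs_graph_join:
  "(u, u') \<in> parcs G \<Longrightarrow> (Inl u, Inl u') \<in> parcs (graph_join G H)"
  "(v, v') \<in> parcs H \<Longrightarrow> (Inr v, Inr v') \<in> parcs (graph_join G H)"
  "u \<in> pverts G \<Longrightarrow> v \<in> pverts H \<Longrightarrow> (Inl u, Inr v) \<in> parcs (graph_join G H)"
  "u \<in> pverts G \<Longrightarrow> v \<in> pverts H \<Longrightarrow> (Inr v, Inl u) \<in> parcs (graph_join G H)"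
  by (auto simp: graph_join_def graph_union_def)

lemma classes_into_grid:
  fixes l :: "'a \<Rightarrow> 'b"
  assumes "finite X" "\<And>x. x \<in> X \<Longrightarrow> card {y \<in> X. l y = l x} \<le> k"
  obtains t :: nat and g :: "'a \<Rightarrow> nat \<times> nat" where "t\<^sub>0 \<le> t" "inj_on g X" "g ` X \<subseteq> {..<t} \<times> {..<k}"
    "\<And>x y. l x = l y \<Longrightarrow> fst (g x) = fst (g y)"
proof -
  obtain h where bij_h: "bij_betw h (l ` X) {0..<card (l ` X)}"
    using ex_bij_betw_finite_nat[of "l ` X"] assms(1) by blast
  have "\<forall>c\<in>l ` X. \<exists>f. f ` {y \<in> X. l y = c} \<subseteq> {..<k} \<and> inj_on f {y \<in> X. l y = c}"
    using assms by (auto intro!: card_le_inj)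
  from bchoice[OF this] obtain f where
    inj_f: "\<forall>c\<in>l ` X. f c ` {y \<in> X. l y = c} \<subseteq> {..<k} \<and> inj_on (f c) {y \<in> X. l y = c}" ..
  define g where "g x = (h (l x), f (l x) x)" for x
  have "inj_on g X"
  proof (rule inj_onI)
    fix x y assume same_image: "x \<in> X" "y \<in> X" "g x = g y"
    then have "l x = l y" using bij_h by (auto simp: g_def bij_betw_def inj_on_def)
    then show "x = y" using bspec[OF inj_f, of "l x"] same_image by (auto simp: g_def inj_on_def)
  qed
  moreover have "g x \<in> {..<t\<^sub>0 + card (l ` X)} \<times> {..<k}" if "x \<in> X" for x
    using bij_betwE[OF bij_h] bspec[OF inj_f, of "l x"] that by (fastforce simp: g_def)
  ultimately show thesis by (intro that[of "t\<^sub>0 + card (l ` X)" g]) (auto simp: g_def)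
qed

lemma bij_betw_consecutive_blocks:
  assumes "finite V" "A \<subseteq> V" "U \<subseteq> V - A"
  obtains e where "bij_betw e V {..<card V}" "e ` A = {..<card A}"
    "e ` U = {card A..<card A + card U}"
proof -
  let ?a = "card A" and ?u = "card A + card U" and ?W = "V - (A \<union> U)"
  have finite_parts: "finite A" "finite U" "finite ?W"
    using assms by (auto intro: finite_subset[of _ V])
  have "card (A \<union> U) = ?u" using finite_parts assms(3) by (intro card_Un_disjoint) auto
  moreover have "A \<union> U \<subseteq> V" using assms by blast
  ultimately have u_le: "?u \<le> card V" and "card ?W = card {?u..<card V}"
    using card_mono[OF assms(1), of "A \<union> U"] card_Diff_subset[of "A \<union> U" V] finite_parts by simp_all
  then obtain f g h where bij_f: "bij_betw f A {..<?a}" and bij_g: "bij_betw g U {?a..<?u}"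
    and bij_h: "bij_betw h ?W {?u..<card V}"
    using finite_same_card_bij[OF finite_parts(1), of "{..<?a}"]
      finite_same_card_bij[OF finite_parts(2), of "{?a..<?u}"]
      finite_same_card_bij[OF finite_parts(3), of "{?u..<card V}"] by auto
  define gh where "gh = (\<lambda>x. if x \<in> U then g x else h x)"
  define e where "e = (\<lambda>x. if x \<in> A then f x else gh x)"
  have "bij_betw gh (U \<union> ?W) ({?a..<?u} \<union> {?u..<card V})"
    unfolding gh_def by (intro bij_betw_disjoint_Un[OF bij_g bij_h]) auto
  then have "bij_betw e (A \<union> (U \<union> ?W)) ({..<?a} \<union> ({?a..<?u} \<union> {?u..<card V}))"
    unfolding e_def using assms(3) by (intro bij_betw_disjoint_Un[OF bij_f]) auto
  moreover have "A \<union> (U \<union> ?W) = V" using assms by blast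
  moreover have "{..<?a} \<union> ({?a..<?u} \<union> {?u..<card V}) = {..<card V}" using u_le by auto
  ultimately have "bij_betw e V {..<card V}" by simp
  moreover have "e ` A = {..<?a}" using bij_f by (simp add: e_def bij_betw_def)
  moreover have "e ` U = g ` U" using assms(3) by (intro image_cong) (auto simp: e_def gh_def)
  then have "e ` U = {?a..<?u}" using bij_g by (simp add: bij_betw_def)
  ultimately show thesis by (rule that)
qed

context simple_graph begin

definition embedding :: "('a \<Rightarrow> 'b) \<Rightarrow> 'a set \<Rightarrow> 'b pair_pre_digraph \<Rightarrow> bool" where
  "embedding f X H \<longleftrightarrow> inj_on f X \<and> f ` X \<subseteq> pverts H \<and>
     (\<forall>x\<in>X. \<forall>y\<in>X. adj x y \<longrightarrow> (f x, f y) \<in> parcs H)"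

lemma embeddingI:
  "inj_on f X \<Longrightarrow> f ` X \<subseteq> pverts H \<Longrightarrow>
    (\<And>x y. x \<in> X \<Longrightarrow> y \<in> X \<Longrightarrow> adj x y \<Longrightarrow> (f x, f y) \<in> parcs H) \<Longrightarrow> embedding f X H"
  by (simp add: embedding_def)

lemma embeddingD:
  assumes "embedding f X H"
  shows "inj_on f X" "x \<in> X \<Longrightarrow> f x \<in> pverts H"
    "x \<in> X \<Longrightarrow> y \<in> X \<Longrightarrow> adj x y \<Longrightarrow> (f x, f y) \<in> parcs H"
  using assms by (auto simp: embedding_def)

lemma embedding_Inl:
  "embedding f X H \<Longrightarrow> embedding (Inl \<circ> f) X (graph_union H K)"
  unfolding embedding_def by (auto simp: inj_on_def graph_union_def)

lemma embedding_union:
  assumes f: "embedding f X H" and g: "embedding g Y K" and disjoint: "X \<inter> Y = {}"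
    and no_edge: "\<And>x y. x \<in> X \<Longrightarrow> y \<in> Y \<Longrightarrow> \<not> adj x y"
  shows "embedding (glue f X g) (X \<union> Y) (graph_union H K)"
proof (rule embeddingI)
  show "inj_on (glue f X g) (X \<union> Y)"
    using embeddingD(1)[OF f] embeddingD(1)[OF g] disjoint by (rule inj_on_glue)
  have notin: "y \<notin> X" if "y \<in> Y" for y using that disjoint by blast
  show "glue f X g ` (X \<union> Y) \<subseteq> pverts (graph_union H K)"
    using embeddingD(2)[OF f] embeddingD(2)[OF g] notin by (auto simp: graph_union_def)
  fix x y assume "x \<in> X \<union> Y" "y \<in> X \<union> Y" "adj x y"
  then consider "x \<in> X" "y \<in> X" | "x \<in> Y" "y \<in> Y" using no_edge adj_sym by blast
  then show "(glue f X g x, glue f X g y) \<in> parcs (graph_union H K)"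
    using embeddingD(3)[OF f] embeddingD(3)[OF g] \<open>adj x y\<close> notin
    by cases (simp_all add: arcs_graph_union)
qed

lemma embedding_join:
  assumes f: "embedding f X H" and g: "embedding g Y K" and disjoint: "X \<inter> Y = {}"
  shows "embedding (glue f X g) (X \<union> Y) (graph_join H K)"
proof (rule embeddingI)
  show "inj_on (glue f X g) (X \<union> Y)"
    using embeddingD(1)[OF f] embeddingD(1)[OF g] disjoint by (rule inj_on_glue)
  have notin: "y \<notin> X" if "y \<in> Y" for y using that disjoint by blast
  show "glue f X g ` (X \<union> Y) \<subseteq> pverts (graph_join H K)"
    using embeddingD(2)[OF f] embeddingD(2)[OF g] notin
    by (auto simp: graph_join_def graph_union_def)
  fix x y assume "x \<in> X \<union> Y" "y \<in> X \<union> Y" "adj x y"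
  then consider "x \<in> X" "y \<in> X" | "x \<in> Y" "y \<in> Y" | "x \<in> X" "y \<in> Y" | "x \<in> Y" "y \<in> X" by blast
  then show "(glue f X g x, glue f X g y) \<in> parcs (graph_join H K)"
    using embeddingD(2,3)[OF f] embeddingD(2,3)[OF g] \<open>adj x y\<close> notin
    by cases (simp_all add: arcs_graph_join)
qed

lemma embedding_cone:
  assumes "embedding f X H" "c \<notin> X"
  shows "embedding (glue (\<lambda>_. 0) {c} f) (insert c X) (graph_join (complete_graph 1) H)"
proof -
  have "embedding (\<lambda>_. 0) {c} (complete_graph 1)"
    using adj_irrefl by (auto simp: embedding_def complete_graph_def)
  then show ?thesis using embedding_join[OF _ assms(1)] assms(2) by fastforce
qed

lemma embedding_linked_union:
  assumes f: "embedding f X H" and g: "embedding g Y K" and disjoint: "X \<inter> Y = {}"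
    and centers: "a \<in> X" "b \<in> Y"
    and only_edge: "\<And>x y. x \<in> X \<Longrightarrow> y \<in> Y \<Longrightarrow> adj x y \<Longrightarrow> x = a \<and> y = b"
  shows "embedding (glue f X g) (X \<union> Y) (add_edge (Inl (f a)) (Inr (g b)) (graph_union H K))"
proof (rule embeddingI)
  show "inj_on (glue f X g) (X \<union> Y)"
    using embeddingD(1)[OF f] embeddingD(1)[OF g] disjoint by (rule inj_on_glue)
  have notin: "y \<notin> X" if "y \<in> Y" for y using that disjoint by blast
  show "glue f X g ` (X \<union> Y) \<subseteq> pverts (add_edge (Inl (f a)) (Inr (g b)) (graph_union H K))"
    using embeddingD(2)[OF f] embeddingD(2)[OF g] notin by (auto simp: graph_union_def add_edge_def)
  fix x y assume "x \<in> X \<union> Y" "y \<in> X \<union> Y" "adj x y"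
  then consider "x \<in> X" "y \<in> X" | "x \<in> Y" "y \<in> Y" | "x = a" "y = b" | "x = b" "y = a"
    using only_edge adj_sym by blast
  then show "(glue f X g x, glue f X g y)
      \<in> parcs (add_edge (Inl (f a)) (Inr (g b)) (graph_union H K))"
    using embeddingD(3)[OF f] embeddingD(3)[OF g] \<open>adj x y\<close> notin centers
    by cases (simp_all add: arcs_graph_union add_edge_def)
qed

lemma embedding_complete:
  assumes "finite X" "card X \<le> m"
  obtains f where "embedding f X (complete_graph m)"
proof -
  obtain f where inj_f: "f ` X \<subseteq> {..<m}" "inj_on f X"
    using card_le_inj[of X "{..<m}"] assms by auto
  have "embedding f X (complete_graph m)"
    using inj_f inj_onD[OF inj_f(2)] adj_irrefl
    by (fastforce simp: embedding_def complete_graph_def)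
  then show thesis by (rule that)
qed

lemma embedding_star:
  assumes "finite X" "a \<in> X" and center: "\<And>x y. x \<in> X \<Longrightarrow> y \<in> X \<Longrightarrow> adj x y \<Longrightarrow> x = a \<or> y = a"
  obtains f where "embedding f X (star_graph (card X))"
proof -
  have "card (X - {a}) = card {1..<card X}" using assms(1,2) by (simp add: card_Diff_singleton)
  then obtain g where "bij_betw g (X - {a}) {1..<card X}"
    using assms(1) finite_same_card_bij[of "X - {a}" "{1..<card X}"] by auto
  then have inj_g: "inj_on g (X - {a})" "\<And>x. x \<in> X - {a} \<Longrightarrow> g x \<in> {1..<card X}"
    by (auto simp: bij_betw_def)
  have pos: "0 < card X" using assms(1,2) card_gt_0_iff by blast
  define f where "f x = (if x = a then 0 else g x)" for x
  have "embedding f X (star_graph (card X))"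
  proof (rule embeddingI)
    show "inj_on f X"
      using inj_g inj_onD[OF inj_g(1)] by (fastforce simp: inj_on_def f_def)
    show "f ` X \<subseteq> pverts (star_graph (card X))"
      using inj_g(2) pos by (auto simp: f_def star_graph_def)
    fix x y assume "x \<in> X" "y \<in> X" "adj x y"
    then have "x = a \<and> y \<in> X - {a} \<or> y = a \<and> x \<in> X - {a}" using center adj_neq by blast
    then show "(f x, f y) \<in> parcs (star_graph (card X))"
      using inj_g(2) by (auto simp: f_def star_graph_def)
  qed
  then show thesis by (rule that)
qed

lemma embedding_copies:
  fixes l :: "'a \<Rightarrow> 'b"
  assumes "finite X" "\<And>x. x \<in> X \<Longrightarrow> card {y \<in> X. l y = l x} \<le> k"
    and edge: "\<And>x y. x \<in> X \<Longrightarrow> y \<in> X \<Longrightarrow> adj x y \<Longrightarrow> l x = l y"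
  obtains t f where "t\<^sub>0 \<le> t" "embedding f X (copies t (complete_graph k))"
proof -
  obtain t and g :: "'a \<Rightarrow> nat \<times> nat" where t_ge: "t\<^sub>0 \<le> t" and inj_g: "inj_on g X"
    and range_g: "g ` X \<subseteq> {..<t} \<times> {..<k}" and same_row: "\<And>x y. l x = l y \<Longrightarrow> fst (g x) = fst (g y)"
    using classes_into_grid[OF assms(1,2)] by blast
  have "embedding g X (copies t (complete_graph k))"
  proof (rule embeddingI[OF inj_g])
    show "g ` X \<subseteq> pverts (copies t (complete_graph k))"
      using range_g by (simp add: copies_def complete_graph_def lessThan_def)
    fix x y assume edge_xy: "x \<in> X" "y \<in> X" "adj x y"
    have "fst (g x) = fst (g y)" using same_row[OF edge[OF edge_xy]] .
    moreover have "g x \<noteq> g y" using inj_onD[OF inj_g _ edge_xy(1,2)] adj_neq[OF edge_xy(3)] by blast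
    moreover have "g x \<in> {..<t} \<times> {..<k}" "g y \<in> {..<t} \<times> {..<k}"
      using range_g edge_xy(1,2) by blast+
    ultimately show "(g x, g y) \<in> parcs (copies t (complete_graph k))"
      by (cases "g x"; cases "g y") (auto simp: copies_def complete_graph_def)
  qed
  then show thesis using that t_ge by blast
qed

lemma embedding_small_components:
  assumes "X \<subseteq> V - Z" "\<And>x. x \<in> X \<Longrightarrow> card (component Z x) \<le> k"
  obtains t f where "t\<^sub>0 \<le> t" "embedding f X (copies t (complete_graph k))"
proof (rule embedding_copies)
  show "finite X" using assms(1) finite_V finite_subset by blast
  show "card {y \<in> X. component Z y = component Z x} \<le> k" if "x \<in> X" for x
  proof -
    have "{y \<in> X. component Z y = component Z x} \<subseteq> component Z x" using component_refl by blast
    then have "card {y \<in> X. component Z y = component Z x} \<le> card (component Z x)"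
      using finite_component assms(1) that by (intro card_mono) auto
    then show ?thesis using assms(2)[OF that] by linarith
  qed
  show "component Z x = component Z y" if "x \<in> X" "y \<in> X" "adj x y" for x y
    using component_adj that assms(1) by blast
qed (use that in blast)

lemma embedding_matching_if_copies:
  assumes "embedding f X (copies t (complete_graph 2))"
  shows "embedding ((\<lambda>(i, j). 2 * i + j) \<circ> f) X (matching_graph (2 * t))"
proof (rule embeddingI)
  let ?pos = "\<lambda>(i, j). 2 * i + j"
  have row: "\<exists>i j. f x = (i, j) \<and> i < t \<and> j < 2" if "x \<in> X" for x
    using embeddingD(2)[OF assms that] by (auto simp: copies_def complete_graph_def)
  show "inj_on (?pos \<circ> f) X"
  proof (rule comp_inj_on[OF embeddingD(1)[OF assms]], rule inj_onI)
    fix a b assume "a \<in> f ` X" "b \<in> f ` X" and same_pos: "?pos a = ?pos b"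
    then obtain i j i' j' where "a = (i, j)" "b = (i', j')" "j < 2" "j' < 2" using row by blast
    then show "a = b" using same_pos by simp presburger
  qed
  show "(?pos \<circ> f) ` X \<subseteq> pverts (matching_graph (2 * t))"
    using row by (fastforce simp: matching_graph_def)
  fix x y assume "x \<in> X" "y \<in> X" "adj x y"
  then obtain i j j' where "f x = (i, j)" "f y = (i, j')" "i < t" "j < 2" "j' < 2" "j \<noteq> j'"
    using embeddingD(3)[OF assms] row by (fastforce simp: copies_def complete_graph_def)
  then show "((?pos \<circ> f) x, (?pos \<circ> f) y) \<in> parcs (matching_graph (2 * t))"
    by (auto simp: matching_graph_def)
qed

lemma embedding_matching:
  assumes "M \<subseteq> V" and matching: "induces_matching M"
  obtains t f where "t\<^sub>0 \<le> t" "embedding f M (matching_graph t)"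
proof -
  define block where "block x = insert x (nbrs x \<inter> M)" for x
  have "finite M" using assms(1) finite_V finite_subset by blast
  have block_edge: "block x = {x, y}" if edge_xy: "x \<in> M" "y \<in> M" "adj x y" for x y
  proof -
    have "z = y" if "adj x z" "z \<in> M" for z
      by (rule induces_matchingD[OF matching that(1) edge_xy(3,1) that(2) edge_xy(2)])
    then show ?thesis using edge_xy unfolding block_def nbrs_def by blast
  qed
  have "card {y \<in> M. block y = block x} \<le> 2" if x_in: "x \<in> M" for x
  proof -
    obtain y where "block x \<subseteq> {x, y}"
    proof (cases "nbrs x \<inter> M = {}")
      case False
      then obtain y where "y \<in> M" "adj x y" by auto
      then show thesis using that[of y] block_edge[OF x_in] by blast
    qed (use that[of x] in \<open>auto simp: block_def\<close>)
    then have "{y \<in> M. block y = block x} \<subseteq> {x, y}" by (auto simp: block_def)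
    then have "card {y \<in> M. block y = block x} \<le> card {x, y}" by (intro card_mono) auto
    also have "\<dots> \<le> 2" by (simp add: card_insert_if)
    finally show ?thesis .
  qed
  moreover have "block x = block y" if "x \<in> M" "y \<in> M" "adj x y" for x y
    using block_edge[OF that] block_edge[of y x] that adj_sym by auto
  ultimately obtain t f where t_ge: "t\<^sub>0 \<le> t" and "embedding f M (copies t (complete_graph 2))"
    using embedding_copies[OF \<open>finite M\<close>] by blast
  from embedding_matching_if_copies[OF this(2)] show thesis using that[of "2 * t"] t_ge by simp
qed

lemma embedding_H_graph:
  assumes "covered_except k d"
  obtains f where "embedding f V (H_graph (card V) (2 * k + d) k)" "k + d \<le> card V"
proof -
  obtain A U where A_subset: "A \<subseteq> V" "card A = k" and U_subset: "U \<subseteq> V - A" "card U = d"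
    and covers: "\<And>x y. adj x y \<Longrightarrow> x \<in> A \<or> y \<in> A \<or> x \<in> U \<and> y \<in> U"
    using assms unfolding covered_except_def by blast
  obtain e where bij_e: "bij_betw e V {..<card V}"
    and image_e: "e ` A = {..<k}" "e ` U = {k..<k + d}"
    using bij_betw_consecutive_blocks[OF finite_V A_subset(1) U_subset(1)] A_subset(2) U_subset(2)
    by metis
  have "card (A \<union> U) \<le> card V" using finite_V A_subset(1) U_subset(1) by (intro card_mono) auto
  moreover have "finite A" "finite U"
    using A_subset(1) U_subset(1) finite_V by (auto intro: finite_subset[of _ V])
  ultimately have order: "k + d \<le> card V"
    using A_subset(2) U_subset by (subst (asm) card_Un_disjoint) auto
  have "embedding e V (H_graph (card V) (2 * k + d) k)"
  proof (rule embeddingI)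
    show "inj_on e V" "e ` V \<subseteq> pverts (H_graph (card V) (2 * k + d) k)"
      using bij_e order by (auto simp: bij_betw_def pverts_H_graph)
    fix x y assume "x \<in> V" "y \<in> V" "adj x y"
    then have "e x < card V" "e y < card V" "e x \<noteq> e y"
      using bij_e adj_neq by (auto simp: bij_betw_def inj_on_def)
    moreover have "e x < k \<or> e y < k \<or> e x \<in> {k..<k + d} \<and> e y \<in> {k..<k + d}"
      using covers[OF \<open>adj x y\<close>] unfolding image_e[symmetric] lessThan_iff[symmetric] by blast
    ultimately show "(e x, e y) \<in> parcs (H_graph (card V) (2 * k + d) k)"
      by (auto simp: H_graph_def Let_def)
  qed
  then show thesis using that order by blast
qed

end

locale graph_of_pair_graph =
  fixes G :: "'a pair_pre_digraph"
  assumes pair_graph_G: "pair_graph G"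

sublocale graph_of_pair_graph \<subseteq> simple_graph "pverts G" "\<lambda>u v. (u, v) \<in> parcs G"
  using pair_graphD'[OF pair_graph_G] by unfold_locales auto

context graph_of_pair_graph begin

abbreviation adj :: "'a \<Rightarrow> 'a \<Rightarrow> bool" where "adj u v \<equiv> (u, v) \<in> parcs G"
abbreviation V :: "'a set" where "V \<equiv> pverts G"

lemma is_subgraph_of_if_embedding:
  assumes "embedding f V H" "pair_graph H"
  shows "is_subgraph_of G H"
proof -
  interpret G: pair_graph G by (rule pair_graph_G)
  interpret H: pair_graph H by (rule assms(2))
  have "pair_wf_digraph G" "pair_wf_digraph H" by unfold_locales
  moreover have "inj_on f V" "f ` V \<subseteq> pverts H" "\<forall>u v. adj u v \<longrightarrow> (f u, f v) \<in> parcs H"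
    using assms(1) adj_V by (auto simp: embedding_def)
  ultimately show ?thesis using is_subgraph_of_iff by blast
qed

lemma out_degree_eq_deg: "out_degree (with_proj G) v = deg v"
proof -
  have "out_arcs (with_proj G) v = Pair v ` nbrs v"
    by (auto simp: out_arcs_def nbrs_def)
  then show ?thesis by (simp add: out_degree_def card_image inj_on_def)
qed

lemma is_path_iff_vpath: "is_path p \<longleftrightarrow> vpath p (with_proj G)"
proof -
  have "set (vwalk_arcs p) \<subseteq> parcs G \<longleftrightarrow> successively adj p" for p
    by (induction p rule: vwalk_arcs.induct) auto
  then show ?thesis by (auto simp: is_path_def vpath_def vwalk_def arcs_ends_conv)
qed

lemma is_connected_if_connected:
  assumes "connected (with_proj G)"
  shows "is_connected" "V \<noteq> {}"
proof -
  have mk: "pverts (mk_symmetric (with_proj G)) = V" "parcs (mk_symmetric (with_proj G)) = parcs G"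
    using adj_sym by (auto simp: mk_symmetric_def)
  have reach: "(u, v) \<in> rtrancl_on V (parcs G)" if "u \<in> V" "v \<in> V" for u v
    using assms that mk unfolding connected_def strongly_connected_def reachable_def
    by (simp add: arcs_ends_conv)
  show "V \<noteq> {}" using assms mk unfolding connected_def strongly_connected_def by simp
  show is_connected
    unfolding is_connected_def
  proof (intro allI impI, rule ccontr)
    fix S assume S_proper: "S \<subseteq> V" "S \<noteq> {}" "S \<noteq> V" and closed: "\<not> (\<exists>x\<in>S. \<exists>y\<in>V - S. adj x y)"
    obtain u v where separated: "u \<in> S" "v \<in> V - S" using S_proper by blast
    have "(u, v) \<in> rtrancl_on V (parcs G)" using reach separated S_proper by blast
    then have "v \<in> S" using separated(1) by induction (use closed in blast)+
    then show False using separated by blast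
  qed
qed

lemma subgraph_H_graph:
  assumes "covered_except k d"
  shows "is_subgraph_of G (H_graph (card V) (2 * k + d) k)"
proof -
  obtain f where "embedding f V (H_graph (card V) (2 * k + d) k)" "k + d \<le> card V"
    by (rule embedding_H_graph[OF assms])
  then show ?thesis by (intro is_subgraph_of_if_embedding pair_graph_H_graph) simp_all
qed

lemma subgraph_of_cut_vertex_graph:
  assumes "small_components_but_one k"
  shows "\<exists>t\<ge>1. is_subgraph_of G (graph_join (complete_graph 1)
          (graph_union (copies t (complete_graph k))
            (graph_union (complete_graph (k + 1)) (complete_graph 1))))"
proof -
  obtain c D where c_in: "c \<in> V" and D: "D \<subseteq> V - {c}" "card D \<le> k + 1" "separates c D"
    and small: "\<And>x. x \<in> V - {c} - D \<Longrightarrow> card (component {c} x) \<le> k"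
    using assms unfolding small_components_but_one_def by blast
  obtain t f where t_ge: "1 \<le> t"
    and embedding_f: "embedding f (V - {c} - D) (copies t (complete_graph k))"
    by (rule embedding_small_components[OF Diff_subset small])
  have "finite D" using D(1) finite_V by (auto intro: finite_subset)
  then obtain g where "embedding g D (complete_graph (k + 1))"
    by (rule embedding_complete[OF _ D(2)])
  note embedding_g = embedding_Inl[OF this, of "complete_graph 1"]
  have "\<not> adj x y" if "x \<in> V - {c} - D" "y \<in> D" for x y
    using separatesD[OF D(3) that(2) adj_sym] that(1) by blast
  then have "embedding (glue f (V - {c} - D) (Inl \<circ> g)) (V - {c} - D \<union> D)
      (graph_union (copies t (complete_graph k))
        (graph_union (complete_graph (k + 1)) (complete_graph 1)))"
    by (intro embedding_union[OF embedding_f embedding_g]) auto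
  note embedding_cone_c = embedding_cone[OF this, of c]
  have "insert c (V - {c} - D \<union> D) = V" using c_in D(1) by blast
  then have "is_subgraph_of G (graph_join (complete_graph 1)
      (graph_union (copies t (complete_graph k))
        (graph_union (complete_graph (k + 1)) (complete_graph 1))))"
    using embedding_cone_c D(1)
    by (intro is_subgraph_of_if_embedding pair_graph_graph_join pair_graph_graph_union
        pair_graph_copies pair_graph_complete_graph) auto
  then show ?thesis using t_ge by blast
qed

lemma subgraph_of_linked_graph:
  assumes "linked_small_components k"
  shows "\<exists>s\<ge>1. \<exists>t\<ge>1. is_subgraph_of G (linked_graph k s t)"
proof -
  obtain c X c' Y where union: "insert c X \<union> insert c' Y = V"
    and disjoint: "insert c X \<inter> insert c' Y = {}" and center: "c \<notin> X" "c' \<notin> Y"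
    and small: "\<forall>x\<in>X \<union> Y. card (component {c, c'} x) \<le> k"
    and only_edge: "\<forall>x\<in>insert c X. \<forall>y\<in>insert c' Y. adj x y \<longrightarrow> x = c \<and> y = c'"
    using linked_small_components_split[OF assms] .
  have parts: "X \<subseteq> V - {c, c'}" "Y \<subseteq> V - {c, c'}" using union disjoint center by auto
  obtain s f where s_ge: "1 \<le> s" and embedding_f: "embedding f X (copies s (complete_graph k))"
    by (rule embedding_small_components[OF parts(1)]) (use small in blast)
  obtain t g where t_ge: "1 \<le> t" and embedding_g: "embedding g Y (copies t (complete_graph k))"
    by (rule embedding_small_components[OF parts(2)]) (use small in blast)
  note cones = embedding_cone[OF embedding_f center(1)]
    embedding_cone[OF embedding_Inl[OF embedding_g, of "complete_graph 1"] center(2)]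
  have "x = c \<and> y = c'" if "x \<in> insert c X" "y \<in> insert c' Y" "adj x y" for x y
    using only_edge that by blast
  from embedding_linked_union[OF cones disjoint insertI1 insertI1 this]
  obtain e where "embedding e (insert c X \<union> insert c' Y) (linked_graph k s t)"
    by (auto simp: linked_graph_def)
  then have "is_subgraph_of G (linked_graph k s t)"
    using union by (intro is_subgraph_of_if_embedding pair_graph_linked_graph) auto
  then show ?thesis using s_ge t_ge by blast
qed

lemma subgraph_of_hub_star_matching:
  assumes hub_star_matching
  shows "\<exists>s t. s \<ge> 1 \<and> s + t \<ge> 6 \<and> is_subgraph_of G
    (graph_join (complete_graph 1) (graph_union (star_graph s) (matching_graph t)))"
proof -
  obtain c S a where c_in: "c \<in> V" and S: "S \<subseteq> V - {c}" "a \<in> S" "separates c S"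
    and star: "\<forall>x\<in>S - {a}. nbrs x \<subseteq> {a, c}" and matching: "induces_matching (V - {c} - S)"
    using assms unfolding hub_star_matching_def by blast
  have finite_S: "finite S" using S(1) finite_V by (auto intro: finite_subset)
  have "x = a \<or> y = a" if "x \<in> S" "y \<in> S" "adj x y" for x y
  proof (rule disjCI)
    assume "y \<noteq> a"
    show "x = a"
    proof (rule ccontr)
      assume "x \<noteq> a"
      then have "nbrs x \<subseteq> {a, c}" using star that(1) by simp
      then show False using nbrs_subsetD[OF _ that(3)] \<open>y \<noteq> a\<close> that(2) S(1) by auto
    qed
  qed
  then obtain f where embedding_f: "embedding f S (star_graph (card S))"
    using embedding_star[OF finite_S S(2)] by blast
  obtain t g where t_ge: "6 \<le> t" and embedding_g: "embedding g (V - {c} - S) (matching_graph t)"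
    by (rule embedding_matching[OF _ matching]) blast
  have "\<not> adj x y" if "x \<in> S" "y \<in> V - {c} - S" for x y
    using separatesD[OF S(3) that(1)] that(2) by blast
  then have "embedding (glue f S g) (S \<union> (V - {c} - S))
      (graph_union (star_graph (card S)) (matching_graph t))"
    by (intro embedding_union[OF embedding_f embedding_g]) auto
  note embedding_cone_c = embedding_cone[OF this, of c]
  have "insert c (S \<union> (V - {c} - S)) = V" using c_in S(1) by blast
  then have "is_subgraph_of G
      (graph_join (complete_graph 1) (graph_union (star_graph (card S)) (matching_graph t)))"
    using embedding_cone_c S(1)
    by (intro is_subgraph_of_if_embedding pair_graph_graph_join pair_graph_graph_union
        pair_graph_complete_graph pair_graph_star_graph pair_graph_matching_graph) auto
  moreover have "1 \<le> card S" using finite_S S(2) card_gt_0_iff[of S] by fastforce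
  ultimately show ?thesis using t_ge by (meson trans_le_add2)
qed

lemma subgraph_of_two_hubs_matching:
  assumes two_hubs_matching
  shows "\<exists>t\<ge>7. is_subgraph_of G (graph_join (complete_graph 2) (matching_graph t))"
proof -
  obtain c d where centers: "c \<in> V" "d \<in> V" "c \<noteq> d" and matching: "induces_matching (V - {c, d})"
    using assms unfolding two_hubs_matching_def by blast
  obtain f where embedding_f: "embedding f {c, d} (complete_graph 2)"
    by (rule embedding_complete[of "{c, d}" 2]) (use centers in auto)
  obtain t g where t_ge: "7 \<le> t" and embedding_g: "embedding g (V - {c, d}) (matching_graph t)"
    by (rule embedding_matching[OF _ matching]) blast
  have "embedding (glue f {c, d} g) ({c, d} \<union> (V - {c, d}))
      (graph_join (complete_graph 2) (matching_graph t))"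
    by (intro embedding_join[OF embedding_f embedding_g]) blast
  moreover have "{c, d} \<union> (V - {c, d}) = V" using centers by blast
  ultimately have "is_subgraph_of G (graph_join (complete_graph 2) (matching_graph t))"
    by (intro is_subgraph_of_if_embedding pair_graph_graph_join pair_graph_complete_graph
        pair_graph_matching_graph) auto
  then show ?thesis using t_ge by blast
qed

lemma nearly_min_degreeI:
  assumes "connected (with_proj G)" "card {v \<in> V. \<not> out_degree (with_proj G) v \<ge> k} \<le> 1" "k \<ge> 1"
  shows "nearly_min_degree V adj k"
proof unfold_locales
  show is_connected by (rule is_connected_if_connected(1)[OF assms(1)])
  let ?low = "{v \<in> V. \<not> out_degree (with_proj G) v \<ge> k}"
  have "\<forall>x\<in>?low. \<forall>y\<in>?low. x = y"
    using card_le_Suc0_iff_eq[of ?low] assms(2) finite_V by simp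
  then show "x = y" if "x \<in> V" "y \<in> V" "deg x < k" "deg y < k" for x y
    using that by (simp add: out_degree_eq_deg)
qed (rule assms(3))

end

theorem theorem3p3:
  fixes G :: "'a pair_pre_digraph" and k n :: nat
  assumes "k \<ge> 1"
    and "pair_graph G"
    and "connected (with_proj G)"
    and "card (pverts G) = n"
    and "\<not> contains_path_on G (min n (2 * k + 3))"
    and "card {v \<in> pverts G. \<not> out_degree (with_proj G) v \<ge> k} \<le> 1"
  shows
    "(is_subgraph_of G (H_graph (2 * k + 2) (2 * k + 1) k) \<or>
      (n \<ge> 2 * k + 3 \<and> is_subgraph_of G (H_graph n (2 * k + 2) k)))
   \<or> (\<exists>t\<ge>1. is_subgraph_of G
        (graph_join (complete_graph 1)
          (graph_union (copies t (complete_graph k))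
            (graph_union (complete_graph (k + 1)) (complete_graph 1)))))
   \<or> (\<exists>s\<ge>1. \<exists>t\<ge>1. is_subgraph_of G (linked_graph k s t))
   \<or> (k = 2 \<and>
       ((\<exists>t\<ge>6. is_subgraph_of G (graph_join (complete_graph 1) (matching_graph t))) \<or>
        (\<exists>s t. s \<ge> 1 \<and> s + t \<ge> 6 \<and>
          is_subgraph_of G
            (graph_join (complete_graph 1) (graph_union (star_graph s) (matching_graph t))))))
   \<or> (k = 3 \<and>
       (\<exists>t\<ge>7. is_subgraph_of G (graph_join (complete_graph 2) (matching_graph t))))"
proof -
  interpret graph_of_pair_graph G by (rule graph_of_pair_graph.intro[OF assms(2)])
  interpret nearly_min_degree V adj k by (rule nearly_min_degreeI[OF assms(3,6,1)])
  have "\<nexists>p. is_path p \<and> length p = min (card V) (2 * k + 3)"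
    using assms(4,5) by (simp add: contains_path_on_def is_path_iff_vpath)
  then have extremal by (rule extremal_if_no_path[OF is_connected_if_connected(2)[OF assms(3)]])
  moreover have "covered_except k 2" if "covered_except k 1" "2 * k + 2 \<le> n"
    using covered_except_mono[OF that(1), of 2] that(2) assms(4) by simp
  ultimately consider (small) "n = 2 * k + 2" "covered_except k 1"
    | (large) "2 * k + 3 \<le> n" "covered_except k 2"
    | "small_components_but_one k" | "linked_small_components k"
    | "k = 2" hub_star_matching | "k = 3" two_hubs_matching
    using assms(4) unfolding extremal_def by fastforce
  then show ?thesis
  proof cases
    case small
    then show ?thesis using subgraph_H_graph assms(4) by fastforce
  next
    case large
    then show ?thesis using subgraph_H_graph assms(4) by blast
  qed (use subgraph_of_cut_vertex_graph subgraph_of_linked_graph subgraph_of_hub_star_matching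
      subgraph_of_two_hubs_matching in blast)+
qed

end
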